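(* For every odd prime $p$, $$E_1^{*,*}[\mathfrak{sl}_2(\mathbb{F}_p)]=H^*(\mathfrak{sl}_2(\mathbb{F}_p),Poly(ad^* ))\sim\Lambda^*(u)\otimes\mathbb{F}_p[\kappa],$$ where $\sim$ indicates isomorphism in the range of Hodge degrees strictly less than $p-1$, and $u$ has Hodge degree $0$ and exterior degree $3$, $\kappa$ has Hodge degree $2$ and exterior degree $0$. (For $p=2$ the isomorphism breaks down already at Hodge degree $0$.) However, for every odd prime $p$ the isomorphism breaks down at Hodge degree $p-1$, and one needs minimally $17$ generators to generate the algebra $H^*(\mathfrak{sl}_2(\mathbb{F}_p),Poly(ad^* ))$ through Hodge degree $p$. It follows that $H^*(\mathfrak{sl}_2(\mathbb{Z}),Poly(ad^* ))$ has $p$-torsion for every prime $p$ and hence cannot be a finitely generated ring.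
   Context: For $\mathbf{k}=\mathbb{F}_p$ or $\mathbb{Z}$, let $\mathfrak{g}=\mathfrak{sl}_2(\mathbf{k})$ with basis $e_1,e_2,e_3$ and structure constants $[e_i,e_j]=\sum_kc_{ij}^ke_k$. Let $x_i$ be the dual basis in $\Lambda^1(\mathfrak{g}^* )$ and $y_i$ the same dual basis in $Poly^1(\mathfrak{g}^* )$, $E_0^{*,*}=\Lambda^*(x_1,x_2,x_3)\otimes\mathbf{k}[y_1,y_2,y_3]$ with $x_i\in E_0^{0,1}$, $y_i\in E_0^{1,0}$. In $E_0^{s,t}$, $s$ is the Hodge (polynomial) degree, $t$ the exterior degree and $2s+t$ the total degree. The derivation $d_0$ (signs by total degree) is $d_0(x_i)=-\sum_{j<k}c_{jk}^ix_jx_k$, $d_0(y_i)=\sum_{j,k}c_{jk}^iy_jx_k$, and $E_1^{s,t}=H^{s,t}(E_0,d_0)=H^t(\mathfrak{g},Poly^s(ad^* ))$, where $Poly^s(ad^* )$ is the module of homogeneous degree $s$ polynomials on $\mathfrak{g}$ with the dual adjoint action (by derivations), $Poly(ad^* )=\bigoplus_sPoly^s(ad^* )$. The algebra structure is induced from $E_0$. Generating "through Hodge degree $p$" means generating all elements of Hodge degree $\le p$. *)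

theory Defs
  imports
    "HOL-Analysis.Determinants"
    "HOL-Library.Poly_Mapping"
    "HOL-Library.Numeral_Type"
    "HOL-Algebra.QuotRing"
    "HOL-Algebra.Generated_Rings"
    "Berlekamp_Zassenhaus.Finite_Field"
begin

section \<open>The bigraded algebra $\Lambda^*(x_i) \otimes k[y_j]$\<close>

text \<open>
  An element is the family of its polynomial coefficients with respect to the basis of the
  exterior algebra consisting of the increasing products $x_S = x_{i_1} \cdots x_{i_r}$,
  $S = \{i_1 < \dots < i_r\}$. Polynomials in the $y_j$ are finitely supported functions on
  exponent vectors.
\<close>

typedef (overloaded) ('x, 'y, 'k) ext_poly = "UNIV :: ('x set \<Rightarrow> ('y \<Rightarrow>\<^sub>0 nat) \<Rightarrow>\<^sub>0 'k::zero) set"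
  morphisms coef ExtPoly ..

setup_lifting type_definition_ext_poly

lemma ext_poly_eqI: "(\<And>S. coef f S = coef g S) \<Longrightarrow> f = g"
  by transfer blast

text \<open>For disjoint \<open>S\<close>, \<open>T\<close> one has $x_S x_T = \pm x_{S \cup T}$ with this sign.\<close>

definition inv_sign :: "'x::linorder set \<Rightarrow> 'x set \<Rightarrow> int" where
  "inv_sign S T = (- 1) ^ card {(i, j). i \<in> S \<and> j \<in> T \<and> j < i}"

lemma inv_sign_empty [simp]: "inv_sign {} T = 1" "inv_sign S {} = 1"
  by (simp_all add: inv_sign_def)

lemma inv_sign_Un_left:
  fixes S T W :: "'x::{finite,linorder} set"
  assumes "S \<inter> T = {}"
  shows "inv_sign (S \<union> T) W = inv_sign S W * inv_sign T W"
proof -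
  have "{(i, j). i \<in> S \<union> T \<and> j \<in> W \<and> j < i} =
        {(i, j). i \<in> S \<and> j \<in> W \<and> j < i} \<union> {(i, j). i \<in> T \<and> j \<in> W \<and> j < i}"
    by auto
  moreover have "card \<dots> = card {(i, j). i \<in> S \<and> j \<in> W \<and> j < i} + card {(i, j). i \<in> T \<and> j \<in> W \<and> j < i}"
    using assms by (intro card_Un_disjoint) auto
  ultimately show ?thesis by (simp add: inv_sign_def power_add)
qed

lemma inv_sign_Un_right:
  fixes S T W :: "'x::{finite,linorder} set"
  assumes "T \<inter> W = {}"
  shows "inv_sign S (T \<union> W) = inv_sign S T * inv_sign S W"
proof -
  have "{(i, j). i \<in> S \<and> j \<in> T \<union> W \<and> j < i} =
        {(i, j). i \<in> S \<and> j \<in> T \<and> j < i} \<union> {(i, j). i \<in> S \<and> j \<in> W \<and> j < i}"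
    by auto
  moreover have "card \<dots> = card {(i, j). i \<in> S \<and> j \<in> T \<and> j < i} + card {(i, j). i \<in> S \<and> j \<in> W \<and> j < i}"
    using assms by (intro card_Un_disjoint) auto
  ultimately show ?thesis by (simp add: inv_sign_def power_add)
qed

instantiation ext_poly :: ("{finite,linorder}", type, comm_ring_1) ring_1
begin

lift_definition zero_ext_poly :: "('a, 'b, 'c) ext_poly" is "\<lambda>S. 0" .
lift_definition one_ext_poly :: "('a, 'b, 'c) ext_poly" is "\<lambda>S. if S = {} then 1 else 0" .
lift_definition plus_ext_poly :: "('a, 'b, 'c) ext_poly \<Rightarrow> ('a, 'b, 'c) ext_poly \<Rightarrow> ('a, 'b, 'c) ext_poly"
  is "\<lambda>f g S. f S + g S" .
lift_definition minus_ext_poly :: "('a, 'b, 'c) ext_poly \<Rightarrow> ('a, 'b, 'c) ext_poly \<Rightarrow> ('a, 'b, 'c) ext_poly"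
  is "\<lambda>f g S. f S - g S" .
lift_definition uminus_ext_poly :: "('a, 'b, 'c) ext_poly \<Rightarrow> ('a, 'b, 'c) ext_poly"
  is "\<lambda>f S. - f S" .
lift_definition times_ext_poly :: "('a, 'b, 'c) ext_poly \<Rightarrow> ('a, 'b, 'c) ext_poly \<Rightarrow> ('a, 'b, 'c) ext_poly"
  is "\<lambda>f g U. \<Sum>S\<in>Pow U. of_int (inv_sign S (U - S)) * f S * g (U - S)" .

instance
proof
  fix f g h :: "('a, 'b, 'c) ext_poly"
  show "f * g * h = f * (g * h)"
  proof (rule ext_poly_eqI)
    fix U
    let ?F = "coef f" and ?G = "coef g" and ?H = "coef h"
    have "coef (f * g * h) U = (\<Sum>V\<in>Pow U. \<Sum>S\<in>Pow V. of_int (inv_sign V (U - V)) *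
            (of_int (inv_sign S (V - S)) * ?F S * ?G (V - S)) * ?H (U - V))"
      by (simp add: times_ext_poly.rep_eq sum_distrib_left sum_distrib_right)
    also have "\<dots> = (\<Sum>(V, S)\<in>Sigma (Pow U) Pow. of_int (inv_sign V (U - V)) *
            (of_int (inv_sign S (V - S)) * ?F S * ?G (V - S)) * ?H (U - V))"
      by (subst sum.Sigma) auto
    also have "\<dots> = (\<Sum>(S, T)\<in>Sigma (Pow U) (\<lambda>S. Pow (U - S)). of_int (inv_sign S (U - S)) * ?F S *
            (of_int (inv_sign T (U - S - T)) * ?G T * ?H (U - S - T)))"
    proof (rule sum.reindex_bij_witness[of _ "\<lambda>(S, T). (S \<union> T, S)" "\<lambda>(V, S). (S, V - S)"], goal_cases)
      case (5 a)
      obtain V S where a: "a = (V, S)" by (cases a)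
      with 5 have sub: "V \<subseteq> U" "S \<subseteq> V" by auto
      have d: "U - S - (V - S) = U - V" using sub by auto
      have "inv_sign V (U - V) = inv_sign S (U - V) * inv_sign (V - S) (U - V)"
        using sub inv_sign_Un_left[of S "V - S" "U - V"] by (simp add: Un_absorb1)
      moreover have "inv_sign S (U - S) = inv_sign S (V - S) * inv_sign S (U - V)"
      proof -
        have "U - S = (V - S) \<union> (U - V)" using sub by auto
        then show ?thesis using inv_sign_Un_right[of "V - S" "U - V" S] by auto
      qed
      ultimately show ?case by (simp add: a d mult_ac)
    qed auto
    also have "\<dots> = (\<Sum>S\<in>Pow U. \<Sum>T\<in>Pow (U - S). of_int (inv_sign S (U - S)) * ?F S *
            (of_int (inv_sign T (U - S - T)) * ?G T * ?H (U - S - T)))"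
      by (subst sum.Sigma) auto
    also have "\<dots> = coef (f * (g * h)) U"
      by (simp add: times_ext_poly.rep_eq sum_distrib_left sum_distrib_right)
    finally show "coef (f * g * h) U = coef (f * (g * h)) U" .
  qed
  show "1 * f = f"
  proof (rule ext_poly_eqI)
    fix U
    have "coef (1 * f) U = (\<Sum>S\<in>Pow U. if S = {} then coef f U else 0)"
      unfolding times_ext_poly.rep_eq by (rule sum.cong) (simp_all add: one_ext_poly.rep_eq)
    also have "\<dots> = coef f U" by simp
    finally show "coef (1 * f) U = coef f U" .
  qed
  show "f * 1 = f"
  proof (rule ext_poly_eqI)
    fix U
    have "coef (f * 1) U = (\<Sum>S\<in>Pow U. if S = U then coef f U else 0)"
      unfolding times_ext_poly.rep_eq by (rule sum.cong) (auto simp add: one_ext_poly.rep_eq)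
    also have "\<dots> = coef f U" by simp
    finally show "coef (f * 1) U = coef f U" .
  qed
  show "(f + g) * h = f * h + g * h" "f * (g + h) = f * g + f * h"
    by (rule ext_poly_eqI; simp add: times_ext_poly.rep_eq plus_ext_poly.rep_eq algebra_simps sum.distrib)+
  show "(0 :: ('a, 'b, 'c) ext_poly) \<noteq> 1"
    by transfer (metis zero_neq_one)
qed (rule ext_poly_eqI; simp add: plus_ext_poly.rep_eq minus_ext_poly.rep_eq zero_ext_poly.rep_eq
       uminus_ext_poly.rep_eq algebra_simps)+

end

lift_definition ext_const :: "'k \<Rightarrow> ('x, 'y, 'k::comm_ring_1) ext_poly"
  is "\<lambda>a S. if S = {} then Poly_Mapping.single 0 a else 0" .

lift_definition gen_x :: "'x \<Rightarrow> ('x, 'y, 'k::comm_ring_1) ext_poly"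
  is "\<lambda>i S. if S = {i} then 1 else 0" .

lift_definition gen_y :: "'y \<Rightarrow> ('x, 'y, 'k::comm_ring_1) ext_poly"
  is "\<lambda>j S. if S = {} then Poly_Mapping.single (Poly_Mapping.single j 1) 1 else 0" .

text \<open>
  Component of Hodge degree \<open>s\<close> and exterior degree \<open>t\<close>, when every \<open>x\<^sub>i\<close> has bidegree
  $(0, b)$ and every \<open>y\<^sub>j\<close> has bidegree $(a, 0)$.
\<close>

definition bicomp :: "nat \<Rightarrow> nat \<Rightarrow> nat \<Rightarrow> nat \<Rightarrow> ('x, 'y::finite, 'k::zero) ext_poly set" where
  "bicomp a b s t = {f. \<forall>S m. Poly_Mapping.lookup (coef f S) m \<noteq> 0 \<longrightarrow>
     a * (\<Sum>j\<in>UNIV. Poly_Mapping.lookup m j) = s \<and> b * card S = t}"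

section \<open>The complex $(E_0, d_0)$\<close>

type_synonym ('n, 'k) E0 = "('n, 'n, 'k) ext_poly"

abbreviation E0_comp :: "nat \<Rightarrow> nat \<Rightarrow> ('n::finite, 'k::zero) E0 set" where
  "E0_comp \<equiv> bicomp 1 1"

definition E0_total :: "nat \<Rightarrow> ('n::finite, 'k::zero) E0 set" where
  "E0_total n = {f. \<forall>S m. Poly_Mapping.lookup (coef f S) m \<noteq> 0 \<longrightarrow>
     2 * (\<Sum>j\<in>UNIV. Poly_Mapping.lookup m j) + card S = n}"

definition is_d0 ::
  "('n \<Rightarrow> 'n \<Rightarrow> 'n \<Rightarrow> 'k) \<Rightarrow> (('n::{finite,linorder}, 'k::comm_ring_1) E0 \<Rightarrow> ('n, 'k) E0) \<Rightarrow> bool" where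
  "is_d0 c d \<longleftrightarrow>
     (\<forall>f g. d (f + g) = d f + d g) \<and>
     (\<forall>a f. d (ext_const a * f) = ext_const a * d f) \<and>
     (\<forall>n. \<forall>f\<in>E0_total n. \<forall>g. d (f * g) = d f * g + (- 1) ^ n * f * d g) \<and>
     (\<forall>i. d (gen_x i) = - (\<Sum>j\<in>UNIV. \<Sum>k\<in>{j<..}. ext_const (c j k i) * gen_x j * gen_x k)) \<and>
     (\<forall>i. d (gen_y i) = (\<Sum>j\<in>UNIV. \<Sum>k\<in>UNIV. ext_const (c j k i) * gen_y j * gen_x k))"

definition d0 ::
  "('n \<Rightarrow> 'n \<Rightarrow> 'n \<Rightarrow> 'k) \<Rightarrow> ('n::{finite,linorder}, 'k::comm_ring_1) E0 \<Rightarrow> ('n, 'k) E0" where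
  "d0 c = (THE d. is_d0 c d)"

subsection \<open>Existence and uniqueness of $d_0$\<close>

lemma pm_induct [case_names single add]:
  fixes q :: "'a \<Rightarrow>\<^sub>0 'b::comm_monoid_add"
  assumes single: "\<And>m a. P (Poly_Mapping.single m a)"
    and add: "\<And>f g. P f \<Longrightarrow> P g \<Longrightarrow> P (f + g)"
  shows "P q"
proof (induction q rule: update_induct)
  case const
  then show ?case using single[of undefined 0] by simp
next
  case (update f a b)
  then have "Poly_Mapping.update a b f = f + Poly_Mapping.single a b"
    by (intro poly_mapping_eqI)
       (auto simp: lookup_update lookup_add lookup_single in_keys_iff)
  then show ?case using add[OF update(3) single] by simp
qed

lemma lookup_single_mult:
  fixes q :: "('y \<Rightarrow>\<^sub>0 nat) \<Rightarrow>\<^sub>0 'k::comm_ring_1"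
  shows "Poly_Mapping.lookup (Poly_Mapping.single 0 a * q) m = a * Poly_Mapping.lookup q m"
proof (induction q rule: pm_induct)
  case (single n b)
  then show ?case by (simp add: mult_single lookup_single when_def)
qed (simp add: lookup_add distrib_left)

context
  fixes i :: 'y
begin

lift_definition pd :: "(('y \<Rightarrow>\<^sub>0 nat) \<Rightarrow>\<^sub>0 'k::comm_ring_1) \<Rightarrow> ('y \<Rightarrow>\<^sub>0 nat) \<Rightarrow>\<^sub>0 'k"
  is "\<lambda>q m. of_nat (Suc (Poly_Mapping.lookup m i)) * q (m + Poly_Mapping.single i 1)"
proof -
  fix q :: "('y \<Rightarrow>\<^sub>0 nat) \<Rightarrow> 'k"
  assume "finite {m. q m \<noteq> 0}"
  then have "finite ((\<lambda>m. m + Poly_Mapping.single i 1) -` {m. q m \<noteq> 0})"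
    by (rule finite_vimageI) (auto simp: inj_def)
  then show "finite {m. of_nat (Suc (Poly_Mapping.lookup m i)) * q (m + Poly_Mapping.single i 1) \<noteq> 0}"
    by (rule rev_finite_subset) auto
qed

lemma pd_add: "pd (q + r) = pd q + pd r"
  by (rule poly_mapping_eqI) (simp add: pd.rep_eq lookup_add distrib_left)

lemma pd_0 [simp]: "pd 0 = 0"
  by (rule poly_mapping_eqI) (simp add: pd.rep_eq)

lemma pd_uminus: "pd (- q) = - pd q"
  by (rule poly_mapping_eqI) (simp add: pd.rep_eq)

lemma pd_sum: "pd (sum f A) = (\<Sum>x\<in>A. pd (f x))"
  by (induction A rule: infinite_finite_induct) (simp_all add: pd_add)

lemma pd_single:
  "pd (Poly_Mapping.single m a) =
     Poly_Mapping.single (m - Poly_Mapping.single i 1) (of_nat (Poly_Mapping.lookup m i) * a)"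
proof (rule poly_mapping_eqI)
  fix n
  have eq: "m = n + Poly_Mapping.single i 1 \<longleftrightarrow>
        m - Poly_Mapping.single i 1 = n \<and> Poly_Mapping.lookup m i \<noteq> 0"
    by (auto simp: poly_mapping_eq_iff fun_eq_iff lookup_add lookup_minus lookup_single when_def)
  have "Poly_Mapping.lookup (pd (Poly_Mapping.single m a)) n =
      of_nat (Suc (Poly_Mapping.lookup n i)) * (if m = n + Poly_Mapping.single i 1 then a else 0)"
    by (simp add: pd.rep_eq lookup_single when_def)
  also have "\<dots> = of_nat (Poly_Mapping.lookup m i) * (if m = n + Poly_Mapping.single i 1 then a else 0)"
    by (auto simp: lookup_add)
  also have "\<dots> = (if m - Poly_Mapping.single i 1 = n then of_nat (Poly_Mapping.lookup m i) * a else 0)"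
    unfolding eq by auto
  finally show "Poly_Mapping.lookup (pd (Poly_Mapping.single m a)) n =
      Poly_Mapping.lookup (Poly_Mapping.single (m - Poly_Mapping.single i 1)
        (of_nat (Poly_Mapping.lookup m i) * a)) n"
    by (simp add: lookup_single when_def)
qed

lemma pd_mult: fixes q r :: "('y \<Rightarrow>\<^sub>0 nat) \<Rightarrow>\<^sub>0 'k::comm_ring_1" shows "pd (q * r) = pd q * r + q * pd r"
proof (induction q rule: pm_induct)
  case (single m a)
  show ?case
  proof (induction r rule: pm_induct)
    case (single n b)
    let ?e = "Poly_Mapping.single i (1::nat)"
    let ?m = "of_nat (Poly_Mapping.lookup m i) :: 'k" and ?n = "of_nat (Poly_Mapping.lookup n i) :: 'k"
    have A: "Poly_Mapping.single (m - ?e + n) (?m * a * b) = Poly_Mapping.single (m + n - ?e) (?m * a * b)"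
    proof (cases "Poly_Mapping.lookup m i = 0")
      case False
      then have "m - ?e + n = m + n - ?e"
        by (intro poly_mapping_eqI) (auto simp: lookup_add lookup_minus lookup_single when_def)
      then show ?thesis by simp
    qed simp
    have B: "Poly_Mapping.single (m + (n - ?e)) (a * (?n * b)) = Poly_Mapping.single (m + n - ?e) (a * (?n * b))"
    proof (cases "Poly_Mapping.lookup n i = 0")
      case False
      then have "m + (n - ?e) = m + n - ?e"
        by (intro poly_mapping_eqI) (auto simp: lookup_add lookup_minus lookup_single when_def)
      then show ?thesis by simp
    qed simp
    have "pd (Poly_Mapping.single m a * Poly_Mapping.single n b) =
        Poly_Mapping.single (m + n - ?e) (?m * a * b + a * (?n * b))"
      by (simp add: mult_single pd_single lookup_add algebra_simps)
    also have "\<dots> = Poly_Mapping.single (m - ?e + n) (?m * a * b) + Poly_Mapping.single (m + (n - ?e)) (a * (?n * b))"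
      unfolding A B by (rule single_add)
    also have "\<dots> = pd (Poly_Mapping.single m a) * Poly_Mapping.single n b +
        Poly_Mapping.single m a * pd (Poly_Mapping.single n b)"
      unfolding pd_single mult_single ..
    finally show ?case .
  qed (simp add: pd_add distrib_left add_ac)
qed (simp add: pd_add distrib_right add_ac)

end

lift_definition ext_dy :: "'y \<Rightarrow> ('x, 'y, 'k::comm_ring_1) ext_poly \<Rightarrow> ('x, 'y, 'k) ext_poly"
  is "\<lambda>i f S. pd i (f S)" .

lift_definition ext_dx :: "'x::linorder \<Rightarrow> ('x, 'y, 'k::comm_ring_1) ext_poly \<Rightarrow> ('x, 'y, 'k) ext_poly"
  is "\<lambda>i f S. if i \<in> S then 0 else of_int (inv_sign {i} S) * f (insert i S)" .

lift_definition ext_parity :: "('x, 'y, 'k::comm_ring_1) ext_poly \<Rightarrow> ('x, 'y, 'k) ext_poly"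
  is "\<lambda>f S. (- 1) ^ card S * f S" .

lemmas ext_poly_coef = times_ext_poly.rep_eq plus_ext_poly.rep_eq uminus_ext_poly.rep_eq
  zero_ext_poly.rep_eq one_ext_poly.rep_eq minus_ext_poly.rep_eq
  ext_const.rep_eq gen_x.rep_eq gen_y.rep_eq ext_dx.rep_eq ext_dy.rep_eq ext_parity.rep_eq

lemma pd_of_int [simp]: "pd i (of_int n :: ('a \<Rightarrow>\<^sub>0 nat) \<Rightarrow>\<^sub>0 'k::comm_ring_1) = 0"
  unfolding single_of_int[symmetric] by (simp add: pd_single del: single_of_int)

lemma pd_1 [simp]: "pd i (1 :: ('a \<Rightarrow>\<^sub>0 nat) \<Rightarrow>\<^sub>0 'k::comm_ring_1) = 0"
  using pd_of_int[of i 1] by simp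

lemma pd_var: "pd i (Poly_Mapping.single (Poly_Mapping.single j 1) 1) =
    (if i = j then 1 else (0 :: ('a \<Rightarrow>\<^sub>0 nat) \<Rightarrow>\<^sub>0 'k::comm_ring_1))"
  by (simp add: pd_single lookup_single)

context
  fixes f g :: "('x::{finite,linorder}, 'y, 'k::comm_ring_1) ext_poly"
begin

lemma coef_const_mult: "coef (ext_const a * f) U = Poly_Mapping.single 0 a * coef f U"
proof -
  have "coef (ext_const a * f) U = (\<Sum>S\<in>Pow U. if S = {} then Poly_Mapping.single 0 a * coef f U else 0)"
    unfolding times_ext_poly.rep_eq by (rule sum.cong) (simp_all add: ext_const.rep_eq)
  then show ?thesis by simp
qed

lemma coef_mult_const: "coef (f * ext_const a) U = Poly_Mapping.single 0 a * coef f U"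
proof -
  have "coef (f * ext_const a) U = (\<Sum>S\<in>Pow U. if S = U then Poly_Mapping.single 0 a * coef f U else 0)"
    unfolding times_ext_poly.rep_eq by (rule sum.cong) (auto simp: ext_const.rep_eq)
  then show ?thesis by simp
qed

lemma ext_const_commute: "ext_const a * f = f * ext_const a"
  by (rule ext_poly_eqI) (simp add: coef_const_mult coef_mult_const)

lemma coef_gen_y_mult: "coef (gen_y j * f) U = Poly_Mapping.single (Poly_Mapping.single j 1) 1 * coef f U"
proof -
  have "coef (gen_y j * f) U =
      (\<Sum>S\<in>Pow U. if S = {} then Poly_Mapping.single (Poly_Mapping.single j 1) 1 * coef f U else 0)"
    unfolding times_ext_poly.rep_eq by (rule sum.cong) (simp_all add: gen_y.rep_eq)
  then show ?thesis by simp
qed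

lemma gen_y_commute: "gen_y j * f = f * gen_y j"
proof (rule ext_poly_eqI)
  fix U
  have "coef (f * gen_y j) U =
      (\<Sum>S\<in>Pow U. if S = U then Poly_Mapping.single (Poly_Mapping.single j 1) 1 * coef f U else 0)"
    unfolding times_ext_poly.rep_eq by (rule sum.cong) (auto simp: gen_y.rep_eq)
  then show "coef (gen_y j * f) U = coef (f * gen_y j) U" by (simp add: coef_gen_y_mult)
qed

lemma coef_gen_x_mult:
  "coef (gen_x j * f) U = (if j \<in> U then of_int (inv_sign {j} (U - {j})) * coef f (U - {j}) else 0)"
proof -
  have "coef (gen_x j * f) U =
      (\<Sum>S\<in>Pow U. if S = {j} then of_int (inv_sign {j} (U - {j})) * coef f (U - {j}) else 0)"
    unfolding times_ext_poly.rep_eq by (rule sum.cong) (auto simp: gen_x.rep_eq)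
  then show ?thesis by simp
qed

lemma inv_sign_swap:
  assumes "j \<notin> S"
  shows "inv_sign {j} S * inv_sign S {j} = (- 1) ^ card (S :: 'x set)"
proof -
  have "{(i, k). i \<in> {j} \<and> k \<in> S \<and> k < i} = Pair j ` {k\<in>S. k < j}"
    "{(i, k). i \<in> S \<and> k \<in> {j} \<and> k < i} = (\<lambda>i. (i, j)) ` {k\<in>S. j < k}"
    by auto
  then have "card {(i, k). i \<in> {j} \<and> k \<in> S \<and> k < i} = card {k\<in>S. k < j}"
    "card {(i, k). i \<in> S \<and> k \<in> {j} \<and> k < i} = card {k\<in>S. j < k}"
    by (simp_all add: card_image inj_on_def)
  moreover have "S = {k\<in>S. k < j} \<union> {k\<in>S. j < k}"
  proof (intro equalityI subsetI)
    fix x assume "x \<in> S"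
    moreover have "x \<noteq> j" using assms \<open>x \<in> S\<close> by auto
    ultimately show "x \<in> {k\<in>S. k < j} \<union> {k\<in>S. j < k}" by (cases x j rule: linorder_cases) auto
  qed auto
  then have "card S = card ({k\<in>S. k < j} \<union> {k\<in>S. j < k})"
    by simp
  then have "card S = card {k\<in>S. k < j} + card {k\<in>S. j < k}"
    by (subst (asm) card_Un_disjoint) auto
  ultimately show ?thesis by (simp add: inv_sign_def power_add)
qed

lemma inv_sign_square: "inv_sign S T * inv_sign S T = 1"
  by (simp add: inv_sign_def flip: power_add)

lemma gen_x_commute: "gen_x j * f = ext_parity f * gen_x j"
proof (rule ext_poly_eqI)
  fix U
  have "coef (ext_parity f * gen_x j) U =
      (\<Sum>S\<in>Pow U. if S = U - {j} then if j \<in> U then of_int (inv_sign (U - {j}) {j}) *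
         ((- 1) ^ card (U - {j}) * coef f (U - {j})) else 0 else 0)"
    unfolding times_ext_poly.rep_eq
  proof (rule sum.cong)
    fix S assume "S \<in> Pow U"
    moreover have "j \<in> U \<Longrightarrow> U - (U - {j}) = {j}" by auto
    ultimately show "of_int (inv_sign S (U - S)) * coef (ext_parity f) S * coef (gen_x j) (U - S) =
       (if S = U - {j} then if j \<in> U then of_int (inv_sign (U - {j}) {j}) *
         ((- 1) ^ card (U - {j}) * coef f (U - {j})) else 0 else 0)"
      by (auto simp: gen_x.rep_eq ext_parity.rep_eq)
  qed simp
  moreover have "inv_sign (U - {j}) {j} * (- 1) ^ card (U - {j}) = inv_sign {j} (U - {j})"
  proof -
    have "inv_sign (U - {j}) {j} * (inv_sign {j} (U - {j}) * inv_sign (U - {j}) {j}) =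
        inv_sign {j} (U - {j})"
      using inv_sign_square[of "U - {j}" "{j}"] by (simp add: mult_ac)
    then show ?thesis by (simp add: inv_sign_swap)
  qed
  note sgn = this
  have "of_int (inv_sign (U - {j}) {j}) * ((- 1) ^ card (U - {j}) * q) =
      of_int (inv_sign {j} (U - {j})) * q" for q :: "('y \<Rightarrow>\<^sub>0 nat) \<Rightarrow>\<^sub>0 'k"
    unfolding sgn[symmetric] by (simp add: mult.assoc)
  ultimately show "coef (gen_x j * f) U = coef (ext_parity f * gen_x j) U"
    by (cases "j \<in> U") (simp_all add: coef_gen_x_mult del: card_Diff_singleton card_Diff_insert)
qed

lemma ext_dy_mult: "ext_dy i (f * g) = ext_dy i f * g + f * ext_dy i g"
  by (rule ext_poly_eqI)
     (simp add: ext_poly_coef pd_sum pd_mult mult.assoc distrib_left sum.distrib)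

lemma ext_dx_mult: "ext_dx i (f * g) = ext_dx i f * g + ext_parity f * ext_dx i g"
proof (rule ext_poly_eqI)
  fix U
  show "coef (ext_dx i (f * g)) U = coef (ext_dx i f * g + ext_parity f * ext_dx i g) U"
  proof (cases "i \<in> U")
    case True
    let ?F = "coef f" and ?G = "coef g"
    define W where "W = U - {i}"
    have U: "U = insert i W" "i \<notin> W" using True by (auto simp: W_def)
    let ?l = "\<lambda>S. of_int (inv_sign S (U - S)) * coef (ext_dx i f) S * ?G (U - S)"
    let ?r = "\<lambda>S. of_int (inv_sign S (U - S)) * coef (ext_parity f) S * coef (ext_dx i g) (U - S)"
    have split: "sum h (Pow U) = (\<Sum>S\<in>Pow W. h (insert i S)) + (\<Sum>S\<in>Pow W. h S)"
      for h :: "'x set \<Rightarrow> ('y \<Rightarrow>\<^sub>0 nat) \<Rightarrow>\<^sub>0 'k"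
    proof -
      have "sum h (Pow U) = sum h (insert i ` Pow W) + sum h (Pow W)"
        unfolding U Pow_insert by (subst sum.union_disjoint) (use U in auto)
      also have "sum h (insert i ` Pow W) = (\<Sum>S\<in>Pow W. h (insert i S))"
        using U by (subst sum.reindex) (auto intro!: inj_onI)
      finally show ?thesis .
    qed
    have "?r (insert i S) = - ?l S" if "S \<in> Pow W" for S
    proof -
      from that have S: "S \<subseteq> W" "i \<notin> S" using U by auto
      have d: "U - insert i S = W - S" "U - S = insert i (W - S)" using S U by auto
      have "inv_sign (insert i S) (W - S) = inv_sign {i} (W - S) * inv_sign S (W - S)"
        using inv_sign_Un_left[of "{i}" S "W - S"] S by auto
      moreover have "inv_sign S (insert i (W - S)) = inv_sign S {i} * inv_sign S (W - S)"
        using inv_sign_Un_right[of "{i}" "W - S" S] U by auto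
      ultimately have "inv_sign (insert i S) (W - S) * (- 1) ^ card (insert i S) * inv_sign {i} (W - S) =
          - (inv_sign S (insert i (W - S)) * inv_sign {i} S)"
        using inv_sign_swap[OF S(2)] inv_sign_square[of "{i}" "W - S"] S by (simp add: mult_ac)
      from arg_cong[OF this, of "of_int :: int \<Rightarrow> ('y \<Rightarrow>\<^sub>0 nat) \<Rightarrow>\<^sub>0 'k"]
      have "of_int (inv_sign (insert i S) (W - S)) * (- 1) ^ card (insert i S) * of_int (inv_sign {i} (W - S)) =
          - (of_int (inv_sign S (insert i (W - S))) * of_int (inv_sign {i} S) :: ('y \<Rightarrow>\<^sub>0 nat) \<Rightarrow>\<^sub>0 'k)"
        by (simp only: of_int_1 of_int_minus of_int_mult of_int_power)
      then have "(of_int (inv_sign (insert i S) (W - S)) * (- 1) ^ card (insert i S) * of_int (inv_sign {i} (W - S))) * q =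
          - (of_int (inv_sign S (insert i (W - S))) * of_int (inv_sign {i} S)) * q" for q :: "('y \<Rightarrow>\<^sub>0 nat) \<Rightarrow>\<^sub>0 'k"
        by simp
      from this[of "?F (insert i S) * ?G (insert i (W - S))"] show ?thesis
        using S U d by (simp add: ext_dx.rep_eq ext_parity.rep_eq mult_ac)
    qed
    then have "(\<Sum>S\<in>Pow W. ?r (insert i S)) = - (\<Sum>S\<in>Pow W. ?l S)"
      by (simp add: sum_negf)
    moreover have "(\<Sum>S\<in>Pow W. ?l (insert i S)) = 0" "(\<Sum>S\<in>Pow W. ?r S) = 0"
      using U by (auto intro!: sum.neutral simp: ext_dx.rep_eq)
    ultimately have "sum ?l (Pow U) + sum ?r (Pow U) = 0"
      unfolding split by simp
    then show ?thesis using True by (simp add: plus_ext_poly.rep_eq times_ext_poly.rep_eq ext_dx.rep_eq[of i "f * g"])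
  next
    case False
    let ?F = "coef f" and ?G = "coef g"
    let ?t = "\<lambda>S. of_int (inv_sign {i} U) * (of_int (inv_sign S (insert i U - S)) * ?F S * ?G (insert i U - S))"
    have "coef (ext_dx i (f * g)) U = (\<Sum>S\<in>Pow (insert i U). ?t S)"
      using False by (simp add: ext_poly_coef sum_distrib_left)
    also have "\<dots> = (\<Sum>S\<in>insert i ` Pow U. ?t S) + (\<Sum>S\<in>Pow U. ?t S)"
      unfolding Pow_insert by (subst sum.union_disjoint) (use False in auto)
    also have "(\<Sum>S\<in>insert i ` Pow U. ?t S) = (\<Sum>S\<in>Pow U. ?t (insert i S))"
      using False by (subst sum.reindex) (auto intro!: inj_onI)
    also have "\<dots> = (\<Sum>S\<in>Pow U. of_int (inv_sign S (U - S)) * coef (ext_dx i f) S * ?G (U - S))"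
    proof (rule sum.cong)
      fix S assume "S \<in> Pow U"
      then have S: "S \<subseteq> U" "i \<notin> S" using False by auto
      have d: "insert i U - insert i S = U - S" using False by auto
      have "U = S \<union> (U - S)" using S by auto
      then have "inv_sign {i} U = inv_sign {i} S * inv_sign {i} (U - S)"
        using inv_sign_Un_right[of S "U - S" "{i}"] by auto
      moreover have "inv_sign (insert i S) (U - S) = inv_sign {i} (U - S) * inv_sign S (U - S)"
        using inv_sign_Un_left[of "{i}" S "U - S"] S by auto
      ultimately have "inv_sign {i} U * inv_sign (insert i S) (U - S) = inv_sign S (U - S) * inv_sign {i} S"
        using inv_sign_square[of "{i}" "U - S"] by (simp add: mult_ac)
      from arg_cong[OF this, of "of_int :: int \<Rightarrow> ('y \<Rightarrow>\<^sub>0 nat) \<Rightarrow>\<^sub>0 'k"]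
      have "of_int (inv_sign {i} U) * (of_int (inv_sign (insert i S) (U - S)) * q) =
          of_int (inv_sign S (U - S)) * (of_int (inv_sign {i} S) * q)" for q :: "('y \<Rightarrow>\<^sub>0 nat) \<Rightarrow>\<^sub>0 'k"
        by (simp only: of_int_mult mult.assoc[symmetric])
      then show "?t (insert i S) = of_int (inv_sign S (U - S)) * coef (ext_dx i f) S * ?G (U - S)"
        using S d by (simp add: ext_dx.rep_eq mult.assoc)
    qed simp
    also have "(\<Sum>S\<in>Pow U. ?t S) =
        (\<Sum>S\<in>Pow U. of_int (inv_sign S (U - S)) * coef (ext_parity f) S * coef (ext_dx i g) (U - S))"
    proof (rule sum.cong)
      fix S assume "S \<in> Pow U"
      then have S: "S \<subseteq> U" "i \<notin> S" using False by auto
      have d: "insert i U - S = insert i (U - S)" using S by auto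
      have "U = S \<union> (U - S)" using S by auto
      then have "inv_sign {i} U = inv_sign {i} S * inv_sign {i} (U - S)"
        using inv_sign_Un_right[of S "U - S" "{i}"] by auto
      moreover have "inv_sign S (insert i (U - S)) = inv_sign S {i} * inv_sign S (U - S)"
        using inv_sign_Un_right[of "{i}" "U - S" S] False by auto
      ultimately have "inv_sign {i} U * inv_sign S (insert i (U - S)) =
          inv_sign S (U - S) * (- 1) ^ card S * inv_sign {i} (U - S)"
        using inv_sign_swap[OF S(2)] by (simp add: mult_ac)
      from arg_cong[OF this, of "of_int :: int \<Rightarrow> ('y \<Rightarrow>\<^sub>0 nat) \<Rightarrow>\<^sub>0 'k"]
      have "of_int (inv_sign {i} U) * (of_int (inv_sign S (insert i (U - S))) * q) =
          of_int (inv_sign S (U - S)) * ((- 1) ^ card S * (of_int (inv_sign {i} (U - S)) * q))"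
        for q :: "('y \<Rightarrow>\<^sub>0 nat) \<Rightarrow>\<^sub>0 'k"
        by (simp only: of_int_mult of_int_1 of_int_minus of_int_power mult.assoc[symmetric])
      from this[of "?F S * ?G (insert i (U - S))"]
      show "?t S = of_int (inv_sign S (U - S)) * coef (ext_parity f) S * coef (ext_dx i g) (U - S)"
        using S d False by (simp add: ext_dx.rep_eq ext_parity.rep_eq mult_ac)
    qed simp
    finally show ?thesis by (simp add: ext_poly_coef)
  qed
qed

lemma ext_d_add: "ext_dx i (f + g) = ext_dx i f + ext_dx i g" "ext_dy j (f + g) = ext_dy j f + ext_dy j g"
  "ext_parity (f + g) = ext_parity f + ext_parity g"
  by (rule ext_poly_eqI; simp add: ext_poly_coef pd_add distrib_left)+

end

lemma ext_d_const: "ext_dx i (ext_const a) = 0" "ext_dy j (ext_const a) = 0" "ext_parity (ext_const a) = ext_const a"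
  by (rule ext_poly_eqI; simp add: ext_poly_coef pd_single)+

lemma ext_d_gen: "ext_dx i (gen_x j) = (if i = j then 1 else 0)" "ext_dx i (gen_y k) = 0"
  "ext_dy l (gen_x j) = 0" "ext_dy l (gen_y k) = (if l = k then 1 else 0)"
  by (rule ext_poly_eqI; auto simp: ext_poly_coef pd_var[unfolded One_nat_def])+

definition dgen_x where
  "dgen_x c i = - (\<Sum>j\<in>UNIV. \<Sum>k\<in>{j<..}. ext_const (c j k i) * gen_x j * gen_x k)"
definition dgen_y where
  "dgen_y c i = (\<Sum>j\<in>UNIV. \<Sum>k\<in>UNIV. ext_const (c j k i) * gen_y j * gen_x k)"

lemma ext_parity_parity [simp]: "ext_parity (ext_parity f) = f"
  by (rule ext_poly_eqI) (simp add: ext_poly_coef)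

lemma dgen_x_commute: "dgen_x c i * f = f * dgen_x c i"
proof -
  have "ext_const a * gen_x j * gen_x k * f = f * (ext_const a * gen_x j * gen_x k)" for a j k
  proof -
    have "gen_x j * (gen_x k * f) = f * (gen_x j * gen_x k)"
      using gen_x_commute[of k f] gen_x_commute[of j "ext_parity f"]
      by (simp flip: mult.assoc)
    then have "ext_const a * (gen_x j * gen_x k * f) = ext_const a * f * (gen_x j * gen_x k)"
      by (simp add: mult.assoc)
    then show ?thesis unfolding ext_const_commute[of a f] by (simp add: mult.assoc)
  qed
  then show ?thesis
    by (simp add: dgen_x_def sum_distrib_left sum_distrib_right)
qed

lemma dgen_y_commute: "dgen_y c i * f = ext_parity f * dgen_y c i"
proof -
  have "ext_const a * gen_y j * gen_x k * f = ext_parity f * (ext_const a * gen_y j * gen_x k)" for a j k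
  proof -
    have "ext_const a * gen_y j * gen_x k * f = ext_const a * (gen_y j * ext_parity f) * gen_x k"
      using gen_x_commute[of k f] by (simp add: mult.assoc)
    also have "\<dots> = ext_const a * ext_parity f * gen_y j * gen_x k"
      unfolding gen_y_commute[of j "ext_parity f"] by (simp add: mult.assoc)
    also have "\<dots> = ext_parity f * (ext_const a * gen_y j * gen_x k)"
      unfolding ext_const_commute[of a "ext_parity f"] by (simp add: mult.assoc)
    finally show ?thesis .
  qed
  then show ?thesis
    by (simp add: dgen_y_def sum_distrib_left sum_distrib_right)
qed

lemma ext_parity_total: "f \<in> E0_total n \<Longrightarrow> ext_parity f = (- 1) ^ n * f"
proof -
  assume f: "f \<in> E0_total n"
  have s: "(- 1) ^ n * f = (if even n then f else - f)" by simp
  show ?thesis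
  proof (rule ext_poly_eqI)
    fix S
    show "coef (ext_parity f) S = coef ((- 1) ^ n * f) S"
    proof (cases "coef f S = 0")
      case False
      then obtain m where "Poly_Mapping.lookup (coef f S) m \<noteq> 0"
        by (metis poly_mapping_eqI lookup_zero)
      with f have "2 * (\<Sum>j\<in>UNIV. Poly_Mapping.lookup m j) + card S = n"
        by (auto simp: E0_total_def)
      then have "even n \<longleftrightarrow> even (card S)" by auto
      then show ?thesis unfolding s by (auto simp: ext_poly_coef)
    qed (auto simp: ext_poly_coef s)
  qed
qed

lemma is_d0_exists:
  fixes c :: "'n::{finite,linorder} \<Rightarrow> 'n \<Rightarrow> 'n \<Rightarrow> 'k::comm_ring_1"
  shows "\<exists>d. is_d0 c d"
proof
  let ?d = "\<lambda>f. (\<Sum>i\<in>UNIV. dgen_x c i * ext_dx i f + dgen_y c i * ext_dy i f)"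
  have L: "?d (f * g) = ?d f * g + ext_parity f * ?d g" for f g
  proof -
    have "dgen_x c i * ext_dx i (f * g) + dgen_y c i * ext_dy i (f * g) =
        (dgen_x c i * ext_dx i f + dgen_y c i * ext_dy i f) * g +
        ext_parity f * (dgen_x c i * ext_dx i g + dgen_y c i * ext_dy i g)" for i
    proof -
      have "dgen_x c i * ext_dx i (f * g) =
          dgen_x c i * ext_dx i f * g + ext_parity f * (dgen_x c i * ext_dx i g)"
        by (simp add: ext_dx_mult distrib_left mult.assoc dgen_x_commute[of c i "ext_parity f * ext_dx i g"]
              dgen_x_commute[of c i "ext_dx i g"])
      moreover have "dgen_y c i * ext_dy i (f * g) =
          dgen_y c i * ext_dy i f * g + ext_parity f * (dgen_y c i * ext_dy i g)"
        using dgen_y_commute[of c i f] by (simp add: ext_dy_mult distrib_left flip: mult.assoc)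
      ultimately show ?thesis by (simp add: distrib_left distrib_right)
    qed
    then show ?thesis
      by (simp only: sum.distrib sum_distrib_left sum_distrib_right distrib_left distrib_right)
  qed
  show "is_d0 c ?d"
    unfolding is_d0_def
  proof (intro conjI allI ballI)
    fix f g :: "('n, 'k) E0" and n i assume "f \<in> E0_total n"
    then show "?d (f * g) = ?d f * g + (- 1) ^ n * f * ?d g"
      by (simp add: L ext_parity_total)
  next
    fix a f show "?d (ext_const a * f) = ext_const a * ?d f"
      unfolding L by (simp add: ext_d_const)
  next
    fix f g show "?d (f + g) = ?d f + ?d g"
      by (simp add: ext_d_add algebra_simps sum.distrib)
  next
    fix i
    have "?d (gen_x i) = (\<Sum>j\<in>UNIV. if j = i then dgen_x c j else 0)"
      by (rule sum.cong) (auto simp: ext_d_gen)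
    then show "?d (gen_x i) = - (\<Sum>j\<in>UNIV. \<Sum>k\<in>{j<..}. ext_const (c j k i) * gen_x j * gen_x k)"
      by (simp add: dgen_x_def)
  next
    fix i
    have "?d (gen_y i) = (\<Sum>j\<in>UNIV. if j = i then dgen_y c j else 0)"
      by (rule sum.cong) (auto simp: ext_d_gen)
    then show "?d (gen_y i) = (\<Sum>j\<in>UNIV. \<Sum>k\<in>UNIV. ext_const (c j k i) * gen_y j * gen_x k)"
      by (simp add: dgen_y_def)
  qed
qed

definition ext_term :: "'x set \<Rightarrow> (('y \<Rightarrow>\<^sub>0 nat) \<Rightarrow>\<^sub>0 'k) \<Rightarrow> ('x, 'y, 'k::comm_ring_1) ext_poly" where
  "ext_term S q = ExtPoly (\<lambda>T. if T = S then q else 0)"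

lemma coef_ext_term: "coef (ext_term S q) T = (if T = S then q else 0)"
  by (simp add: ext_term_def ExtPoly_inverse)

lemma ext_term_add: "ext_term S (q + r) = ext_term S q + ext_term S r"
  by (rule ext_poly_eqI) (simp add: ext_poly_coef coef_ext_term)

lemma sum_ext_term: "f = (\<Sum>S\<in>UNIV. ext_term S (coef f S))"
proof (rule ext_poly_eqI)
  fix T
  have "coef (\<Sum>S\<in>A. ext_term S (coef f S)) T = (\<Sum>S\<in>A. if T = S then coef f S else 0)" for A
    by (induction A rule: infinite_finite_induct) (auto simp: ext_poly_coef coef_ext_term)
  then show "coef f T = coef (\<Sum>S\<in>UNIV. ext_term S (coef f S)) T" by simp
qed

lemma is_d0_unique:
  assumes "is_d0 c d" "is_d0 c d'"
  shows "d = d'"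
proof
  note d = assms[unfolded is_d0_def]
  have one: "1 \<in> E0_total 0"
    by (auto simp: E0_total_def one_ext_poly.rep_eq lookup_one split: if_splits)
  have x: "gen_x i \<in> E0_total 1" for i
    by (auto simp: E0_total_def gen_x.rep_eq lookup_one split: if_splits)
  have y: "gen_y i \<in> E0_total 2" for i
  proof -
    have "(\<Sum>j\<in>UNIV. Poly_Mapping.lookup (Poly_Mapping.single i (1::nat)) j) = 1"
      by (simp add: lookup_single when_def)
    then show ?thesis
      by (auto simp: E0_total_def gen_y.rep_eq lookup_single split: if_splits)
  qed
  have d1: "d 1 = d' 1"
  proof -
    have "d (1 * 1) = d 1 * 1 + (- 1) ^ 0 * 1 * d 1" using d one by blast
    moreover have "d' (1 * 1) = d' 1 * 1 + (- 1) ^ 0 * 1 * d' 1" using d one by blast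
    ultimately show ?thesis by simp
  qed
  have mx: "d (gen_x i * f) = d' (gen_x i * f)" if "d f = d' f" for f i
  proof -
    have "d (gen_x i * f) = d (gen_x i) * f + (- 1) ^ 1 * gen_x i * d f" using d x by blast
    moreover have "d' (gen_x i * f) = d' (gen_x i) * f + (- 1) ^ 1 * gen_x i * d' f" using d x by blast
    ultimately show ?thesis using d that by simp
  qed
  have my: "d (gen_y i * f) = d' (gen_y i * f)" if "d f = d' f" for f i
  proof -
    have "d (gen_y i * f) = d (gen_y i) * f + (- 1) ^ 2 * gen_y i * d f" using d y by blast
    moreover have "d' (gen_y i * f) = d' (gen_y i) * f + (- 1) ^ 2 * gen_y i * d' f" using d y by blast
    ultimately show ?thesis using d that by simp
  qed
  have m: "d (ext_term {} (Poly_Mapping.single m 1)) = d' (ext_term {} (Poly_Mapping.single m 1))" for m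
  proof (induction "\<Sum>j\<in>UNIV. Poly_Mapping.lookup m j" arbitrary: m)
    case 0
    then have "m = 0" by (intro poly_mapping_eqI) simp
    then have "ext_term {} (Poly_Mapping.single m 1) = (1 :: ('a, 'a, 'b) ext_poly)"
      by (intro ext_poly_eqI) (simp add: ext_poly_coef coef_ext_term)
    then show ?case using d1 by simp
  next
    case (Suc n)
    then obtain i where i: "Poly_Mapping.lookup m i \<noteq> 0" by force
    define m' where "m' = m - Poly_Mapping.single i 1"
    have m': "m = Poly_Mapping.single i 1 + m'"
      using i by (intro poly_mapping_eqI) (auto simp: m'_def lookup_add lookup_minus lookup_single when_def)
    have "(\<Sum>j\<in>UNIV. Poly_Mapping.lookup m j) = 1 + (\<Sum>j\<in>UNIV. Poly_Mapping.lookup m' j)"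
      unfolding m' by (simp add: lookup_add sum.distrib lookup_single when_def)
    with Suc have IH: "d (ext_term {} (Poly_Mapping.single m' 1)) = d' (ext_term {} (Poly_Mapping.single m' 1))"
      by simp
    have "ext_term {} (Poly_Mapping.single m 1) =
        (gen_y i * ext_term {} (Poly_Mapping.single m' 1) :: ('a, 'a, 'b) ext_poly)"
      by (rule ext_poly_eqI) (simp add: coef_gen_y_mult coef_ext_term mult_single m')
    then show ?case using my[OF IH] by simp
  qed
  have "d (ext_term S q) = d' (ext_term S q)" for S q
  proof (induction "card S" arbitrary: S)
    case 0
    then have [simp]: "S = {}" by simp
    show ?case
    proof (induction q rule: pm_induct)
      case (single n a)
      have "ext_term {} (Poly_Mapping.single n a) =
          (ext_const a * ext_term {} (Poly_Mapping.single n 1) :: ('a, 'a, 'b) ext_poly)"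
        by (rule ext_poly_eqI) (simp add: coef_const_mult coef_ext_term mult_single)
      then show ?case using m d by simp
    qed (use d in \<open>simp add: ext_term_add\<close>)
  next
    case (Suc n)
    then have ne: "S \<noteq> {}" by auto
    define i where "i = Min S"
    have i: "i \<in> S" "\<And>j. j \<in> S - {i} \<Longrightarrow> i < j"
      using ne Min_in[of S] Min_le[of S] by (auto simp: i_def le_less)
    have "{(k, j). k \<in> {i} \<and> j \<in> S - {i} \<and> j < k} = {}" using i by force
    then have sgn: "inv_sign {i} (S - {i}) = 1" unfolding inv_sign_def by (simp only: card.empty power_0)
    have "ext_term S q = gen_x i * ext_term (S - {i}) q"
      using i sgn by (intro ext_poly_eqI) (auto simp: coef_gen_x_mult coef_ext_term)
    moreover have "d (ext_term (S - {i}) q) = d' (ext_term (S - {i}) q)"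
      using Suc i by (intro Suc(1)) simp
    ultimately show ?case using mx by simp
  qed
  moreover have "d (sum h A) = d' (sum h A)" if "\<And>a. d (h a) = d' (h a)" for h and A :: "'a set set"
  proof (induction A rule: infinite_finite_induct)
    case (insert a A)
    then show ?case using d that by simp
  next
    case empty
    have "d (0 + 0) = d 0 + d 0" "d' (0 + 0) = d' 0 + d' 0" using d by blast+
    then show ?case by simp
  next
    case (infinite A)
    then show ?case by simp
  qed
  ultimately show "d f = d' f" for f
    using sum_ext_term[of f] by metis
qed

theorem is_d0_d0: "is_d0 c (d0 c)"
  unfolding d0_def using is_d0_exists is_d0_unique by (metis theI)

section \<open>The algebra $E_1$\<close>

definition cocycle_ring ::
  "('n \<Rightarrow> 'n \<Rightarrow> 'n \<Rightarrow> 'k) \<Rightarrow> ('n::{finite,linorder}, 'k::comm_ring_1) E0 ring" where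
  "cocycle_ring c = \<lparr>carrier = {z. d0 c z = 0}, mult = (*), one = 1, zero = 0, add = (+)\<rparr>"

definition E1 ::
  "('n \<Rightarrow> 'n \<Rightarrow> 'n \<Rightarrow> 'k) \<Rightarrow> ('n::{finite,linorder}, 'k::comm_ring_1) E0 set ring" where
  "E1 c = cocycle_ring c Quot range (d0 c)"

definition E1_class ::
  "('n \<Rightarrow> 'n \<Rightarrow> 'n \<Rightarrow> 'k) \<Rightarrow> ('n::{finite,linorder}, 'k::comm_ring_1) E0 \<Rightarrow> ('n, 'k) E0 set" where
  "E1_class c z = range (d0 c) +>\<^bsub>cocycle_ring c\<^esub> z"

definition E1_comp ::
  "('n \<Rightarrow> 'n \<Rightarrow> 'n \<Rightarrow> 'k) \<Rightarrow> nat \<Rightarrow> nat \<Rightarrow> ('n::{finite,linorder}, 'k::comm_ring_1) E0 set set" where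
  "E1_comp c s t = E1_class c ` {z \<in> E0_comp s t. d0 c z = 0}"

text \<open>
  $\Lambda^*(u) \otimes k[\kappa]$ is \<^typ>\<open>(unit, unit, 'k) ext_poly\<close> with $u$ in bidegree
  $(0, 3)$ and $\kappa$ in bidegree $(2, 0)$.
\<close>

abbreviation Luk_comp :: "nat \<Rightarrow> nat \<Rightarrow> (unit, unit, 'k::zero) ext_poly set" where
  "Luk_comp \<equiv> bicomp 2 3"

text \<open>
  Isomorphism of bigraded \<open>k\<close>-algebras $\Lambda^*(u) \otimes k[\kappa] \sim E_1$ in the range of
  Hodge degrees \<open>< n\<close>. Products are compared only when they lie in that range. Scalars act on
  \<^const>\<open>E1\<close> through the classes of constants.
\<close>

definition Luk_iso_below :: "nat \<Rightarrow> ('n::{finite,linorder} \<Rightarrow> 'n \<Rightarrow> 'n \<Rightarrow> 'k::comm_ring_1) \<Rightarrow> bool" where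
  "Luk_iso_below n c \<longleftrightarrow>
     (\<exists>\<phi> :: (unit, unit, 'k) ext_poly \<Rightarrow> ('n, 'k) E0 set.
        (\<forall>s<n. \<forall>t. bij_betw \<phi> (Luk_comp s t) (E1_comp c s t)) \<and>
        (\<forall>s<n. \<forall>t. \<forall>a\<in>Luk_comp s t. \<forall>b\<in>Luk_comp s t. \<phi> (a + b) = \<phi> a \<oplus>\<^bsub>E1 c\<^esub> \<phi> b) \<and>
        (\<forall>s<n. \<forall>t. \<forall>r. \<forall>a\<in>Luk_comp s t.
            \<phi> (ext_const r * a) = E1_class c (ext_const r) \<otimes>\<^bsub>E1 c\<^esub> \<phi> a) \<and>
        (0 < n \<longrightarrow> \<phi> 1 = \<one>\<^bsub>E1 c\<^esub>) \<and>
        (\<forall>s t s' t'. s + s' < n \<longrightarrow> (\<forall>a\<in>Luk_comp s t. \<forall>b\<in>Luk_comp s' t'.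
            \<phi> (a * b) = \<phi> a \<otimes>\<^bsub>E1 c\<^esub> \<phi> b)))"

text \<open>The \<open>k\<close>-subalgebra generated by \<open>S\<close>: the subring generated by \<open>S\<close> and the constants.\<close>

definition E1_alg_gen ::
  "('n \<Rightarrow> 'n \<Rightarrow> 'n \<Rightarrow> 'k) \<Rightarrow> ('n::{finite,linorder}, 'k::comm_ring_1) E0 set set \<Rightarrow> ('n, 'k) E0 set set" where
  "E1_alg_gen c S = generate_ring (E1 c) (S \<union> range (\<lambda>a. E1_class c (ext_const a)))"

definition generates_through ::
  "('n \<Rightarrow> 'n \<Rightarrow> 'n \<Rightarrow> 'k) \<Rightarrow> nat \<Rightarrow> ('n::{finite,linorder}, 'k::comm_ring_1) E0 set set \<Rightarrow> bool" where
  "generates_through c n S \<longleftrightarrow>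
     S \<subseteq> carrier (E1 c) \<and> (\<forall>s\<le>n. \<forall>t. E1_comp c s t \<subseteq> E1_alg_gen c S)"

definition has_torsion :: "('a, 'b) ring_scheme \<Rightarrow> nat \<Rightarrow> bool" where
  "has_torsion R p \<longleftrightarrow> (\<exists>x\<in>carrier R. x \<noteq> \<zero>\<^bsub>R\<^esub> \<and> [p] \<cdot>\<^bsub>R\<^esub> x = \<zero>\<^bsub>R\<^esub>)"

definition fin_gen_ring :: "('a, 'b) ring_scheme \<Rightarrow> bool" where
  "fin_gen_ring R \<longleftrightarrow> (\<exists>S. finite S \<and> S \<subseteq> carrier R \<and> generate_ring R S = carrier R)"

section \<open>The Lie algebra $\mathfrak{sl}_2(k)$\<close>

definition sl2 :: "('k::comm_ring_1^2^2) set" where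
  "sl2 = {A. trace A = 0}"

definition lie_bracket :: "'k::comm_ring_1^2^2 \<Rightarrow> 'k^2^2 \<Rightarrow> 'k^2^2" where
  "lie_bracket A B = A ** B - B ** A"

definition lin_comb :: "(3 \<Rightarrow> 'k) \<Rightarrow> (3 \<Rightarrow> 'k::comm_ring_1^2^2) \<Rightarrow> 'k^2^2" where
  "lin_comb a e = (\<chi> r s. \<Sum>k\<in>UNIV. a k * e k $ r $ s)"

definition sl2_basis :: "(3 \<Rightarrow> 'k::comm_ring_1^2^2) \<Rightarrow> bool" where
  "sl2_basis e \<longleftrightarrow> range e \<subseteq> sl2 \<and> (\<forall>A\<in>sl2. \<exists>!a. A = lin_comb a e)"

definition structure_const :: "(3 \<Rightarrow> 'k::comm_ring_1^2^2) \<Rightarrow> 3 \<Rightarrow> 3 \<Rightarrow> 3 \<Rightarrow> 'k" where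
  "structure_const e i j = (THE a. lie_bracket (e i) (e j) = lin_comb a e)"

lemma structure_const:
  assumes "sl2_basis e"
  shows "lie_bracket (e i) (e j) = lin_comb (structure_const e i j) e"
proof -
  have "lie_bracket (e i) (e j) \<in> sl2"
    using trace_mul_sym[of "e i" "e j"] by (simp add: sl2_def lie_bracket_def trace_sub)
  with assms have "\<exists>!a. lie_bracket (e i) (e j) = lin_comb a e"
    by (simp add: sl2_basis_def)
  then show ?thesis unfolding structure_const_def by (rule theI')
qed

lemma sl2_basis_standard:
  "sl2_basis (\<lambda>k::3. if k = 1 then vector [vector [0, 1], vector [0, 0]]
     else if k = 2 then vector [vector [1, 0], vector [0, - 1]]
     else vector [vector [0, 0], vector [1, 0 :: 'k::comm_ring_1]])"
  (is "sl2_basis ?e")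
proof -
  have *: "A = lin_comb a ?e \<longleftrightarrow>
      A $ 1 $ 1 = a 2 \<and> A $ 1 $ 2 = a 1 \<and> A $ 2 $ 1 = a 3 \<and> A $ 2 $ 2 = - a 2" for A a
  proof -
    have entries: "lin_comb a ?e $ 1 $ 1 = a 2" "lin_comb a ?e $ 1 $ 2 = a 1"
      "lin_comb a ?e $ 2 $ 1 = a 3" "lin_comb a ?e $ 2 $ 2 = - a 2"
      by (simp_all add: lin_comb_def sum_3 vector_2)
    show ?thesis unfolding vec_eq_iff forall_2 entries by (simp only: conj_assoc)
  qed
  show ?thesis
    unfolding sl2_basis_def
  proof (intro conjI ballI)
    show "range ?e \<subseteq> sl2"
      by (auto simp: sl2_def trace_def sum_2 vector_2)
  next
    fix A :: "'k^2^2"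
    assume "A \<in> sl2"
    then have A: "A $ 2 $ 2 = - (A $ 1 $ 1)"
      by (simp add: sl2_def trace_def sum_2 add_eq_0_iff)
    show "\<exists>!a. A = lin_comb a ?e"
      unfolding *
    proof (rule ex1I)
      show "A $ 1 $ 1 = (\<lambda>k::3. if k = 1 then A $ 1 $ 2 else if k = 2 then A $ 1 $ 1 else A $ 2 $ 1) 2 \<and>
          A $ 1 $ 2 = (\<lambda>k::3. if k = 1 then A $ 1 $ 2 else if k = 2 then A $ 1 $ 1 else A $ 2 $ 1) 1 \<and>
          A $ 2 $ 1 = (\<lambda>k::3. if k = 1 then A $ 1 $ 2 else if k = 2 then A $ 1 $ 1 else A $ 2 $ 1) 3 \<and>
          A $ 2 $ 2 = - (\<lambda>k::3. if k = 1 then A $ 1 $ 2 else if k = 2 then A $ 1 $ 1 else A $ 2 $ 1) 2"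
        using A by simp
    next
      fix a :: "3 \<Rightarrow> 'k"
      assume a: "A $ 1 $ 1 = a 2 \<and> A $ 1 $ 2 = a 1 \<and> A $ 2 $ 1 = a 3 \<and> A $ 2 $ 2 = - a 2"
      show "a = (\<lambda>k::3. if k = 1 then A $ 1 $ 2 else if k = 2 then A $ 1 $ 1 else A $ 2 $ 1)"
      proof
        fix k :: 3
        consider "k = 1" | "k = 2" | "k = 3" using exhaust_3[of k] by blast
        then show "a k = (if k = 1 then A $ 1 $ 2 else if k = 2 then A $ 1 $ 1 else A $ 2 $ 1)"
          by cases (simp_all add: a)
      qed
    qed
  qed
qed

end

theory Submission
  imports Defs
begin

text \<open>
  In the basis \<open>f, h, e\<close> of \<open>sl\<^sub>2\<close> the polynomial functions are polynomials in three variables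
  \<open>va, vb, vc\<close>, and \<open>kap = vb\<^sup>2 + va * vc\<close> is invariant. The idea is to restrict cochains to the
  nilpotent cone \<open>kap = 0\<close>. The cone is parametrised by pairs \<open>(u, v)\<close>, polynomials of degree \<open>s\<close>
  restrict to binary forms of degree \<open>2 s\<close>, and there the differential is an explicit matrix for
  each weight (\<open>symb_dd\<close>). A cochain that vanishes on the cone is \<open>kap\<close> times a cochain, and
  multiplication by \<open>kap\<close> is injective and commutes with the differential. So if the restriction of
  a cocycle of Hodge degree \<open>s\<close> can be written as the restriction of known cocycles plus a
  coboundary, the rest is \<open>kap\<close> times a cocycle of Hodge degree \<open>s - 2\<close>, and induction applies.

  On the cone, contraction with \<open>h\<close> is a homotopy for every weight \<open>2 w\<close> that is invertible in
  \<open>k\<close> (\<open>weight_reduction\<close>). Let \<open>k\<close> be the field with \<open>p\<close> elements, \<open>p\<close> odd. For \<open>s \<le> p\<close> this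
  leaves \<open>w = 0\<close> and \<open>w = p, - p\<close>. If \<open>0 < s < p - 1\<close>, only \<open>w = 0\<close> occurs, and it contributes nothing
  because \<open>s\<close> and \<open>s + 1\<close> are invertible; hence all classes come from Hodge degree 0 by
  multiplication with powers of \<open>kap\<close> (\<open>cocycle_low_degree\<close>). The powers of \<open>kap\<close> times the volume form
  are not coboundaries: the \<open>n\<close>-th power of the Laplacian dual to \<open>kap\<close> is an invariant functional,
  which kills coboundaries but not the multiple \<open>vb\<^bsup>2 n\<^esup>\<close> of the volume form
  (\<open>vb_power_not_exact\<close>). This is the isomorphism below \<open>p - 1\<close>.

  In the Hodge degrees \<open>p - 1\<close> and \<open>p\<close>, where \<open>s + 1\<close> or \<open>s\<close> vanishes modulo \<open>p\<close>, new cocycles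
  appear on the cone. Such a cocycle lifts to an actual cocycle if and only if an obstruction of
  Hodge degree \<open>s - 2\<close> is exact. This obstruction lies in a vanishing group for all but one of them
  (\<open>lift_cocycle\<close>), and is a nonzero multiple of \<open>vb\<^bsup>p - 3\<^esup>\<close> times the volume form for the remaining
  one. There result 7 new classes in degree \<open>p - 1\<close> (\<open>cocycle_degree_pred_p\<close>) and 8 in degree \<open>p\<close>
  (\<open>cocycle_degree_p\<close>), which together with \<open>u\<close> and \<open>\<kappa>\<close> make 17.

  Fewer than 17 generators do not suffice, as there are 17 linear functionals \<open>phi\<close> on cocycles that
  vanish on coboundaries, are dual to the 17 generators, and are derivations at the augmentation
  \<open>eps\<close> (\<open>phi_mult\<close>). Therefore the values of \<open>phi\<close> at the elements of a generating set span a space of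
  dimension 17. They are derivations because a cocycle of augmentation 0 is, up to coboundaries, the
  sum of a multiple of the volume form, of \<open>kap\<close> times a cocycle and of a part of Hodge degree at least
  \<open>p - 1\<close> (\<open>cocycle_decomposition\<close>), and \<open>2 (p - 1) > p\<close>.

  Over the integers \<open>d (va\<^sup>q)\<close> is divisible by \<open>q\<close>, and the quotient represents a class of order
  \<open>q\<close>. On the other hand, some positive multiple of the 1-form part of any cocycle is exact, by the
  same restriction to the cone. For a fixed \<open>N\<close> the cocycles whose 1-form part becomes exact after
  multiplication by \<open>N\<close> are closed under the ring operations, so a finite set of generators would
  give one \<open>N\<close> for all cocycles, contradicting the classes of prime order \<open>q > N\<close>.

  All this is done for the basis \<open>f, h, e\<close>. Any other basis gives an isomorphic differential algebra
  through the linear substitution of variables (\<open>basis_change\<close>), along which the assertions are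
  transported.
\<close>

section \<open>Polynomials in three variables and the derivations of the adjoint action\<close>

type_synonym 'k pol3 = "(3 \<Rightarrow>\<^sub>0 nat) \<Rightarrow>\<^sub>0 'k"

definition expo :: "nat \<Rightarrow> nat \<Rightarrow> nat \<Rightarrow> (3 \<Rightarrow>\<^sub>0 nat)" where
  "expo x y z = Poly_Mapping.single 0 x + Poly_Mapping.single 1 y + Poly_Mapping.single 2 z"

abbreviation mon :: "nat \<Rightarrow> nat \<Rightarrow> nat \<Rightarrow> 'k \<Rightarrow> 'k::zero pol3" where
  "mon x y z r \<equiv> Poly_Mapping.single (expo x y z) r"

lemma UNIV_three: "(UNIV :: 3 set) = {0, 1, 2}"
proof -
  have "x = 0 \<or> x = 1 \<or> x = 2" for x :: 3
    using exhaust_3[of x] by auto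
  then show ?thesis by auto
qed

lemma three_cases: obtains "x = (0::3)" | "x = 1" | "x = 2"
  using UNIV_three by blast

lemma lookup_expo [simp]:
  "Poly_Mapping.lookup (expo x y z) 0 = x"
  "Poly_Mapping.lookup (expo x y z) 1 = y"
  "Poly_Mapping.lookup (expo x y z) 2 = z"
  by (simp_all add: expo_def lookup_add lookup_single when_def)

lemma three_poly_mapping_eqI:
  assumes "Poly_Mapping.lookup m 0 = Poly_Mapping.lookup m' 0"
    "Poly_Mapping.lookup m 1 = Poly_Mapping.lookup m' 1"
    "Poly_Mapping.lookup m 2 = Poly_Mapping.lookup m' (2::3)"
  shows "m = m'"
  by (rule poly_mapping_eqI) (metis assms three_cases)

lemma expo_lookup: "expo (Poly_Mapping.lookup m 0) (Poly_Mapping.lookup m 1) (Poly_Mapping.lookup m 2) = m"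
  by (rule three_poly_mapping_eqI) simp_all

lemma expo_inject [simp]: "expo x y z = expo x' y' z' \<longleftrightarrow> x = x' \<and> y = y' \<and> z = z'"
  by (metis lookup_expo)

lemma expo_add: "expo x y z + expo x' y' z' = expo (x + x') (y + y') (z + z')"
  by (rule three_poly_mapping_eqI) (simp_all add: lookup_add)

lemma expo_0: "expo 0 0 0 = 0"
  by (simp add: expo_def)

lemma mon_mult: "mon x y z r * mon x' y' z' r' = mon (x + x') (y + y') (z + z') (r * r')"
  by (simp add: mult_single expo_add)

lemma pol3_induct [case_names mon add]:
  fixes q :: "'k::comm_monoid_add pol3"
  assumes "\<And>x y z r. P (mon x y z r)" "\<And>f g. P f \<Longrightarrow> P g \<Longrightarrow> P (f + g)"
  shows "P q"
  by (induction q rule: pm_induct) (metis assms expo_lookup)+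

definition cst :: "'k \<Rightarrow> 'k::comm_ring_1 pol3" where "cst r = mon 0 0 0 r"
definition va :: "'k::comm_ring_1 pol3" where "va = mon 1 0 0 1"
definition vb :: "'k::comm_ring_1 pol3" where "vb = mon 0 1 0 1"
definition vc :: "'k::comm_ring_1 pol3" where "vc = mon 0 0 1 1"

lemma cst_ring: "cst 0 = 0" "cst 1 = 1" "cst (r + t) = cst r + cst t" "cst (r * t) = cst r * cst t"
  "cst (- r) = - cst r" "cst (r - t) = cst r - cst t"
  by (simp_all add: cst_def expo_0 single_add mult_single single_uminus single_diff)

lemma cst_of_nat: "cst (of_nat n) = of_nat n"
  by (simp add: cst_def expo_0)

lemma cst_numeral: "cst (numeral n) = numeral n"
  by (simp add: cst_def expo_0)

lemma cst_mon: "cst t * mon x y z r = mon x y z (t * r)"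
  by (simp add: cst_def mon_mult)

lemma numeral_mon: "numeral n * mon x y z (r::'k::comm_ring_1) = mon x y z (numeral n * r)"
  by (metis cst_numeral cst_mon)

lemma var_mon:
  "va * mon x y z r = mon (Suc x) y z r"
  "vb * mon x y z r = mon x (Suc y) z r"
  "vc * mon x y z r = mon x y (Suc z) r"
  by (simp_all add: va_def vb_def vc_def mon_mult)

lemma var_power: "va ^ n = mon n 0 0 1" "vb ^ n = mon 0 n 0 1" "vc ^ n = mon 0 0 n 1"
  by (induction n) (simp_all add: var_mon expo_0)

lemma pd_mon:
  "pd 0 (mon x y z r) = mon (x - 1) y z (of_nat x * r)"
  "pd 1 (mon x y z r) = mon x (y - 1) z (of_nat y * r)"
  "pd 2 (mon x y z r) = mon x y (z - 1) (of_nat z * r)"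
proof -
  have "expo x y z - Poly_Mapping.single 0 1 = expo (x - 1) y z"
       "expo x y z - Poly_Mapping.single 1 1 = expo x (y - 1) z"
       "expo x y z - Poly_Mapping.single 2 1 = expo x y (z - 1)"
    by (rule three_poly_mapping_eqI; simp add: lookup_minus lookup_single when_def)+
  then show "pd 0 (mon x y z r) = mon (x - 1) y z (of_nat x * r)"
    "pd 1 (mon x y z r) = mon x (y - 1) z (of_nat y * r)"
    "pd 2 (mon x y z r) = mon x y (z - 1) (of_nat z * r)"
    by (simp_all add: pd_single)
qed

lemma pd_cst [simp]: "pd i (cst r) = 0"
  by (simp add: cst_def expo_0 pd_single)

lemma pd_v [simp]: "pd 0 va = 1" "pd 1 va = 0" "pd 2 va = 0" "pd 0 vb = 0" "pd 1 vb = 1" "pd 2 vb = 0"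
   "pd 0 vc = 0" "pd 1 vc = 0" "pd 2 vc = 1"
  by (simp_all add: va_def vb_def vc_def pd_mon[unfolded One_nat_def] expo_0)

text \<open>
  The dual basis of \<open>f, h, e\<close> is \<open>va, vb, vc\<close>; these are the derivations by which
  \<open>e\<close>, \<open>h\<close>, \<open>f\<close> act, the coefficients being those of the bracket.
\<close>

definition opE :: "'k::comm_ring_1 pol3 \<Rightarrow> 'k pol3" where
  "opE q = 2 * vb * pd 2 q - va * pd 1 q"
definition opF :: "'k::comm_ring_1 pol3 \<Rightarrow> 'k pol3" where
  "opF q = vc * pd 1 q - 2 * vb * pd 0 q"
definition opH :: "'k::comm_ring_1 pol3 \<Rightarrow> 'k pol3" where
  "opH q = 2 * va * pd 0 q - 2 * vc * pd 2 q"

lemmas op_defs = opE_def opF_def opH_def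

lemma op_add: "opE (q + r) = opE q + opE r" "opF (q + r) = opF q + opF r" "opH (q + r) = opH q + opH r"
  by (simp_all add: op_defs pd_add algebra_simps)

lemma op_mult: "opE (q * r) = opE q * r + q * opE r" "opF (q * r) = opF q * r + q * opF r"
  "opH (q * r) = opH q * r + q * opH r"
  by (simp_all add: op_defs pd_mult algebra_simps)

lemma op_0 [simp]: "opE 0 = 0" "opF 0 = 0" "opH 0 = 0"
  by (simp_all add: op_defs)

lemma op_1 [simp]: "opE 1 = 0" "opF 1 = 0" "opH 1 = 0"
  by (simp_all add: op_defs)

lemma op_uminus: "opE (- q) = - opE q" "opF (- q) = - opF q" "opH (- q) = - opH q"
  by (simp_all add: op_defs pd_uminus)

lemma op_diff: "opE (q - r) = opE q - opE r" "opF (q - r) = opF q - opF r" "opH (q - r) = opH q - opH r"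
  using op_add[of q "- r"] by (simp_all add: op_uminus)

lemma op_v [simp]:
  "opE va = 0" "opE vb = - va" "opE vc = 2 * vb"
  "opF va = - 2 * vb" "opF vb = vc" "opF vc = 0"
  "opH va = 2 * va" "opH vb = 0" "opH vc = - 2 * vc"
  by (simp_all add: op_defs)

lemma op_cst [simp]: "opE (cst r) = 0" "opF (cst r) = 0" "opH (cst r) = 0"
  by (simp_all add: op_defs)

lemma op_numeral [simp]: "opE (numeral n) = 0" "opF (numeral n) = 0" "opH (numeral n) = 0"
  by (simp_all flip: cst_numeral)

lemma op_power:
  "opE (q ^ n) = of_nat n * q ^ (n - 1) * opE q"
  "opF (q ^ n) = of_nat n * q ^ (n - 1) * opF q"
  "opH (q ^ n) = of_nat n * q ^ (n - 1) * opH q"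
proof -
  have "opE (q ^ n) = of_nat n * q ^ (n - 1) * opE q \<and>
    opF (q ^ n) = of_nat n * q ^ (n - 1) * opF q \<and>
    opH (q ^ n) = of_nat n * q ^ (n - 1) * opH q"
  proof (induction n)
    case (Suc n)
    then show ?case
      by (cases n) (simp_all add: op_mult algebra_simps)
  qed simp
  then show "opE (q ^ n) = of_nat n * q ^ (n - 1) * opE q"
    "opF (q ^ n) = of_nat n * q ^ (n - 1) * opF q"
    "opH (q ^ n) = of_nat n * q ^ (n - 1) * opH q" by blast+
qed

text \<open>The commutation relations of \<open>e, h, f\<close>; on polynomials they give \<open>d\<^sup>2 = 0\<close>.\<close>

lemma pd_commute: "pd i (pd j q) = pd j (pd i (q :: 'k::comm_ring_1 pol3))"
proof (induction q rule: pm_induct)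
  case (single m r)
  show ?case
  proof (cases "i = j")
    case False
    have "m - Poly_Mapping.single i 1 - Poly_Mapping.single j (1::nat) =
      m - Poly_Mapping.single j 1 - Poly_Mapping.single i 1"
      by (rule poly_mapping_eqI) (simp add: lookup_minus)
    with False show ?thesis
      by (simp add: pd_single lookup_minus lookup_single mult_ac)
  qed simp
qed (simp add: pd_add)

lemma op_commute:
  "opE (opF q) - opF (opE q) = opH q"
  "opH (opE q) - opE (opH q) = 2 * opE q"
  "opH (opF q) - opF (opH q) = - 2 * opF q"
proof -
  have n: "pd i (2 :: 'k::comm_ring_1 pol3) = 0" for i
    by (simp flip: cst_numeral)
  note c = pd_commute[of 0 1 q] pd_commute[of 0 2 q] pd_commute[of 1 2 q]
  have d: "pd i (p - r) = pd i p - pd i r" for i and p r :: "'a pol3"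
    using pd_add[of i p "- r"] by (simp add: pd_uminus)
  show "opE (opF q) - opF (opE q) = opH q"
    "opH (opE q) - opE (opH q) = 2 * opE q"
    "opH (opF q) - opF (opH q) = - 2 * opF q"
    unfolding op_defs d pd_mult n c
    by (simp_all add: c algebra_simps)
qed

definition kap :: "'k::comm_ring_1 pol3" where "kap = vb * vb + va * vc"

lemma op_kap [simp]: "opE kap = 0" "opF kap = 0" "opH kap = 0"
  by (simp_all add: kap_def op_add op_mult algebra_simps)

section \<open>Restriction to the nilpotent cone\<close>

text \<open>
  The linear functional on polynomials with prescribed values \<open>F\<close> on monomials.
\<close>

definition linf :: "((3 \<Rightarrow>\<^sub>0 nat) \<Rightarrow> 'k) \<Rightarrow> 'k::comm_ring_1 pol3 \<Rightarrow> 'k" where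
  "linf F q = (\<Sum>m\<in>Poly_Mapping.keys q. Poly_Mapping.lookup q m * F m)"

lemma linf_single: "linf F (Poly_Mapping.single m r) = r * F m"
  by (simp add: linf_def)

lemma linf_superset:
  assumes "finite A" "Poly_Mapping.keys q \<subseteq> A"
  shows "linf F q = (\<Sum>m\<in>A. Poly_Mapping.lookup q m * F m)"
  unfolding linf_def using assms by (intro sum.mono_neutral_left) (auto simp: in_keys_iff)

lemma linf_add: "linf F (q + r) = linf F q + linf F r"
proof -
  let ?A = "Poly_Mapping.keys q \<union> Poly_Mapping.keys r"
  have "linf F (q + r) = (\<Sum>m\<in>?A. Poly_Mapping.lookup (q + r) m * F m)"
    by (rule linf_superset) (auto simp: in_keys_iff lookup_add)
  also have "\<dots> = (\<Sum>m\<in>?A. Poly_Mapping.lookup q m * F m) + (\<Sum>m\<in>?A. Poly_Mapping.lookup r m * F m)"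
    by (simp add: lookup_add distrib_right sum.distrib)
  also have "\<dots> = linf F q + linf F r"
    using linf_superset[of ?A q F] linf_superset[of ?A r F] by simp
  finally show ?thesis .
qed

text \<open>
  The cone \<open>kap = 0\<close> is parametrised by \<open>va = u\<^sup>2\<close>, \<open>vb = u v\<close>, \<open>vc = - v\<^sup>2\<close>. Restricted to it, the
  degree \<open>s\<close> part of \<open>q\<close> becomes a binary form of degree \<open>2 s\<close>; \<open>symb s w q\<close> is its
  coefficient of \<open>u\<^bsup>s+w\<^esup> v\<^bsup>s-w\<^esup>\<close>, the vector of weight \<open>2 w\<close>.
\<close>

definition symb :: "nat \<Rightarrow> int \<Rightarrow> 'k::comm_ring_1 pol3 \<Rightarrow> 'k" where
  "symb s w = linf (\<lambda>m. if Poly_Mapping.lookup m 0 + Poly_Mapping.lookup m 1 + Poly_Mapping.lookup m 2 = s \<and>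
     int (Poly_Mapping.lookup m 0) - int (Poly_Mapping.lookup m 2) = w
     then (- 1) ^ Poly_Mapping.lookup m 2 else 0)"

lemma symb_mon: "symb s w (mon x y z r) = (if x + y + z = s \<and> int x - int z = w then (- 1) ^ z * r else 0)"
  by (simp add: symb_def linf_single)

lemma symb_add: "symb s w (q + r) = symb s w q + symb s w r"
  by (simp add: symb_def linf_add)

lemma symb_0 [simp]: "symb s w 0 = 0"
  by (simp add: symb_def linf_def)

lemma symb_uminus: "symb s w (- q) = - symb s w q"
  using symb_add[of s w q "- q"] by (simp add: add_eq_0_iff2)

lemma symb_diff: "symb s w (q - r) = symb s w q - symb s w r"
  using symb_add[of s w q "- r"] by (simp add: symb_uminus)

lemma symb_cst: "symb s w (cst r * q) = r * symb s w q"
  by (induction q rule: pol3_induct) (simp_all add: cst_mon symb_mon symb_add distrib_left)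

lemma symb_numeral: "symb s w (numeral n * q) = numeral n * symb s w q"
  using symb_cst[of s w "numeral n" q] by (simp add: cst_numeral)

lemma symb_sum: "symb s w (sum g A) = (\<Sum>i\<in>A. symb s w (g i))"
  by (induction A rule: infinite_finite_induct) (simp_all add: symb_add)

lemma symb_out: "\<bar>w\<bar> > int s \<Longrightarrow> symb s w q = 0"
  by (induction q rule: pol3_induct) (auto simp: symb_mon symb_add)

lemma symb_kap: "symb s w (kap * q) = 0"
  by (induction q rule: pol3_induct)
    (auto simp: kap_def distrib_left distrib_right mult.assoc var_mon symb_mon symb_add)

lemma op_mon:
  "opE (mon x y z r) = mon x (Suc y) (z - 1) (2 * (of_nat z * r)) - mon (Suc x) (y - 1) z (of_nat y * r)"
  "opF (mon x y z r) = mon x (y - 1) (Suc z) (of_nat y * r) - mon (x - 1) (Suc y) z (2 * (of_nat x * r))"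
  "opH (mon x y z r) = mon x y z (2 * (of_nat x - of_nat z) * r)"
proof -
  show "opE (mon x y z r) = mon x (Suc y) (z - 1) (2 * (of_nat z * r)) - mon (Suc x) (y - 1) z (of_nat y * r)"
    "opF (mon x y z r) = mon x (y - 1) (Suc z) (of_nat y * r) - mon (x - 1) (Suc y) z (2 * (of_nat x * r))"
    by (simp_all add: op_defs pd_mon[unfolded One_nat_def] mult.assoc var_mon numeral_mon)
  have "opH (mon x y z r) = mon x y z (2 * (of_nat x * r)) - mon x y z (2 * (of_nat z * r))"
    by (cases x; cases z) (simp_all add: op_defs pd_mon[unfolded One_nat_def] mult.assoc var_mon numeral_mon)
  then show "opH (mon x y z r) = mon x y z (2 * (of_nat x - of_nat z) * r)"
    by (simp add: algebra_simps flip: single_diff)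
qed

text \<open>
  On binary forms \<open>e\<close>, \<open>f\<close> and \<open>h\<close> act as \<open>- u \<partial>\<^sub>v\<close>, \<open>- v \<partial>\<^sub>u\<close> and \<open>u \<partial>\<^sub>u - v \<partial>\<^sub>v\<close>.
\<close>

lemma symb_op:
  "symb s w (opE q) = - of_int (int s - w + 1) * symb s (w - 1) q"
  "symb s w (opF q) = - of_int (int s + w + 1) * symb s (w + 1) q"
  "symb s w (opH q) = of_int (2 * w) * symb s w q"
proof -
  have "symb s w (opE q) = - of_int (int s - w + 1) * symb s (w - 1) q \<and>
    symb s w (opF q) = - of_int (int s + w + 1) * symb s (w + 1) q \<and>
    symb s w (opH q) = of_int (2 * w) * symb s w q"
  proof (induction q rule: pol3_induct)
    case (mon x y z r)
    have E: "symb s w (opE (mon x y z r)) = - of_int (int s - w + 1) * symb s (w - 1) (mon x y z r)"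
    proof (cases "s = x + y + z \<and> w = int x - int z + 1")
      case True
      then have s: "s = x + y + z" and w: "w = int x - int z + 1" by auto
      show ?thesis
        unfolding s w by (cases y; cases z) (simp_all add: op_mon symb_diff symb_uminus symb_mon algebra_simps)
    next
      case False
      then show ?thesis
        by (cases y; cases z) (auto simp: op_mon symb_diff symb_uminus symb_mon)
    qed
    have F: "symb s w (opF (mon x y z r)) = - of_int (int s + w + 1) * symb s (w + 1) (mon x y z r)"
    proof (cases "s = x + y + z \<and> w = int x - int z - 1")
      case True
      then have s: "s = x + y + z" and w: "w = int x - int z - 1" by auto
      show ?thesis
        unfolding s w by (cases y; cases x) (simp_all add: op_mon symb_diff symb_uminus symb_mon algebra_simps)
    next
      case False
      then show ?thesis
        by (cases y; cases x) (auto simp: op_mon symb_diff symb_uminus symb_mon)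
    qed
    have H: "symb s w (opH (mon x y z r)) = of_int (2 * w) * symb s w (mon x y z r)"
    proof (cases "s = x + y + z \<and> w = int x - int z")
      case True
      then have s: "s = x + y + z" and w: "w = int x - int z" by auto
      show ?thesis
        unfolding s w by (simp add: op_mon symb_mon algebra_simps)
    qed (auto simp: op_mon symb_mon)
    from E F H show ?case by blast
  qed (simp add: op_add symb_add distrib_left)
  then show "symb s w (opE q) = - of_int (int s - w + 1) * symb s (w - 1) q"
    "symb s w (opF q) = - of_int (int s + w + 1) * symb s (w + 1) q"
    "symb s w (opH q) = of_int (2 * w) * symb s w q" by blast+
qed

text \<open>
  \<open>2 s\<close>-th binary forms are spanned by the restrictions of these monomials, one for each weight.
\<close>

definition cone_mon :: "nat \<Rightarrow> int \<Rightarrow> 'k \<Rightarrow> 'k::comm_ring_1 pol3" where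
  "cone_mon s w r = (if w \<ge> 0 then mon (nat w) (s - nat w) 0 r
     else mon 0 (s - nat (- w)) (nat (- w)) ((- 1) ^ nat (- w) * r))"

lemma cone_mon_neg: "cone_mon s (- int z) r = mon 0 (s - z) z ((- 1) ^ z * r)"
  by (cases "z = 0") (simp_all add: cone_mon_def)

definition homog :: "nat \<Rightarrow> 'k::zero pol3 \<Rightarrow> bool" where
  "homog s q \<longleftrightarrow> (\<forall>m. Poly_Mapping.lookup q m \<noteq> 0 \<longrightarrow>
     Poly_Mapping.lookup m 0 + Poly_Mapping.lookup m 1 + Poly_Mapping.lookup m 2 = s)"

lemma homog_0 [simp]: "homog s 0"
  by (simp add: homog_def)

lemma homog_mon: "x + y + z = s \<Longrightarrow> homog s (mon x y z r)"
  by (auto simp: homog_def lookup_single when_def)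

lemma homog_add: "homog s q \<Longrightarrow> homog s r \<Longrightarrow> homog s (q + r)"
  unfolding homog_def by (metis lookup_add add_0)

lemma homog_uminus: "homog s q \<Longrightarrow> homog s (- (q :: 'k::comm_ring_1 pol3))"
  unfolding homog_def by simp

lemma homog_diff: "homog s q \<Longrightarrow> homog s r \<Longrightarrow> homog s (q - r :: 'k::comm_ring_1 pol3)"
  using homog_add[of s q "- r"] homog_uminus[of s r] by simp

lemma homog_sum: "(\<And>i. i \<in> A \<Longrightarrow> homog s (g i)) \<Longrightarrow> homog s (sum g A :: 'k::comm_ring_1 pol3)"
  by (induction A rule: infinite_finite_induct) (auto intro: homog_add)

lemma homog_induct [consumes 1, case_names zero mon add]:
  fixes q :: "'k::comm_ring_1 pol3"
  assumes "homog s q" and "P 0"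
    and "\<And>x y z r. x + y + z = s \<Longrightarrow> P (mon x y z r)"
    and "\<And>f g. homog s f \<Longrightarrow> homog s g \<Longrightarrow> P f \<Longrightarrow> P g \<Longrightarrow> P (f + g)"
  shows "P q"
proof -
  have q: "q = (\<Sum>m\<in>Poly_Mapping.keys q. Poly_Mapping.single m (Poly_Mapping.lookup q m))"
  proof (rule poly_mapping_eqI)
    fix n
    have "Poly_Mapping.lookup (\<Sum>m\<in>Poly_Mapping.keys q. Poly_Mapping.single m (Poly_Mapping.lookup q m)) n =
      (\<Sum>m\<in>Poly_Mapping.keys q. if n = m then Poly_Mapping.lookup q m else 0)"
      by (auto simp: lookup_sum lookup_single when_def intro!: sum.cong)
    then show "Poly_Mapping.lookup q n =
      Poly_Mapping.lookup (\<Sum>m\<in>Poly_Mapping.keys q. Poly_Mapping.single m (Poly_Mapping.lookup q m)) n"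
      by (simp add: in_keys_iff)
  qed
  have "P (\<Sum>m\<in>A. Poly_Mapping.single m (Poly_Mapping.lookup q m)) \<and>
    homog s (\<Sum>m\<in>A. Poly_Mapping.single m (Poly_Mapping.lookup q m))"
    if "finite A" "A \<subseteq> Poly_Mapping.keys q" for A
    using that
  proof (induction A rule: finite_induct)
    case (insert m A)
    obtain x y z where m: "m = expo x y z" by (metis expo_lookup)
    have "x + y + z = s"
      using insert.prems assms(1) by (auto simp: homog_def in_keys_iff m)
    then show ?case
      using insert by (auto intro!: assms(3,4) homog_add homog_mon simp: m)
  qed (simp add: assms(2))
  from this[of "Poly_Mapping.keys q"] show ?thesis using q by simp
qed

lemma homog_mult: "homog s q \<Longrightarrow> homog t r \<Longrightarrow> homog (s + t) (q * r :: 'k::comm_ring_1 pol3)"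
proof (induction rule: homog_induct)
  case (mon x y z a)
  from mon(2) show ?case
    by (induction rule: homog_induct)
      (use mon(1) in \<open>auto simp: mon_mult distrib_left intro!: homog_mon homog_add\<close>)
qed (auto simp: distrib_right intro: homog_add)

lemma homog_basic [simp]: "homog 0 (cst r)" "homog 0 1" "homog 1 va" "homog 1 vb" "homog 1 vc" "homog 2 kap"
proof -
  show a: "homog 0 (cst r)" "homog 1 va" "homog 1 vb" "homog 1 vc"
    by (auto simp: cst_def va_def vb_def vc_def intro!: homog_mon)
  show "homog 0 1" by (auto simp: homog_def lookup_one when_def split: if_splits)
  show "homog 2 kap"
    unfolding kap_def using homog_mult[OF a(3) a(3)] homog_mult[OF a(2) a(4)]
    by (auto intro: homog_add simp: numeral_2_eq_2)
qed

lemma homog_op: "homog s q \<Longrightarrow> homog s (opE q)" "homog s q \<Longrightarrow> homog s (opF q)" "homog s q \<Longrightarrow> homog s (opH q)"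
proof -
  assume "homog s q"
  then have "homog s (opE q) \<and> homog s (opF q) \<and> homog s (opH q)"
  proof (induction rule: homog_induct)
    case (mon x y z r)
    then show ?case
      by (cases x; cases y; cases z) (auto simp: op_mon intro!: homog_diff homog_uminus homog_mon)
  qed (auto simp: op_add intro: homog_add)
  then show "homog s (opE q)" "homog s (opF q)" "homog s (opH q)" by blast+
qed

lemma homog_cone_mon: "\<bar>w\<bar> \<le> int s \<Longrightarrow> homog s (cone_mon s w r)"
  by (auto simp: cone_mon_def intro!: homog_mon)

lemma symb_cone_mon: "\<bar>w\<bar> \<le> int s \<Longrightarrow> symb s w' (cone_mon s w r) = (if w' = w then r else 0)"
  by (auto simp: cone_mon_def symb_mon simp flip: power_add mult.assoc)

lemma cone_mon_add: "cone_mon s w (r + t) = cone_mon s w r + cone_mon s w t"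
  by (simp add: cone_mon_def single_add distrib_left)

lemma cone_mon_0 [simp]: "cone_mon s w 0 = 0"
  by (simp add: cone_mon_def)

text \<open>Restriction to the cone is onto the binary forms.\<close>

lemma ex_symb:
  fixes r :: "int \<Rightarrow> 'k::comm_ring_1"
  obtains q where "homog s q" "\<And>w. symb s w q = (if \<bar>w\<bar> \<le> int s then r w else 0)"
proof
  let ?q = "\<Sum>w\<in>{- int s..int s}. cone_mon s w (r w)"
  show "homog s ?q" by (intro homog_sum homog_cone_mon) auto
  have "symb s w ?q = (\<Sum>w'\<in>{- int s..int s}. if w = w' then r w' else 0)" for w
    unfolding symb_sum by (rule sum.cong) (auto simp: symb_cone_mon)
  then show "symb s w ?q = (if \<bar>w\<bar> \<le> int s then r w else 0)" for w
    by (auto simp: abs_le_iff)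
qed

text \<open>
  Replacing \<open>va * vc\<close> by \<open>kap - vb\<^sup>2\<close> repeatedly shows that a form that vanishes on the cone is a
  multiple of \<open>kap\<close>.
\<close>

lemma homog_decompose:
  fixes q :: "'k::comm_ring_1 pol3"
  assumes "homog s q"
  obtains q' where "q = (\<Sum>w\<in>{- int s..int s}. cone_mon s w (symb s w q)) + kap * q'"
    "q' = 0 \<or> (\<exists>t. s = Suc (Suc t) \<and> homog t q')"
proof -
  have "\<exists>q'. q = (\<Sum>w\<in>{- int s..int s}. cone_mon s w (symb s w q)) + kap * q' \<and>
    (q' = 0 \<or> (\<exists>t. s = Suc (Suc t) \<and> homog t q'))"
    using assms
  proof (induction rule: homog_induct)
    case (mon x y z r)
    then show ?case
    proof (induction x arbitrary: y z r)
      case 0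
      have "cone_mon s w (symb s w (mon 0 y z r)) = (if w = - int z then mon 0 y z r else 0)" for w
        using 0 by (auto simp: cone_mon_neg symb_mon simp flip: power_add mult.assoc)
      then have "(\<Sum>w\<in>{- int s..int s}. cone_mon s w (symb s w (mon 0 y z r))) = mon 0 y z r"
        using 0 by simp
      then show ?case by (intro exI[of _ 0]) simp
    next
      case (Suc x)
      show ?case
      proof (cases z)
        case 0
        have "cone_mon s w (symb s w (mon (Suc x) y z r)) = (if w = int (Suc x) then mon (Suc x) y z r else 0)" for w
          using Suc.prems 0 by (auto simp: symb_mon cone_mon_def nat_add_distrib)
        then have "(\<Sum>w\<in>{- int s..int s}. cone_mon s w (symb s w (mon (Suc x) y z r))) = mon (Suc x) y z r"
          using Suc.prems by simp
        then show ?thesis by (intro exI[of _ 0]) simp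
      next
        case (Suc z')
        have e: "mon (Suc x) y z r = kap * mon x y z' r + mon x (Suc (Suc y)) z' (- r)"
          by (simp add: Suc kap_def distrib_right mult.assoc var_mon flip: single_add)
        have "x + Suc (Suc y) + z' = s" using Suc.prems Suc by simp
        from Suc.IH[OF this, of "- r"] obtain q' where
          q': "mon x (Suc (Suc y)) z' (- r) =
            (\<Sum>w\<in>{- int s..int s}. cone_mon s w (symb s w (mon x (Suc (Suc y)) z' (- r)))) + kap * q'"
            "q' = 0 \<or> (\<exists>t. s = Suc (Suc t) \<and> homog t q')" by blast
        have "symb s w (mon x (Suc (Suc y)) z' (- r)) = symb s w (mon (Suc x) y z r)" for w
          unfolding e by (simp add: symb_add symb_kap)
        then have "mon (Suc x) y z r = (\<Sum>w\<in>{- int s..int s}. cone_mon s w (symb s w (mon (Suc x) y z r))) +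
          kap * (q' + mon x y z' r)"
          using q'(1) e by (simp add: distrib_left)
        moreover have "\<exists>t. s = Suc (Suc t) \<and> homog t (q' + mon x y z' r)"
          using Suc.prems q'(2) by (intro exI[of _ "x + y + z'"]) (auto simp: Suc intro!: homog_add homog_mon)
        ultimately show ?thesis by blast
      qed
    qed
  next
    case (add f g)
    from add.IH obtain f' g' where
      f: "f = (\<Sum>w\<in>{- int s..int s}. cone_mon s w (symb s w f)) + kap * f'"
        "f' = 0 \<or> (\<exists>t. s = Suc (Suc t) \<and> homog t f')" and
      g: "g = (\<Sum>w\<in>{- int s..int s}. cone_mon s w (symb s w g)) + kap * g'"
        "g' = 0 \<or> (\<exists>t. s = Suc (Suc t) \<and> homog t g')" by blast
    have *: "(\<Sum>w\<in>{- int s..int s}. cone_mon s w (symb s w (f + g))) =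
      (\<Sum>w\<in>{- int s..int s}. cone_mon s w (symb s w f)) + (\<Sum>w\<in>{- int s..int s}. cone_mon s w (symb s w g))"
      by (simp only: symb_add cone_mon_add sum.distrib)
    have "f + g = (\<Sum>w\<in>{- int s..int s}. cone_mon s w (symb s w (f + g))) + kap * (f' + g')"
      unfolding * using arg_cong2[OF f(1) g(1), of "(+)"]
      by (simp only: distrib_left add_ac)
    moreover have "f' + g' = 0 \<or> (\<exists>t. s = Suc (Suc t) \<and> homog t (f' + g'))"
      using f(2) g(2) by (auto intro: homog_add)
    ultimately show ?case by blast
  qed (intro exI[of _ 0], simp)
  then show ?thesis using that by blast
qed

lemma symb_0_imp_kap_dvd:
  fixes q :: "'k::comm_ring_1 pol3"
  assumes "homog s q" "\<And>w. symb s w q = 0"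
  obtains q' where "q = kap * q'" "q' = 0 \<or> (\<exists>t. s = Suc (Suc t) \<and> homog t q')"
  using homog_decompose[OF assms(1)] by (metis (no_types, lifting) add_0 assms(2) cone_mon_0 sum.neutral)

lemma kap_neq_0: "kap \<noteq> (0 :: 'k::idom pol3)"
proof
  assume "kap = (0 :: 'k pol3)"
  then have "Poly_Mapping.lookup (kap :: 'k pol3) (expo 0 2 0) = 0" by simp
  then show False
    by (simp add: kap_def va_def vb_def vc_def mon_mult lookup_add lookup_single when_def numeral_2_eq_2)
qed

text \<open>
  The ring of polynomials is a domain, which makes division by \<open>kap\<close> unambiguous.
\<close>

lemma kap_cancel: "kap * q = kap * r \<longleftrightarrow> q = (r :: 'k::idom pol3)"
  by (simp add: kap_neq_0)

section \<open>The complex in coordinates\<close>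

text \<open>
  Every element is obtained from constants by adding and by multiplying with generators from the
  left, so that a derivation, or a ring homomorphism, is determined on generators.
\<close>

lemma ext_term_single:
  fixes S :: "'x::{finite,linorder} set" and m :: "'y::finite \<Rightarrow>\<^sub>0 nat"
  assumes const: "\<And>r. P (ext_const r)"
    and x: "\<And>i f. P f \<Longrightarrow> P (gen_x i * f)"
    and y: "\<And>j f. P f \<Longrightarrow> P (gen_y j * f)"
  shows "P (ext_term S (Poly_Mapping.single m (r :: 'k::comm_ring_1)))"
proof (induction "card S" arbitrary: S)
  case 0
  then have [simp]: "S = {}" by simp
  show ?case
  proof (induction "\<Sum>j\<in>UNIV. Poly_Mapping.lookup m j" arbitrary: m)
    case 0
    then have "m = 0" by (intro poly_mapping_eqI) simp
    then have "ext_term S (Poly_Mapping.single m r) = (ext_const r :: ('x, 'y, 'k) ext_poly)"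
      by (intro ext_poly_eqI) (simp add: ext_const.rep_eq coef_ext_term)
    then show ?case using const by simp
  next
    case (Suc n)
    then obtain i where i: "Poly_Mapping.lookup m i \<noteq> 0" by force
    define m' where "m' = m - Poly_Mapping.single i 1"
    have m': "m = Poly_Mapping.single i 1 + m'"
      using i by (intro poly_mapping_eqI) (auto simp: m'_def lookup_add lookup_minus lookup_single when_def)
    have "(\<Sum>j\<in>UNIV. Poly_Mapping.lookup m j) = 1 + (\<Sum>j\<in>UNIV. Poly_Mapping.lookup m' j)"
      unfolding m' by (simp add: lookup_add sum.distrib lookup_single when_def)
    with Suc have "P (ext_term S (Poly_Mapping.single m' r))" by simp
    moreover have "ext_term S (Poly_Mapping.single m r) =
        (gen_y i * ext_term S (Poly_Mapping.single m' r) :: ('x, 'y, 'k) ext_poly)"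
      by (rule ext_poly_eqI) (simp add: coef_gen_y_mult coef_ext_term mult_single m')
    ultimately show ?case using y by simp
  qed
next
  case (Suc n)
  then have ne: "S \<noteq> {}" by auto
  define i where "i = Min S"
  have i: "i \<in> S" "\<And>j. j \<in> S - {i} \<Longrightarrow> i < j"
    using ne Min_in[of S] Min_le[of S] by (auto simp: i_def le_less)
  have "{(k, j). k \<in> {i} \<and> j \<in> S - {i} \<and> j < k} = {}" using i by force
  then have sgn: "inv_sign {i} (S - {i}) = 1" unfolding inv_sign_def by (simp only: card.empty power_0)
  have "ext_term S (Poly_Mapping.single m r) =
    (gen_x i * ext_term (S - {i}) (Poly_Mapping.single m r) :: ('x, 'y, 'k) ext_poly)"
    using i sgn by (intro ext_poly_eqI) (auto simp: coef_gen_x_mult coef_ext_term)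
  moreover have "P (ext_term (S - {i}) (Poly_Mapping.single m r))"
    using Suc i by (intro Suc(1)) simp
  ultimately show ?case using x by simp
qed

lemma ext_poly_induct [case_names const add gen_x gen_y]:
  fixes f :: "('x::{finite,linorder}, 'y::finite, 'k::comm_ring_1) ext_poly"
  assumes const: "\<And>r. P (ext_const r)"
    and add: "\<And>f g. P f \<Longrightarrow> P g \<Longrightarrow> P (f + g)"
    and x: "\<And>i f. P f \<Longrightarrow> P (gen_x i * f)"
    and y: "\<And>j f. P f \<Longrightarrow> P (gen_y j * f)"
  shows "P f"
proof -
  have "ext_const 0 = (0 :: ('x, 'y, 'k) ext_poly)"
    by (rule ext_poly_eqI) (simp add: ext_poly_coef)
  with const[of 0] have 0: "P 0" by simp
  have t: "P (ext_term S q)" for S q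
    by (induction q rule: pm_induct) (auto intro: ext_term_single const x y add simp: ext_term_add)
  have "P (\<Sum>S\<in>A. ext_term S (coef f S))" for A
    by (induction A rule: infinite_finite_induct) (auto intro: 0 t add)
  then show ?thesis using sum_ext_term[of f] by metis
qed

lemma gen_total: "1 \<in> E0_total 0" "gen_x i \<in> E0_total 1" "gen_y i \<in> E0_total 2"
proof -
  show "1 \<in> E0_total 0"
    by (auto simp: E0_total_def one_ext_poly.rep_eq lookup_one split: if_splits)
  show "gen_x i \<in> E0_total 1"
    by (auto simp: E0_total_def gen_x.rep_eq lookup_one split: if_splits)
  have "(\<Sum>j\<in>UNIV. Poly_Mapping.lookup (Poly_Mapping.single i (1::nat)) j) = 1"
    by (simp add: lookup_single when_def)
  then show "gen_y i \<in> E0_total 2"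
    by (auto simp: E0_total_def gen_y.rep_eq lookup_single split: if_splits)
qed

context
  fixes c :: "'n::{finite,linorder} \<Rightarrow> 'n \<Rightarrow> 'n \<Rightarrow> 'k::comm_ring_1"
begin

lemma d0_add: "d0 c (f + g) = d0 c f + d0 c g"
  using is_d0_d0[of c] unfolding is_d0_def by blast

lemma d0_const_mult: "d0 c (ext_const a * f) = ext_const a * d0 c f"
  using is_d0_d0[of c] unfolding is_d0_def by blast

lemma d0_gen_x: "d0 c (gen_x i) = dgen_x c i"
  using is_d0_d0[of c] unfolding is_d0_def dgen_x_def by blast

lemma d0_gen_y: "d0 c (gen_y i) = dgen_y c i"
  using is_d0_d0[of c] unfolding is_d0_def dgen_y_def by blast

lemma d0_gen_x_mult: "d0 c (gen_x i * f) = dgen_x c i * f - gen_x i * d0 c f"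
proof -
  have "d0 c (gen_x i * f) = d0 c (gen_x i) * f + (- 1) ^ 1 * gen_x i * d0 c f"
    using is_d0_d0[of c] gen_total(2)[of i] unfolding is_d0_def by blast
  then show ?thesis by (simp add: d0_gen_x)
qed

lemma d0_gen_y_mult: "d0 c (gen_y i * f) = dgen_y c i * f + gen_y i * d0 c f"
proof -
  have "d0 c (gen_y i * f) = d0 c (gen_y i) * f + (- 1) ^ 2 * gen_y i * d0 c f"
    using is_d0_d0[of c] gen_total(3)[of i] unfolding is_d0_def by blast
  then show ?thesis by (simp add: d0_gen_y)
qed

lemma d0_const: "d0 c (ext_const a) = 0"
proof -
  have "d0 c (1 * 1) = d0 c 1 * 1 + (- 1) ^ 0 * 1 * d0 c 1"
    using is_d0_d0[of c] gen_total(1) unfolding is_d0_def by blast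
  then have "d0 c 1 = 0" by simp
  then show ?thesis using d0_const_mult[of a 1] by simp
qed

lemma d0_0: "d0 c 0 = 0"
  using d0_add[of 0 0] by simp

lemma d0_uminus: "d0 c (- f) = - d0 c f"
  using d0_add[of "- f" f] by (simp add: d0_0 eq_neg_iff_add_eq_0)

lemma d0_diff: "d0 c (f - g) = d0 c f - d0 c g"
  using d0_add[of f "- g"] by (simp add: d0_uminus)

lemma d0_sum: "d0 c (sum g A) = (\<Sum>i\<in>A. d0 c (g i))"
  by (induction A rule: infinite_finite_induct) (simp_all add: d0_0 d0_add)

lemma ext_parity_gen_x_mult: "ext_parity (gen_x i * f) = - (gen_x i * ext_parity (f :: ('n, 'n, 'k) ext_poly))"
proof (rule ext_poly_eqI)
  fix U
  have "(- 1) ^ card U = - ((- 1) ^ card (U - {i}) :: ('n \<Rightarrow>\<^sub>0 nat) \<Rightarrow>\<^sub>0 'k)" if "i \<in> U"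
    using card.remove[OF _ that] by simp
  then show "coef (ext_parity (gen_x i * f)) U = coef (- (gen_x i * ext_parity f)) U"
    by (simp add: ext_parity.rep_eq coef_gen_x_mult uminus_ext_poly.rep_eq mult_ac del: card_Diff_singleton)
qed

lemma ext_parity_gen_y_mult: "ext_parity (gen_y i * f) = gen_y i * ext_parity (f :: ('n, 'n, 'k) ext_poly)"
  by (rule ext_poly_eqI) (simp add: ext_parity.rep_eq coef_gen_y_mult mult_ac)

lemma d0_mult: "d0 c (f * g) = d0 c f * g + ext_parity f * d0 c g"
proof (induction f rule: ext_poly_induct)
  case (const r)
  then show ?case by (simp add: d0_const_mult d0_const ext_d_const)
next
  case (add f f')
  then show ?case by (simp add: distrib_right d0_add ext_d_add)
next
  case (gen_x i f)
  then show ?case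
    by (simp add: mult.assoc d0_gen_x_mult ext_parity_gen_x_mult algebra_simps)
next
  case (gen_y i f)
  then show ?case
    by (simp add: mult.assoc d0_gen_y_mult ext_parity_gen_y_mult algebra_simps)
qed

end

text \<open>Elements of \<open>E0\<close> for a three-dimensional Lie algebra have eight coefficients.\<close>

lemma subsets_three:
  obtains "S = ({} :: 3 set)" | "S = {0}" | "S = {1}" | "S = {2}" | "S = {0, 1}" | "S = {0, 2}" | "S = {1, 2}"
    | "S = {0, 1, 2}"
proof -
  have "S \<in> Pow {0, 1, 2}" using UNIV_three by auto
  then show ?thesis unfolding Pow_insert using that by auto
qed

lemma ext3_eqI:
  assumes "coef f {} = coef g {}" "coef f {0} = coef g {0}" "coef f {1} = coef g {1}" "coef f {2} = coef g {2}"
    "coef f {0, 1} = coef g {0, 1}" "coef f {0, 2} = coef g {0, 2}" "coef f {1, 2} = coef g {1, 2}"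
    "coef f {0, 1, 2} = coef g {0, 1, 2}"
  shows "f = (g :: (3, 'y, 'k::zero) ext_poly)"
proof (rule ext_poly_eqI)
  fix S :: "3 set"
  show "coef f S = coef g S"
    by (rule subsets_three[of S]) (simp_all only: assms)
qed

lemma less_three [simp]: "(0::3) < 1" "(0::3) < 2" "(1::3) < 2" "\<not> (1::3) < 0" "\<not> (2::3) < 0" "\<not> (2::3) < 1"
proof -
  have a: "(0::3) < 1" "(0::3) < 2" "(1::3) < 2"
    by (simp_all add: less_bit1_def bit1.Rep_0 bit1.Rep_1 bit1.Rep_numeral)
  then show "(0::3) < 1" "(0::3) < 2" "(1::3) < 2" "\<not> (1::3) < 0" "\<not> (2::3) < 0" "\<not> (2::3) < 1"
    by (auto dest: less_asym)
qed

lemma inv_sign_single: "inv_sign {i} {j} = (if j < i then - 1 else 1)"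
proof -
  have "{(a, b). a \<in> {i} \<and> b \<in> {j} \<and> b < a} = (if j < i then {(i, j)} else {})" by auto
  then show ?thesis unfolding inv_sign_def by simp
qed

lemma inv_sign_insert2:
  fixes S :: "'x::{finite,linorder} set"
  shows "i \<notin> insert j S \<Longrightarrow> inv_sign (insert i (insert j S)) W = inv_sign {i} W * inv_sign (insert j S) W"
    "i \<notin> insert j S \<Longrightarrow> inv_sign W (insert i (insert j S)) = inv_sign W {i} * inv_sign W (insert j S)"
  unfolding insert_is_Un[of i "insert j S"]
  by (rule inv_sign_Un_left inv_sign_Un_right, simp)+

lemma sum_Pow_insert:
  assumes "a \<notin> A" "finite A"
  shows "sum F (Pow (insert a A)) = sum F (Pow A) + (\<Sum>S\<in>Pow A. F (insert a S))"
proof -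
  have "sum F (Pow (insert a A)) = sum F (Pow A) + sum F (insert a ` Pow A)"
    unfolding Pow_insert by (rule sum.union_disjoint) (use assms in auto)
  also have "sum F (insert a ` Pow A) = (\<Sum>S\<in>Pow A. F (insert a S))"
    using assms by (subst sum.reindex) (auto intro!: inj_onI)
  finally show ?thesis .
qed

lemma coef_mult3:
  fixes f g :: "(3, 'y, 'k::comm_ring_1) ext_poly"
  shows "coef (f * g) {} = coef f {} * coef g {}"
    "coef (f * g) {i} = coef f {} * coef g {i} + coef f {i} * coef g {}"
    "coef (f * g) {0, 1} = coef f {} * coef g {0, 1} + coef f {0} * coef g {1} - coef f {1} * coef g {0} +
       coef f {0, 1} * coef g {}"
    "coef (f * g) {0, 2} = coef f {} * coef g {0, 2} + coef f {0} * coef g {2} - coef f {2} * coef g {0} +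
       coef f {0, 2} * coef g {}"
    "coef (f * g) {1, 2} = coef f {} * coef g {1, 2} + coef f {1} * coef g {2} - coef f {2} * coef g {1} +
       coef f {1, 2} * coef g {}"
    "coef (f * g) {0, 1, 2} = coef f {} * coef g {0, 1, 2} + coef f {0} * coef g {1, 2} -
       coef f {1} * coef g {0, 2} + coef f {2} * coef g {0, 1} + coef f {0, 1} * coef g {2} -
       coef f {0, 2} * coef g {1} + coef f {1, 2} * coef g {0} + coef f {0, 1, 2} * coef g {}"
  by (simp_all add: times_ext_poly.rep_eq sum_Pow_insert inv_sign_insert2 inv_sign_single insert_Diff_if)

lemma coef_gen_x3 [simp]:
  "coef (gen_x i) {} = 0" "coef (gen_x i) {j} = (if i = j then 1 else 0)"
  "coef (gen_x i) {0, 1::3} = 0" "coef (gen_x i) {0, 2::3} = 0" "coef (gen_x i) {1, 2::3} = 0"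
  "coef (gen_x i) {0, 1, 2::3} = 0"
  by (auto simp: gen_x.rep_eq)

lemma var_eq_single:
  "Poly_Mapping.single (Poly_Mapping.single 0 1) 1 = va"
  "Poly_Mapping.single (Poly_Mapping.single 1 1) 1 = vb"
  "Poly_Mapping.single (Poly_Mapping.single 2 1) 1 = vc"
  by (simp_all add: va_def vb_def vc_def expo_def)

lemma coef_gen_y3 [simp]:
  "coef (gen_y 0) {} = va" "coef (gen_y 1) {} = vb" "coef (gen_y 2) {} = vc"
  "coef (gen_y i) {j} = 0"
  "coef (gen_y i) {0, 1::3} = 0" "coef (gen_y i) {0, 2::3} = 0" "coef (gen_y i) {1, 2::3} = 0"
  "coef (gen_y i) {0, 1, 2::3} = 0"
  by (simp_all add: gen_y.rep_eq flip: var_eq_single)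

lemma coef_const3 [simp]:
  "coef (ext_const r) {} = cst r"
  "coef (ext_const r) {j} = 0"
  "coef (ext_const r) {0, 1::3} = 0" "coef (ext_const r) {0, 2::3} = 0" "coef (ext_const r) {1, 2::3} = 0"
  "coef (ext_const r) {0, 1, 2::3} = 0"
  by (simp_all add: ext_const.rep_eq cst_def expo_0)

lemma coef_simps [simp]: "coef (f + g) S = coef f S + coef g S" "coef (f - g) S = coef f S - coef g S"
  "coef (- f) S = - coef f S" "coef 0 S = 0"
  by (simp_all add: ext_poly_coef)

lemma coef_1 [simp]: "coef 1 {} = 1" "coef 1 (insert i S) = 0"
  by (simp_all add: ext_poly_coef)

lemma coef_sum: "coef (sum g A) S = (\<Sum>i\<in>A. coef (g i) S)"
  by (induction A rule: infinite_finite_induct) simp_all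

text \<open>The structure constants of \<open>sl\<^sub>2\<close> in the basis \<open>f, h, e\<close>.\<close>

definition sl2c :: "3 \<Rightarrow> 3 \<Rightarrow> 3 \<Rightarrow> 'k::comm_ring_1" where
  "sl2c i j k =
    (if (i, j, k) = (0, 1, 0) then 2 else if (i, j, k) = (1, 0, 0) then - 2
     else if (i, j, k) = (0, 2, 1) then - 1 else if (i, j, k) = (2, 0, 1) then 1
     else if (i, j, k) = (1, 2, 2) then 2 else if (i, j, k) = (2, 1, 2) then - 2 else 0)"

lemma sl2c_simps [simp]:
  "sl2c i i k = 0"
  "sl2c 0 1 0 = 2" "sl2c 0 1 1 = 0" "sl2c 0 1 2 = 0"
  "sl2c 1 0 0 = - 2" "sl2c 1 0 1 = 0" "sl2c 1 0 2 = 0"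
  "sl2c 0 2 0 = 0" "sl2c 0 2 1 = - 1" "sl2c 0 2 2 = 0"
  "sl2c 2 0 0 = 0" "sl2c 2 0 1 = 1" "sl2c 2 0 2 = 0"
  "sl2c 1 2 0 = 0" "sl2c 1 2 1 = 0" "sl2c 1 2 2 = 2"
  "sl2c 2 1 0 = 0" "sl2c 2 1 1 = 0" "sl2c 2 1 2 = - 2"
  by (auto simp: sl2c_def)

abbreviation dd :: "(3, 'k::comm_ring_1) E0 \<Rightarrow> (3, 'k) E0" where "dd \<equiv> d0 sl2c"

lemma greaterThan_three: "{0<..} = {1, 2::3}" "{1<..} = {2::3}" "{2<..} = ({} :: 3 set)"
proof -
  have "x \<in> {0<..} \<longleftrightarrow> x \<in> {1, 2}" "x \<in> {1<..} \<longleftrightarrow> x \<in> {2}" "x \<in> {2<..} \<longleftrightarrow> x \<in> {}" for x :: 3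
    by (rule three_cases[of x]; simp)+
  then show "{0<..} = {1, 2::3}" "{1<..} = {2::3}" "{2<..} = ({} :: 3 set)" by blast+
qed

lemma dgen_sl2:
  "dgen_x sl2c 0 = (ext_const (- 2) * gen_x 0 * gen_x 1 :: (3, 'k::comm_ring_1) E0)"
  "dgen_x sl2c 1 = (gen_x 0 * gen_x 2 :: (3, 'k::comm_ring_1) E0)"
  "dgen_x sl2c 2 = (ext_const (- 2) * gen_x 1 * gen_x 2 :: (3, 'k::comm_ring_1) E0)"
  "dgen_y sl2c 0 = (ext_const 2 * gen_y 0 * gen_x 1 - ext_const 2 * gen_y 1 * gen_x 0 :: (3, 'k::comm_ring_1) E0)"
  "dgen_y sl2c 1 = (gen_y 2 * gen_x 0 - gen_y 0 * gen_x 2 :: (3, 'k::comm_ring_1) E0)"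
  "dgen_y sl2c 2 = (ext_const 2 * gen_y 1 * gen_x 2 - ext_const 2 * gen_y 2 * gen_x 1 :: (3, 'k::comm_ring_1) E0)"
  unfolding dgen_x_def dgen_y_def UNIV_three
  by (rule ext3_eqI; simp add: greaterThan_three coef_mult3 cst_ring; fail)+

text \<open>
  The Chevalley-Eilenberg differential in coordinates; everything below rests on these formulas.
\<close>

lemma coef_dd:
  "coef (dd f) {} = 0"
  "coef (dd f) {0} = opF (coef f {})" "coef (dd f) {1} = opH (coef f {})" "coef (dd f) {2} = opE (coef f {})"
  "coef (dd f) {0, 1} = opF (coef f {1}) - opH (coef f {0}) - 2 * coef f {0}"
  "coef (dd f) {0, 2} = opF (coef f {2}) - opE (coef f {0}) + coef f {1}"
  "coef (dd f) {1, 2} = opH (coef f {2}) - opE (coef f {1}) - 2 * coef f {2}"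
  "coef (dd f) {0, 1, 2} = opE (coef f {0, 1}) - opH (coef f {0, 2}) + opF (coef f {1, 2})"
proof -
  have "coef (dd f) {} = 0 \<and>
    coef (dd f) {0} = opF (coef f {}) \<and> coef (dd f) {1} = opH (coef f {}) \<and> coef (dd f) {2} = opE (coef f {}) \<and>
    coef (dd f) {0, 1} = opF (coef f {1}) - opH (coef f {0}) - 2 * coef f {0} \<and>
    coef (dd f) {0, 2} = opF (coef f {2}) - opE (coef f {0}) + coef f {1} \<and>
    coef (dd f) {1, 2} = opH (coef f {2}) - opE (coef f {1}) - 2 * coef f {2} \<and>
    coef (dd f) {0, 1, 2} = opE (coef f {0, 1}) - opH (coef f {0, 2}) + opF (coef f {1, 2})"
  proof (induction f rule: ext_poly_induct)
    case (const r)
    then show ?case by (simp add: d0_const)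
  next
    case (add f g)
    then show ?case by (simp only: d0_add coef_simps op_add add.IH) (simp add: algebra_simps)
  next
    case (gen_x i f)
    show ?case
      by (rule three_cases[of i]; simp only: d0_gen_x_mult dgen_sl2;
        simp add: coef_mult3 gen_x.IH op_mult op_uminus op_diff cst_ring cst_numeral algebra_simps)
  next
    case (gen_y i f)
    show ?case
      by (rule three_cases[of i]; simp only: d0_gen_y_mult dgen_sl2;
        simp add: coef_mult3 gen_y.IH op_mult op_uminus op_diff cst_ring cst_numeral algebra_simps)
  qed
  then show "coef (dd f) {} = 0"
    "coef (dd f) {0} = opF (coef f {})" "coef (dd f) {1} = opH (coef f {})" "coef (dd f) {2} = opE (coef f {})"
    "coef (dd f) {0, 1} = opF (coef f {1}) - opH (coef f {0}) - 2 * coef f {0}"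
    "coef (dd f) {0, 2} = opF (coef f {2}) - opE (coef f {0}) + coef f {1}"
    "coef (dd f) {1, 2} = opH (coef f {2}) - opE (coef f {1}) - 2 * coef f {2}"
    "coef (dd f) {0, 1, 2} = opE (coef f {0, 1}) - opH (coef f {0, 2}) + opF (coef f {1, 2})"
    by blast+
qed

lemma op_swap:
  "opE (opF q) = opF (opE q) + opH q"
  "opH (opE q) = opE (opH q) + 2 * opE q"
  "opH (opF q) = opF (opH q) - 2 * opF q"
  using op_commute[of q] by (simp_all add: diff_eq_eq add.commute)

lemma dd_dd: "dd (dd f) = 0"
  by (rule ext3_eqI) (simp_all add: coef_dd op_add op_diff op_mult op_swap algebra_simps)

text \<open>Polynomials as elements of exterior degree 0.\<close>

definition emb :: "'k::comm_ring_1 pol3 \<Rightarrow> (3, 'k) E0" where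
  "emb q = ext_term {} q"

lemma coef_emb: "coef (emb q) S = (if S = {} then q else 0)"
  by (simp add: emb_def coef_ext_term)

lemma coef_emb_mult: "coef (emb q * f) U = q * coef f U"
proof -
  have "coef (emb q * f) U = (\<Sum>S\<in>Pow U. if S = {} then q * coef f U else 0)"
    unfolding times_ext_poly.rep_eq by (rule sum.cong) (auto simp: coef_emb)
  then show ?thesis by simp
qed

lemma coef_mult_emb: "coef (f * emb q) U = q * coef f U"
proof -
  have "coef (f * emb q) U = (\<Sum>S\<in>Pow U. if S = U then q * coef f U else 0)"
    unfolding times_ext_poly.rep_eq by (rule sum.cong) (auto simp: coef_emb)
  then show ?thesis by simp
qed

lemma emb_commute: "emb q * f = f * emb q"
  by (rule ext_poly_eqI) (simp add: coef_emb_mult coef_mult_emb)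

lemma ext_poly_eq_iff: "f = g \<longleftrightarrow> (\<forall>S. coef f S = coef g S)"
  by (auto intro: ext_poly_eqI)

lemma emb_ring: "emb (q + r) = emb q + emb r" "emb (q * r) = emb q * emb r" "emb 0 = 0" "emb 1 = 1"
  "emb (- q) = - emb q" "emb (cst a) = ext_const a"
  by (simp_all add: ext_poly_eq_iff coef_emb coef_emb_mult one_ext_poly.rep_eq ext_const.rep_eq cst_def expo_0)

lemma coef_const_mult3: "coef (ext_const r * (f :: (3, 'k::comm_ring_1) E0)) U = cst r * coef f U"
  using coef_emb_mult[of "cst r" f U] by (simp add: emb_ring)

lemma dd_emb_kap: "dd (emb kap * f) = emb kap * dd f"
  by (rule ext3_eqI) (simp_all add: coef_dd coef_emb_mult op_mult algebra_simps)

lemma set_three_eq_iff: "S = T \<longleftrightarrow> (0 \<in> S \<longleftrightarrow> 0 \<in> T) \<and> (1 \<in> S \<longleftrightarrow> 1 \<in> T) \<and> (2 \<in> S \<longleftrightarrow> (2::3) \<in> T)"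
proof
  assume "(0 \<in> S \<longleftrightarrow> 0 \<in> T) \<and> (1 \<in> S \<longleftrightarrow> 1 \<in> T) \<and> (2 \<in> S \<longleftrightarrow> (2::3) \<in> T)"
  then have "x \<in> S \<longleftrightarrow> x \<in> T" for x by (rule_tac three_cases[of x]) simp_all
  then show "S = T" by blast
qed simp

text \<open>Elements given by their coefficients of \<open>1, x\<^sub>0, x\<^sub>1, x\<^sub>2, x\<^sub>0x\<^sub>1, x\<^sub>0x\<^sub>2, x\<^sub>1x\<^sub>2, x\<^sub>0x\<^sub>1x\<^sub>2\<close>.\<close>

definition mk :: "'k pol3 \<Rightarrow> 'k pol3 \<Rightarrow> 'k pol3 \<Rightarrow> 'k pol3 \<Rightarrow> 'k pol3 \<Rightarrow> 'k pol3 \<Rightarrow> 'k pol3 \<Rightarrow> 'k pol3 \<Rightarrow>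
    (3, 'k::comm_ring_1) E0" where
  "mk n a b c ab ac bc t = ext_term {} n + ext_term {0} a + ext_term {1} b + ext_term {2} c +
     ext_term {0, 1} ab + ext_term {0, 2} ac + ext_term {1, 2} bc + ext_term {0, 1, 2} t"

lemma coef_mk [simp]:
  "coef (mk n a b c ab ac bc t) {} = n" "coef (mk n a b c ab ac bc t) {0} = a"
  "coef (mk n a b c ab ac bc t) {1} = b" "coef (mk n a b c ab ac bc t) {2} = c"
  "coef (mk n a b c ab ac bc t) {0, 1} = ab" "coef (mk n a b c ab ac bc t) {0, 2} = ac"
  "coef (mk n a b c ab ac bc t) {1, 2} = bc" "coef (mk n a b c ab ac bc t) {0, 1, 2} = t"
  by (simp_all add: mk_def coef_ext_term set_three_eq_iff)

definition hodge :: "nat \<Rightarrow> (3, 'k::comm_ring_1) E0 \<Rightarrow> bool" where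
  "hodge s f \<longleftrightarrow> (\<forall>S. homog s (coef f S))"

lemma hodgeI:
  assumes "homog s (coef f {})" "homog s (coef f {0})" "homog s (coef f {1})" "homog s (coef f {2})"
    "homog s (coef f {0, 1})" "homog s (coef f {0, 2})" "homog s (coef f {1, 2})" "homog s (coef f {0, 1, 2})"
  shows "hodge s f"
  unfolding hodge_def
proof
  fix S show "homog s (coef f S)"
    by (rule subsets_three[of S]) (simp_all only: assms)
qed

lemma hodge_0 [simp]: "hodge s 0"
  by (simp add: hodge_def)

lemma hodge_add: "hodge s f \<Longrightarrow> hodge s g \<Longrightarrow> hodge s (f + g)"
  by (simp add: hodge_def homog_add)

lemma hodge_diff: "hodge s f \<Longrightarrow> hodge s g \<Longrightarrow> hodge s (f - g)"
  by (simp add: hodge_def homog_diff)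

lemma homog_cst_mult: "homog s q \<Longrightarrow> homog s (cst r * q)"
  using homog_mult[of 0 "cst r" s q] by simp

lemma homog_numeral_mult: "homog s q \<Longrightarrow> homog s (numeral n * (q :: 'k::comm_ring_1 pol3))"
  using homog_cst_mult[of s q "numeral n"] by (simp add: cst_numeral)

lemma hodge_const_mult: "hodge s f \<Longrightarrow> hodge s (ext_const r * f)"
  by (simp add: hodge_def coef_const_mult3 homog_cst_mult)

lemma hodge_dd: "hodge s f \<Longrightarrow> hodge s (dd f)"
  by (rule hodgeI)
    (auto simp: coef_dd hodge_def intro!: homog_add homog_diff homog_op homog_numeral_mult)

lemma hodge_emb_mult: "homog s q \<Longrightarrow> hodge t f \<Longrightarrow> hodge (s + t) (emb q * f)"
  by (simp add: hodge_def coef_emb_mult homog_mult)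

section \<open>Symbols of cochains\<close>

text \<open>
  \<open>vanishes s f w\<close>: the part of total weight \<open>2 w\<close> and Hodge degree \<open>s\<close> of \<open>f\<close> vanishes on the
  cone. The shifts account for the weights 2, 0, -2 of \<open>x\<^sub>0, x\<^sub>1, x\<^sub>2\<close>.
\<close>

definition vanishes :: "nat \<Rightarrow> (3, 'k::comm_ring_1) E0 \<Rightarrow> int \<Rightarrow> bool" where
  "vanishes s f w \<longleftrightarrow>
     symb s w (coef f {}) = 0 \<and>
     symb s (w - 1) (coef f {0}) = 0 \<and> symb s w (coef f {1}) = 0 \<and> symb s (w + 1) (coef f {2}) = 0 \<and>
     symb s (w - 1) (coef f {0, 1}) = 0 \<and> symb s w (coef f {0, 2}) = 0 \<and> symb s (w + 1) (coef f {1, 2}) = 0 \<and>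
     symb s w (coef f {0, 1, 2}) = 0"

text \<open>
  On the cone the differential preserves the total weight, and for each weight it is a complex of
  spaces of dimension at most \<open>1, 3, 3, 1\<close>. All case distinctions below concern the vanishing of the
  scalars \<open>2 w\<close>, \<open>s \<plusminus> w\<close> and \<open>s \<plusminus> w + 1\<close> in these matrices.
\<close>

lemma symb_dd:
  "symb s w (coef (dd f) {}) = 0"
  "symb s (w - 1) (coef (dd f) {0}) = - of_int (int s + w) * symb s w (coef f {})"
  "symb s w (coef (dd f) {1}) = of_int (2 * w) * symb s w (coef f {})"
  "symb s (w + 1) (coef (dd f) {2}) = - of_int (int s - w) * symb s w (coef f {})"
  "symb s (w - 1) (coef (dd f) {0, 1}) =
     - of_int (int s + w) * symb s w (coef f {1}) - of_int (2 * w) * symb s (w - 1) (coef f {0})"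
  "symb s w (coef (dd f) {0, 2}) = of_int (int s - w + 1) * symb s (w - 1) (coef f {0}) + symb s w (coef f {1})
     - of_int (int s + w + 1) * symb s (w + 1) (coef f {2})"
  "symb s (w + 1) (coef (dd f) {1, 2}) =
     of_int (int s - w) * symb s w (coef f {1}) + of_int (2 * w) * symb s (w + 1) (coef f {2})"
  "symb s w (coef (dd f) {0, 1, 2}) = - of_int (int s - w + 1) * symb s (w - 1) (coef f {0, 1})
     - of_int (2 * w) * symb s w (coef f {0, 2}) - of_int (int s + w + 1) * symb s (w + 1) (coef f {1, 2})"
  by (simp_all add: coef_dd symb_add symb_diff symb_op symb_numeral algebra_simps)

lemma cocycle_symb:
  assumes "dd z = 0"
  shows "of_int (int s + w) * symb s w (coef z {}) = 0"
  "of_int (2 * w) * symb s w (coef z {}) = 0"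
  "of_int (int s + w) * symb s w (coef z {1}) + of_int (2 * w) * symb s (w - 1) (coef z {0}) = 0"
  "of_int (int s - w + 1) * symb s (w - 1) (coef z {0}) + symb s w (coef z {1})
     - of_int (int s + w + 1) * symb s (w + 1) (coef z {2}) = 0"
  "of_int (int s - w) * symb s w (coef z {1}) + of_int (2 * w) * symb s (w + 1) (coef z {2}) = 0"
  "of_int (int s - w + 1) * symb s (w - 1) (coef z {0, 1})
     + of_int (2 * w) * symb s w (coef z {0, 2}) + of_int (int s + w + 1) * symb s (w + 1) (coef z {1, 2}) = 0"
proof -
  have z: "symb s w (coef (dd z) S) = 0" for S w using assms by simp
  note d = symb_dd[of s w z, unfolded z]
  have neg2: "a * x + b * y = 0" if "0 = - a * x - b * y" for a x b y :: 'a
  proof -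
    have "a * x + b * y = - (- a * x - b * y)" by simp
    also have "\<dots> = 0" unfolding that[symmetric] by simp
    finally show ?thesis .
  qed
  have neg3: "a * x + b * y + c * u = 0" if "0 = - a * x - b * y - c * u" for a x b y c u :: 'a
  proof -
    have "a * x + b * y + c * u = - (- a * x - b * y - c * u)" by simp
    also have "\<dots> = 0" unfolding that[symmetric] by simp
    finally show ?thesis .
  qed
  show "of_int (int s + w) * symb s w (coef z {}) = 0"
    using d(2) by (metis mult_minus_left neg_equal_0_iff_equal)
  show "of_int (2 * w) * symb s w (coef z {}) = 0" using d(3) by simp
  show "of_int (int s + w) * symb s w (coef z {1}) + of_int (2 * w) * symb s (w - 1) (coef z {0}) = 0"
    using d(5) by (rule neg2)
  show "of_int (int s - w + 1) * symb s (w - 1) (coef z {0}) + symb s w (coef z {1})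
     - of_int (int s + w + 1) * symb s (w + 1) (coef z {2}) = 0" using d(6) by simp
  show "of_int (int s - w) * symb s w (coef z {1}) + of_int (2 * w) * symb s (w + 1) (coef z {2}) = 0"
    using d(7) by simp
  show "of_int (int s - w + 1) * symb s (w - 1) (coef z {0, 1})
     + of_int (2 * w) * symb s w (coef z {0, 2}) + of_int (int s + w + 1) * symb s (w + 1) (coef z {1, 2}) = 0"
    using d(8) by (rule neg3)
qed

text \<open>
  The division by \<open>kap\<close> that drives the induction on the Hodge degree.
\<close>

lemma vanishes_imp_kap:
  fixes f :: "(3, 'k::idom) E0"
  assumes "hodge s f" "\<And>w. vanishes s f w"
  obtains y where "f = emb kap * y" "y = 0 \<or> (\<exists>t. s = Suc (Suc t) \<and> hodge t y)"
proof -
  have "symb s w (coef f S) = 0" for S w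
    using assms(2)[of w] assms(2)[of "w + 1"] assms(2)[of "w - 1"]
    by (rule_tac subsets_three[of S]) (simp_all add: vanishes_def)
  then have "\<exists>q. coef f S = kap * q \<and> (q = 0 \<or> (\<exists>t. s = Suc (Suc t) \<and> homog t q))" for S
    using symb_0_imp_kap_dvd[of s "coef f S"] assms(1) unfolding hodge_def by metis
  then obtain q where q: "\<And>S. coef f S = kap * q S" "\<And>S. q S = 0 \<or> (\<exists>t. s = Suc (Suc t) \<and> homog t (q S))"
    by metis
  define y where "y = ExtPoly q"
  have y: "coef y S = q S" for S by (simp add: y_def ExtPoly_inverse)
  show ?thesis
  proof
    show "f = emb kap * y" by (rule ext_poly_eqI) (simp add: coef_emb_mult q y)
    show "y = 0 \<or> (\<exists>t. s = Suc (Suc t) \<and> hodge t y)"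
    proof (cases "\<exists>t. s = Suc (Suc t)")
      case True
      then obtain t where t: "s = Suc (Suc t)" ..
      then have "homog t (q S)" for S using q(2)[of S] by auto
      then show ?thesis using t by (auto simp: hodge_def y)
    next
      case False
      then show ?thesis using q(2) by (auto intro!: ext_poly_eqI simp: y)
    qed
  qed
qed

lemma emb_kap_cancel: "emb kap * f = emb kap * g \<longleftrightarrow> f = (g :: (3, 'k::idom) E0)"
proof
  assume "emb kap * f = emb kap * g"
  then have "kap * coef f S = kap * coef g S" for S by (metis coef_emb_mult)
  then show "f = g" unfolding kap_cancel by (rule ext_poly_eqI)
qed simp

lemma kap_cocycle: "dd (emb kap * y) = 0 \<Longrightarrow> dd (y :: (3, 'k::idom) E0) = 0"
  using emb_kap_cancel[of "dd y" 0] by (simp add: dd_emb_kap)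

text \<open>
  Any list of weight components, supported on the weights that occur, is the restriction of a form.
\<close>

lemma ex_symb':
  fixes r :: "int \<Rightarrow> 'k::comm_ring_1"
  assumes "\<And>w. \<bar>w\<bar> > int s \<Longrightarrow> r w = 0"
  obtains q where "homog s q" "\<And>w. symb s w q = r w"
proof -
  obtain q where q: "homog s q" "\<And>w. symb s w q = (if \<bar>w\<bar> \<le> int s then r w else 0)"
    using ex_symb[of s r] by blast
  show ?thesis
    by (rule that[OF q(1)]) (use q(2) assms in \<open>auto simp: not_le\<close>)
qed

text \<open>
  Cartan's formula: the contraction with \<open>h\<close> followed by \<open>d\<close>, plus the other composition, is the
  action of \<open>h\<close>, which is multiplication by \<open>2 w\<close> in weight \<open>2 w\<close>. The correction \<open>g\<close> is the contraction
  of \<open>z\<close> divided by the weight; a cocycle of this weight whose contraction is 0 is itself 0.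
\<close>

lemma weight_reduction:
  fixes z :: "(3, 'k::field) E0"
  assumes z: "hodge s z" "dd z = 0"
  obtains g where "hodge s g" "\<And>w. of_int (2 * w) \<noteq> (0 :: 'k) \<Longrightarrow> vanishes s (z - dd g) w"
proof -
  obtain n where n: "homog s n" "\<And>w. symb s w n = symb s w (coef z {1}) / of_int (2 * w)"
    by (rule ex_symb'[of s "\<lambda>w. symb s w (coef z {1}) / of_int (2 * w)"]) (simp_all add: symb_out)
  obtain a where a: "homog s a" "\<And>w. symb s w a = - symb s w (coef z {0, 1}) / of_int (2 * (w + 1))"
    by (rule ex_symb'[of s "\<lambda>w. - symb s w (coef z {0, 1}) / of_int (2 * (w + 1))"]) (simp_all add: symb_out)
  obtain c where c: "homog s c" "\<And>w. symb s w c = symb s w (coef z {1, 2}) / of_int (2 * (w - 1))"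
    by (rule ex_symb'[of s "\<lambda>w. symb s w (coef z {1, 2}) / of_int (2 * (w - 1))"]) (simp_all add: symb_out)
  obtain q where q: "homog s q" "\<And>w. symb s w q = - symb s w (coef z {0, 1, 2}) / of_int (2 * w)"
    by (rule ex_symb'[of s "\<lambda>w. - symb s w (coef z {0, 1, 2}) / of_int (2 * w)"]) (simp_all add: symb_out)
  \<comment> \<open>the contraction of \<open>z\<close> with \<open>h\<close>, divided weight by weight by \<open>2 w\<close>\<close>
  define g where "g = mk n a 0 c 0 q 0 0"
  show ?thesis
  proof
    show "hodge s g" by (rule hodgeI) (simp_all add: g_def n a c q)
    fix w :: int assume w: "of_int (2 * w) \<noteq> (0 :: 'k)"
    define z' where "z' = z - dd g"
    have "dd z' = 0" using z by (simp add: z'_def d0_diff dd_dd)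
    note cy = cocycle_symb[OF this, where s = s and w = w]
    have 1: "symb s w (coef z' {1}) = 0"
      using w by (simp add: z'_def symb_diff symb_dd) (simp add: g_def n)
    have 2: "symb s (w - 1) (coef z' {0, 1}) = 0"
      using w unfolding z'_def coef_simps symb_diff symb_dd by (simp add: g_def a)
    have 3: "symb s (w + 1) (coef z' {1, 2}) = 0"
      using w unfolding z'_def coef_simps symb_diff symb_dd by (simp add: g_def c)
    have 4: "symb s w (coef z' {0, 1, 2}) = 0"
      using w unfolding z'_def coef_simps symb_diff symb_dd by (simp add: g_def q)
    have "vanishes s z' w"
      unfolding vanishes_def using cy w 1 2 3 4 by simp
    then show "vanishes s (z - dd g) w" by (simp add: z'_def)
  qed
qed

lemma vanishes_out: "\<bar>w\<bar> > int s + 1 \<Longrightarrow> vanishes s f w"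
  by (auto simp: vanishes_def intro!: symb_out)

lemma vanishes_diff: "vanishes s f w \<Longrightarrow> vanishes s g w \<Longrightarrow> vanishes s (f - g) w"
  by (simp add: vanishes_def symb_diff)

lemma vanishes_dd: "vanishes s g w \<Longrightarrow> vanishes s (dd g) w"
  unfolding vanishes_def symb_dd by simp

lemma homog_0_cst: "homog 0 q \<Longrightarrow> \<exists>r. q = cst r"
proof (induction rule: homog_induct)
  case zero
  then show ?case by (metis cst_ring(1))
next
  case (mon x y z r)
  then show ?case by (auto simp: cst_def)
next
  case (add f g)
  then show ?case by (metis cst_ring(3))
qed

lemma ext_const_0: "ext_const 0 = (0 :: (3, 'k::comm_ring_1) E0)"
  by (rule ext_poly_eqI) (simp add: ext_const.rep_eq)

text \<open>
  The power of \<open>kap\<close> of Hodge degree \<open>s\<close>. It is 0 for odd \<open>s\<close>, so that statements need no case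
  distinction on the parity of the Hodge degree.
\<close>

definition kpow :: "nat \<Rightarrow> 'k::comm_ring_1 pol3" where
  "kpow s = (if even s then kap ^ (s div 2) else 0)"

lemma kap_kpow: "kap * kpow s = kpow (Suc (Suc s))"
  by (simp add: kpow_def)

lemma kpow_0 [simp]: "kpow 0 = 1" and kpow_odd: "odd s \<Longrightarrow> kpow s = 0"
  by (simp_all add: kpow_def)

definition vol :: "(3, 'k::comm_ring_1) E0" where
  "vol = ext_term {0, 1, 2} 1"

lemma coef_vol: "coef vol S = (if S = {0, 1, 2} then 1 else 0)"
  by (simp add: vol_def coef_ext_term)

section \<open>An invariant functional\<close>

text \<open>
  Up to a factor, \<open>laplace n\<close> is the \<open>n\<close>-th power of the Laplacian dual to \<open>kap\<close>, as a functional on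
  forms of degree \<open>2 n\<close>. In this normalisation the coefficients are integers without common
  denominators, and the value at \<open>vb\<^bsup>2 n\<^esup>\<close> is the product of the odd numbers below \<open>2 n\<close>.
\<close>

definition laplace_coeff :: "nat \<Rightarrow> nat \<Rightarrow> nat" where
  "laplace_coeff n x = (\<Prod>j\<in>{1..x}. 2 * j) * (\<Prod>j\<in>{Suc x..n}. 2 * n - 2 * j + 1)"

lemma laplace_coeff_Suc:
  assumes "x < n"
  shows "(2 * n - 2 * x - 1) * laplace_coeff n (Suc x) = 2 * Suc x * laplace_coeff n x"
proof -
  define m where "m = 2 * n - 2 * x - 1"
  have "(\<Prod>j\<in>{Suc x..n}. 2 * n - 2 * j + 1) = m * (\<Prod>j\<in>{Suc (Suc x)..n}. 2 * n - 2 * j + 1)"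
    using assms by (subst prod.atLeast_Suc_atMost) (simp_all add: m_def Suc_diff_Suc)
  then show ?thesis
    unfolding m_def[symmetric] laplace_coeff_def by (simp only: prod.cl_ivl_Suc) (simp add: algebra_simps)
qed

definition laplace :: "nat \<Rightarrow> 'k::comm_ring_1 pol3 \<Rightarrow> 'k" where
  "laplace n = linf (\<lambda>m. if Poly_Mapping.lookup m 0 = Poly_Mapping.lookup m 2 \<and>
     Poly_Mapping.lookup m 1 + 2 * Poly_Mapping.lookup m 0 = 2 * n
     then of_nat (laplace_coeff n (Poly_Mapping.lookup m 0)) else 0)"

lemma laplace_mon: "laplace n (mon x y z r) = (if x = z \<and> y + 2 * x = 2 * n then r * of_nat (laplace_coeff n x) else 0)"
  by (simp add: laplace_def linf_single)

lemma laplace_add: "laplace n (q + r) = laplace n q + laplace n r"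
  by (simp add: laplace_def linf_add)

lemma laplace_diff: "laplace n (q - r) = laplace n q - laplace n r"
  using laplace_add[of n "q - r" r] by (simp add: algebra_simps)

lemma laplace_0 [simp]: "laplace n 0 = 0"
  by (simp add: laplace_def linf_def)

lemma laplace_uminus: "laplace n (- q) = - laplace n q"
  using laplace_diff[of n 0 q] by simp

lemma laplace_coeff_Suc':
  assumes "Suc (y + 2 * x) = 2 * n"
  shows "of_nat y * of_nat (laplace_coeff n (Suc x)) = (2 * of_nat (Suc x) * of_nat (laplace_coeff n x) :: 'k::comm_ring_1)"
proof -
  have "x < n" and y: "2 * n - 2 * x - 1 = y" using assms by auto
  from laplace_coeff_Suc[OF this(1)] have "y * laplace_coeff n (Suc x) = 2 * Suc x * laplace_coeff n x"
    unfolding y .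
  then have "of_nat (y * laplace_coeff n (Suc x)) = (of_nat (2 * Suc x * laplace_coeff n x) :: 'k)"
    by (rule arg_cong)
  then show ?thesis by (simp only: of_nat_mult of_nat_numeral)
qed

text \<open>
  Invariance under \<open>e\<close> and \<open>f\<close> is the recursion \<open>laplace_coeff_Suc\<close>.
\<close>

lemma laplace_op: "laplace n (opE q) = 0" "laplace n (opF q) = 0" "laplace n (opH q) = 0"
proof -
  have "laplace n (opE q) = 0 \<and> laplace n (opF q) = 0 \<and> laplace n (opH q) = 0"
  proof (induction q rule: pol3_induct)
    case (mon x y z r)
    have "laplace n (opE (mon x y z r)) = 0"
    proof (cases "z = Suc x \<and> Suc (y + 2 * x) = 2 * n")
      case True
      from laplace_coeff_Suc'[OF conjunct2[OF True], where 'k = 'a] True show ?thesis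
        by (cases y) (auto simp: op_mon laplace_diff laplace_uminus laplace_mon mult_ac)
    qed (cases y; cases z; auto simp: op_mon laplace_diff laplace_uminus laplace_mon)
    moreover have "laplace n (opF (mon x y z r)) = 0"
    proof (cases "x = Suc z \<and> Suc (y + 2 * z) = 2 * n")
      case True
      from laplace_coeff_Suc'[OF conjunct2[OF True], where 'k = 'a] True show ?thesis
        by (cases y) (auto simp: op_mon laplace_diff laplace_uminus laplace_mon mult_ac)
    qed (cases y; cases x; auto simp: op_mon laplace_diff laplace_uminus laplace_mon)
    moreover have "laplace n (opH (mon x y z r)) = 0"
      by (simp add: op_mon laplace_mon)
    ultimately show ?case by blast
  qed (simp add: op_add laplace_add)
  then show "laplace n (opE q) = 0" "laplace n (opF q) = 0" "laplace n (opH q) = 0" by blast+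
qed

text \<open>
  A coboundary of exterior degree 3 is a sum of values of \<open>e\<close>, \<open>h\<close> and \<open>f\<close>.
\<close>

lemma laplace_dd: "laplace n (coef (dd f) {0, 1, 2}) = 0"
  by (simp add: coef_dd laplace_add laplace_diff laplace_op)

section \<open>Hodge degrees below \<open>p - 1\<close>\<close>

context
  assumes odd_p: "odd CARD('p::prime_card)"
begin

lemma p_ge_3: "CARD('p) \<ge> 3"
proof -
  have "CARD('p) \<ge> 2" using prime_card[where 'a = 'p] by (rule prime_ge_2_nat)
  then show ?thesis using odd_p by (cases "CARD('p) = 2") auto
qed

lemma of_nat_mod_ring_eq_0: "(of_nat n :: 'p mod_ring) = 0 \<longleftrightarrow> CARD('p) dvd n"
  by (simp add: of_nat_eq_0_iff_char_dvd)

lemma of_int_mod_ring_eq_0: "(of_int w :: 'p mod_ring) = 0 \<longleftrightarrow> int CARD('p) dvd w"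
proof (cases w)
  case (nonneg n)
  then show ?thesis by (simp add: of_nat_mod_ring_eq_0)
next
  case (neg n)
  have "(of_int w :: 'p mod_ring) = - of_nat (Suc n)" unfolding neg by simp
  then have "(of_int w :: 'p mod_ring) = 0 \<longleftrightarrow> CARD('p) dvd Suc n"
    by (simp only: neg_equal_0_iff_equal of_nat_mod_ring_eq_0)
  moreover have "int CARD('p) dvd w \<longleftrightarrow> CARD('p) dvd Suc n" unfolding neg by (simp only: dvd_minus_iff int_dvd_int_iff)
  ultimately show ?thesis by simp
qed

lemma two_neq_0: "(2 :: 'p mod_ring) \<noteq> 0"
proof -
  have "\<not> CARD('p) dvd 2" using p_ge_3 by (auto dest: dvd_imp_le)
  then show ?thesis using of_nat_mod_ring_eq_0[of 2] by simp
qed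

lemma of_nat_small_neq_0: "0 < n \<Longrightarrow> n < CARD('p) \<Longrightarrow> (of_nat n :: 'p mod_ring) \<noteq> 0"
  using nat_dvd_not_less by (auto simp: of_nat_mod_ring_eq_0)

lemma of_int_2_neq_0: "\<not> int CARD('p) dvd w \<Longrightarrow> (of_int (2 * w) :: 'p mod_ring) \<noteq> 0"
  using two_neq_0 by (simp add: of_int_mod_ring_eq_0)

text \<open>
  By Cartan's homotopy only the weight 0 remains, since \<open>\<bar>w\<bar> \<le> s + 1 < p\<close>. There the matrices of
  \<open>symb_dd\<close> form an exact complex, because \<open>s\<close> and \<open>s + 1\<close> are invertible.
\<close>

lemma cocycle_low_degree_step:
  fixes z :: "(3, 'p mod_ring) E0"
  assumes s: "0 < s" "Suc s < CARD('p)" and z: "hodge s z" "dd z = 0"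
  obtains g y where "z = dd g + emb kap * y" "y = 0 \<or> (\<exists>t. s = Suc (Suc t) \<and> hodge t y)"
proof -
  let ?s = "of_nat s :: 'p mod_ring"
  have s0: "?s \<noteq> 0" "1 + ?s \<noteq> 0"
    using of_nat_small_neq_0[of s] of_nat_small_neq_0[of "Suc s"] s by simp_all
  obtain g1 where g1: "hodge s g1" "\<And>w. of_int (2 * w) \<noteq> (0 :: 'p mod_ring) \<Longrightarrow> vanishes s (z - dd g1) w"
    using weight_reduction[OF z] by metis
  define z1 where "z1 = z - dd g1"
  have z1: "hodge s z1" "dd z1 = 0"
    unfolding z1_def using z g1 by (simp_all add: hodge_diff hodge_dd d0_diff dd_dd)
  \<comment> \<open>the solution of \<open>d g2 = z1\<close> on the cone in weight 0\<close>
  define B where "B = - symb s (- 1) (coef z1 {0, 1}) / ?s"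
  define g2 where "g2 = mk (cone_mon s 0 (- symb s (- 1) (coef z1 {0}) / ?s))
    (cone_mon s (- 1) ((symb s 0 (coef z1 {0, 2}) - B) / (1 + ?s))) (cone_mon s 0 B) 0
    (cone_mon s (- 1) (- symb s 0 (coef z1 {0, 1, 2}) / (1 + ?s))) 0 0 0"
  have g2: "hodge s g2"
    using s by (intro hodgeI) (simp_all add: g2_def homog_cone_mon)
  have "vanishes s (z1 - dd g2) w" for w
  proof -
    consider "\<not> int CARD('p) dvd w" | "int CARD('p) dvd w" "w \<noteq> 0" | "w = 0" by blast
    then show ?thesis
    proof cases
      case 1
      then have "w \<noteq> 0" by auto
      then have "vanishes s g2 w"
        using s by (simp add: vanishes_def g2_def symb_cone_mon)
      moreover have "vanishes s z1 w" using g1(2)[OF of_int_2_neq_0[OF 1]] by (simp add: z1_def)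
      ultimately show ?thesis by (intro vanishes_diff vanishes_dd)
    next
      case 2
      then have "\<bar>w\<bar> \<ge> int CARD('p)" using dvd_imp_le_int[OF 2(2,1)] by simp
      then show ?thesis using s by (intro vanishes_out) linarith
    next
      case 3
      let ?n = "symb s 0 (coef z1 {})" and ?a = "symb s (- 1) (coef z1 {0})" and ?b = "symb s 0 (coef z1 {1})"
        and ?c = "symb s 1 (coef z1 {2})" and ?ab = "symb s (- 1) (coef z1 {0, 1})"
        and ?ac = "symb s 0 (coef z1 {0, 2})" and ?bc = "symb s 1 (coef z1 {1, 2})"
        and ?t = "symb s 0 (coef z1 {0, 1, 2})"
      have G: "symb s 0 (coef g2 {}) = - ?a / ?s" "symb s (- 1) (coef g2 {0}) = (?ac - B) / (1 + ?s)"
        "symb s 0 (coef g2 {1}) = B" "symb s 1 (coef g2 {2}) = 0"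
        "symb s (- 1) (coef g2 {0, 1}) = - ?t / (1 + ?s)" "symb s 0 (coef g2 {0, 2}) = 0"
        "symb s 1 (coef g2 {1, 2}) = 0"
        using s by (simp_all add: g2_def symb_cone_mon)
      have cy': "?n = 0" "?b = 0" "?c = ?a" "?bc = - ?ab"
      proof -
        show "?n = 0" "?b = 0" using cocycle_symb(1,3)[OF z1(2), of s 0] s0 by simp_all
        then have "(1 + ?s) * (?a - ?c) = 0"
          using cocycle_symb(4)[OF z1(2), of s 0] by (simp add: algebra_simps)
        then show "?c = ?a" using s0 by simp
        have "(1 + ?s) * (?bc + ?ab) = 0"
          using cocycle_symb(6)[OF z1(2), of s 0] by (simp add: algebra_simps)
        then show "?bc = - ?ab" using s0 by (simp add: eq_neg_iff_add_eq_0)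
      qed
      note D = symb_dd[of s 0 g2]
      have e: "(- 1 - ?s) * x / (1 + ?s) = - x" for x
        using s0 by (simp add: field_simps)
      have "vanishes s (z1 - dd g2) 0"
        unfolding vanishes_def coef_simps symb_diff D
        using cy' s0 G e by (simp add: B_def add.commute)
      then show ?thesis using 3 by simp
    qed
  qed
  moreover have "hodge s (z1 - dd g2)" using z1 g2 by (simp add: hodge_diff hodge_dd)
  ultimately obtain y where y: "z1 - dd g2 = emb kap * y" "y = 0 \<or> (\<exists>t. s = Suc (Suc t) \<and> hodge t y)"
    using vanishes_imp_kap by blast
  have "z = dd (g1 + g2) + emb kap * y"
    using y(1) by (simp add: z1_def d0_add algebra_simps)
  then show ?thesis using that y(2) by blast
qed

lemma cocycle_hodge_0:
  fixes z :: "(3, 'p mod_ring) E0"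
  assumes z: "hodge 0 z" "dd z = 0"
  obtains r r' g where "z = ext_const r + ext_const r' * vol + dd g"
proof -
  have "\<exists>r. coef z S = cst r" for S using z homog_0_cst by (auto simp: hodge_def)
  then obtain r where r: "\<And>S. coef z S = cst (r S)" by metis
  have c0: "cst t = 0 \<Longrightarrow> t = 0" for t :: "'p mod_ring"
    by (metis cst_def lookup_single_eq lookup_zero)
  have d: "coef (dd z) S = 0" for S using z by simp
  have "cst (r {1}) = 0" using d[of "{0, 2}"] by (simp add: coef_dd r)
  moreover have "cst (2 * r {0}) = 0" using d[of "{0, 1}"] by (simp add: coef_dd r cst_ring cst_numeral)
  moreover have "cst (2 * r {2}) = 0" using d[of "{1, 2}"] by (simp add: coef_dd r cst_ring cst_numeral)
  ultimately have 0: "r {0} = 0" "r {1} = 0" "r {2} = 0"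
    using two_neq_0 by (auto dest!: c0)
  define g where "g = mk 0 (cst (- r {0, 1} / 2)) (cst (r {0, 2})) (cst (- r {1, 2} / 2)) 0 0 0 0"
  have h: "2 * cst (t / 2) = cst t" for t :: "'p mod_ring"
    using two_neq_0 by (simp flip: cst_numeral cst_ring)
  have "z = ext_const (r {}) + ext_const (r {0, 1, 2}) * vol + dd g"
    by (rule ext3_eqI)
      (simp_all add: r 0 coef_const_mult3 coef_vol g_def coef_dd op_uminus cst_ring h set_three_eq_iff
        del: minus_divide_left add: minus_divide_left[symmetric])
  then show ?thesis using that by blast
qed

text \<open>
  Modulo coboundaries, a cocycle of positive Hodge degree below \<open>p - 1\<close> is \<open>kap\<close> times a cocycle, so
  that induction leads to Hodge degree 0.
\<close>

lemma cocycle_low_degree: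
  fixes z :: "(3, 'p mod_ring) E0"
  assumes "Suc s < CARD('p)" "hodge s z" "dd z = 0"
  shows "\<exists>r r' g. z = emb (kpow s) * (ext_const r + ext_const r' * vol) + dd g"
  using assms
proof (induction s arbitrary: z rule: less_induct)
  case (less s)
  show ?case
  proof (cases "s = 0")
    case True
    obtain r r' g where "z = ext_const r + ext_const r' * vol + dd g"
      using less.prems by (auto simp: True intro: cocycle_hodge_0)
    then show ?thesis by (auto simp: True emb_ring)
  next
    case False
    with less.prems obtain g y where gy: "z = dd g + emb kap * y" "y = 0 \<or> (\<exists>t. s = Suc (Suc t) \<and> hodge t y)"
      using cocycle_low_degree_step[of s z] by auto
    from gy(2) show ?thesis
    proof
      assume "y = 0"
      then show ?thesis using gy(1) by (intro exI[of _ 0] exI[of _ g]) (simp add: ext_const_0)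
    next
      assume "\<exists>t. s = Suc (Suc t) \<and> hodge t y"
      then obtain t where t: "s = Suc (Suc t)" "hodge t y" by blast
      have "dd (emb kap * y) = 0" using gy(1) less.prems(3) by (simp add: d0_add dd_dd)
      then have "dd y = 0" by (rule kap_cocycle)
      with less.IH[of t y] less.prems t obtain r r' g' where
        y: "y = emb (kpow t) * (ext_const r + ext_const r' * vol) + dd g'" by auto
      have "emb kap * y = emb (kpow s) * (ext_const r + ext_const r' * vol) + dd (emb kap * g')"
        unfolding y t kap_kpow[symmetric] emb_ring dd_emb_kap by (simp add: distrib_left mult.assoc)
      then have "z = emb (kpow s) * (ext_const r + ext_const r' * vol) + dd (g + emb kap * g')"
        using gy(1) by (simp add: d0_add)
      then show ?thesis by blast
    qed
  qed
qed

text \<open>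
  The obstruction that distinguishes the volume class: the value of \<open>laplace\<close> on
  \<open>vb\<^bsup>2 n\<^esup>\<close> is a product of odd numbers smaller than \<open>p\<close>.
\<close>

lemma vb_power_not_exact:
  assumes "2 * n < Suc CARD('p)" "coef (dd g) {0, 1, 2} = cst r * vb ^ (2 * n)"
  shows "r = (0 :: 'p mod_ring)"
proof -
  have "laplace n (cst r * vb ^ (2 * n)) = 0" using laplace_dd[of n g] assms(2) by simp
  then have "r * of_nat (laplace_coeff n 0) = 0"
    by (simp add: var_power cst_mon laplace_mon)
  moreover have "(of_nat (2 * n - 2 * j + 1) :: 'p mod_ring) \<noteq> 0" if "j \<in> {Suc 0..n}" for j
    using that assms(1) by (intro of_nat_small_neq_0) auto
  then have "(of_nat (laplace_coeff n 0) :: 'p mod_ring) \<noteq> 0"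
    by (simp add: laplace_coeff_def del: of_nat_add of_nat_Suc)
  ultimately show ?thesis by simp
qed

text \<open>
  The classes of \<open>cocycle_low_degree\<close> have exterior degrees 0 and 3 only.
\<close>

lemma low_two_form_exact:
  fixes z :: "(3, 'p mod_ring) E0"
  assumes "Suc s < CARD('p)" "z = mk 0 0 0 0 P Q R 0" "hodge s z" "dd z = 0"
  obtains g where "z = dd g"
proof -
  obtain r r' g where z: "z = emb (kpow s) * (ext_const r + ext_const r' * vol) + dd g"
    using cocycle_low_degree[OF assms(1,3,4)] by blast
  have "z = dd (mk 0 (coef g {0}) (coef g {1}) (coef g {2}) 0 0 0 0)"
  proof (rule ext3_eqI)
    show "coef z {0, 1} = coef (dd (mk 0 (coef g {0}) (coef g {1}) (coef g {2}) 0 0 0 0)) {0, 1}"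
      unfolding z by (simp add: coef_dd coef_emb_mult coef_const_mult3 coef_vol set_three_eq_iff)
    show "coef z {0, 2} = coef (dd (mk 0 (coef g {0}) (coef g {1}) (coef g {2}) 0 0 0 0)) {0, 2}"
      unfolding z by (simp add: coef_dd coef_emb_mult coef_const_mult3 coef_vol set_three_eq_iff)
    show "coef z {1, 2} = coef (dd (mk 0 (coef g {0}) (coef g {1}) (coef g {2}) 0 0 0 0)) {1, 2}"
      unfolding z by (simp add: coef_dd coef_emb_mult coef_const_mult3 coef_vol set_three_eq_iff)
  qed (simp_all add: coef_dd assms(2))
  then show ?thesis by (rule that)
qed

text \<open>
  A cochain that is a cocycle on the cone has a coboundary divisible by \<open>kap\<close>. The quotient is a cocycle,
  and when it is a 2-form of low degree, it is exact and can be absorbed by a correction that does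
  not change the restriction to the cone.
\<close>

lemma lift_cocycle:
  fixes f :: "(3, 'p mod_ring) E0"
  assumes "Suc t < CARD('p)" "dd f = emb kap * mk 0 0 0 0 P Q R 0" "hodge t (mk 0 0 0 0 P Q R 0)"
  obtains g where "dd (f - emb kap * g) = 0"
proof -
  have "dd (emb kap * mk 0 0 0 0 P Q R 0) = 0" unfolding assms(2)[symmetric] by (rule dd_dd)
  then have "dd (mk 0 0 0 0 P Q R 0) = 0" by (rule kap_cocycle)
  then obtain g where "mk 0 0 0 0 P Q R 0 = dd g"
    using low_two_form_exact[OF assms(1) refl assms(3)] by blast
  then have "dd (f - emb kap * g) = 0" by (simp add: d0_diff dd_emb_kap assms(2))
  then show ?thesis by (rule that)
qed

end

section \<open>Projection to a Hodge degree\<close>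

lift_definition hcomp :: "nat \<Rightarrow> 'k::zero pol3 \<Rightarrow> 'k pol3" is
  "\<lambda>s q m. if Poly_Mapping.lookup m 0 + Poly_Mapping.lookup m 1 + Poly_Mapping.lookup m 2 = s then q m else 0"
  by (rule rev_finite_subset) auto

lemma hcomp_mon: "hcomp s (mon x y z r) = (if x + y + z = s then mon x y z r else 0)"
  by (rule poly_mapping_eqI) (auto simp: hcomp.rep_eq lookup_single when_def)

lemma hcomp_add: "hcomp s (q + r) = hcomp s q + hcomp s r"
  by (rule poly_mapping_eqI) (simp add: hcomp.rep_eq lookup_add)

lemma hcomp_0 [simp]: "hcomp s 0 = 0"
  by (rule poly_mapping_eqI) (simp add: hcomp.rep_eq)

lemma hcomp_uminus: "hcomp s (- q) = - hcomp s (q :: 'k::comm_ring_1 pol3)"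
  by (rule poly_mapping_eqI) (simp add: hcomp.rep_eq)

lemma hcomp_diff: "hcomp s (q - r) = hcomp s q - hcomp s (r :: 'k::comm_ring_1 pol3)"
  using hcomp_add[of s q "- r"] by (simp add: hcomp_uminus)

lemma hcomp_numeral: "hcomp s (numeral n * q) = numeral n * hcomp s (q :: 'k::comm_ring_1 pol3)"
  by (induction q rule: pol3_induct) (simp_all add: numeral_mon hcomp_mon hcomp_add distrib_left)

lemma homog_hcomp: "homog s (hcomp s q)"
  by (auto simp: homog_def hcomp.rep_eq split: if_splits)

lemma hcomp_homog: "homog s q \<Longrightarrow> hcomp t q = (if s = t then q else 0)"
  by (rule poly_mapping_eqI) (auto simp: homog_def hcomp.rep_eq)

lemma hcomp_op: "hcomp s (opE q) = opE (hcomp s q)" "hcomp s (opF q) = opF (hcomp s q)"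
  "hcomp s (opH q) = opH (hcomp s q)"
proof -
  have "hcomp s (opE q) = opE (hcomp s q) \<and> hcomp s (opF q) = opF (hcomp s q) \<and> hcomp s (opH q) = opH (hcomp s q)"
  proof (induction q rule: pol3_induct)
    case (mon x y z r)
    have "homog (x + y + z) (mon x y z r)" by (intro homog_mon) simp
    note h = this homog_op[OF this]
    show ?case by (simp add: hcomp_homog[OF h(1)] hcomp_homog[OF h(2)] hcomp_homog[OF h(3)] hcomp_homog[OF h(4)])
  qed (simp add: op_add hcomp_add)
  then show "hcomp s (opE q) = opE (hcomp s q)" "hcomp s (opF q) = opF (hcomp s q)"
    "hcomp s (opH q) = opH (hcomp s q)" by blast+
qed

lemma hcomp_sum_ex: "\<exists>N. \<forall>n\<ge>N. q = (\<Sum>s<n. hcomp s (q :: 'k::comm_ring_1 pol3))"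
proof (induction q rule: pol3_induct)
  case (mon x y z r)
  show ?case
  proof (intro exI allI impI)
    fix n assume "n \<ge> Suc (x + y + z)"
    then show "mon x y z r = (\<Sum>s<n. hcomp s (mon x y z r))"
      by (simp add: hcomp_mon)
  qed
next
  case (add f g)
  from add.IH obtain N M where "\<And>n. n \<ge> N \<Longrightarrow> f = (\<Sum>s<n. hcomp s f)" "\<And>n. n \<ge> M \<Longrightarrow> g = (\<Sum>s<n. hcomp s g)" by blast
  then have "\<And>n. n \<ge> max N M \<Longrightarrow> f + g = (\<Sum>s<n. hcomp s f) + (\<Sum>s<n. hcomp s g)"
    by (metis max.bounded_iff)
  then show ?case unfolding hcomp_add sum.distrib by blast
qed

definition hpart :: "nat \<Rightarrow> (3, 'k::comm_ring_1) E0 \<Rightarrow> (3, 'k) E0" where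
  "hpart s f = ExtPoly (\<lambda>S. hcomp s (coef f S))"

lemma coef_hpart: "coef (hpart s f) S = hcomp s (coef f S)"
  by (simp add: hpart_def ExtPoly_inverse)

lemma hodge_hpart: "hodge s (hpart s f)"
  by (simp add: hodge_def coef_hpart homog_hcomp)

lemma hpart_hodge: "hodge s f \<Longrightarrow> hpart s f = f"
  by (rule ext_poly_eqI) (simp add: hodge_def coef_hpart hcomp_homog[of s _ s])

lemma dd_hpart: "dd (hpart s f) = hpart s (dd f)"
  by (rule ext3_eqI) (simp_all add: coef_dd coef_hpart hcomp_add hcomp_diff hcomp_op hcomp_numeral)

lemma hpart_sum: obtains N where "\<And>n. n \<ge> N \<Longrightarrow> f = (\<Sum>s<n. hpart s f)"
proof -
  have "\<exists>N. \<forall>n\<ge>N. coef f S = (\<Sum>s<n. hcomp s (coef f S))" for S by (rule hcomp_sum_ex)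
  then obtain N where N: "\<And>S n. n \<ge> N S \<Longrightarrow> coef f S = (\<Sum>s<n. hcomp s (coef f S))" by metis
  show ?thesis
  proof
    fix n assume n: "n \<ge> Max (range N)"
    have "N S \<le> Max (range N)" for S by (rule Max_ge) auto
    then have "n \<ge> N S" for S using n order_trans by blast
    then have "coef f S = (\<Sum>s<n. hcomp s (coef f S))" for S by (rule N)
    then show "f = (\<Sum>s<n. hpart s f)"
      by (intro ext_poly_eqI) (simp add: coef_sum coef_hpart)
  qed
qed

definition one_form :: "(3, 'k::comm_ring_1) E0 \<Rightarrow> bool" where
  "one_form f \<longleftrightarrow> (\<forall>S. card S \<noteq> 1 \<longrightarrow> coef f S = 0)"

lemma one_form_mk: "one_form (mk 0 a b c 0 0 0 0)"
  unfolding one_form_def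
proof (intro allI impI)
  fix S :: "3 set" assume "card S \<noteq> 1"
  then show "coef (mk 0 a b c 0 0 0 0) S = 0"
    by (rule_tac subsets_three[of S]; hypsubst; simp)
qed

text \<open>
  The same with a correction that is homogeneous in both degrees, to stay in one bidegree.
\<close>

lemma lift_cocycle_hodge:
  fixes f :: "(3, 'p::prime_card mod_ring) E0"
  assumes "odd CARD('p)" "Suc t < CARD('p)"
    and f: "dd f = emb kap * mk 0 0 0 0 P Q R 0" "hodge t (mk 0 0 0 0 P Q R 0)"
  obtains g where "hodge t g" "one_form g" "dd (f - emb kap * g) = 0"
proof -
  obtain g where "dd (f - emb kap * g) = 0" using lift_cocycle[OF assms] by blast
  then have "emb kap * dd g = emb kap * mk 0 0 0 0 P Q R 0"
    by (simp add: d0_diff dd_emb_kap f(1))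
  then have "dd g = mk 0 0 0 0 P Q R 0" by (simp only: emb_kap_cancel)
  then have g: "dd (hpart t g) = mk 0 0 0 0 P Q R 0"
    using hpart_hodge[OF f(2)] by (simp add: dd_hpart)
  define g' where "g' = mk 0 (coef (hpart t g) {0}) (coef (hpart t g) {1}) (coef (hpart t g) {2}) 0 0 0 0"
  have c: "coef (dd (hpart t g)) S = coef (mk 0 0 0 0 P Q R 0) S" for S by (simp add: g)
  have "dd g' = mk 0 0 0 0 P Q R 0"
    using c[of "{0, 1}"] c[of "{0, 2}"] c[of "{1, 2}"]
    by (intro ext3_eqI) (simp_all add: coef_dd g'_def)
  then have "dd (f - emb kap * g') = 0" by (simp add: d0_diff dd_emb_kap f(1))
  moreover have "hodge t g'"
    using hodge_hpart[of t g] by (intro hodgeI) (simp_all add: g'_def hodge_def)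
  ultimately show ?thesis using that[of g'] by (simp add: g'_def one_form_mk)
qed

section \<open>Generators\<close>

text \<open>
  The names group the 17 generators by bidegree: \<open>GU\<close> is the volume class \<open>u\<close>, \<open>GK\<close> is \<open>\<kappa>\<close>; the
  \<open>GA\<close>, \<open>GB\<close>, \<open>GC\<close> have Hodge degree \<open>p - 1\<close> and exterior degrees 1, 2, 3; the \<open>GD\<close>, \<open>GE\<close>, \<open>GF\<close> have Hodge
  degree \<open>p\<close> and exterior degrees 0, 1, 2. In each group the weights are \<open>0\<close> and, as far as they
  occur, \<open>2 p\<close> and \<open>- 2 p\<close>.
\<close>

datatype gen = GU | GK | GA0 | GA1 | GA2 | GB0 | GB1 | GB2 | GC
  | GD0 | GD1 | GD2 | GE0 | GE1 | GE2 | GE3 | GF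

text \<open>
  Two of the cocycles on the cone are cocycles only modulo \<open>kap\<close>; they are lifted below by means of
  \<open>correction\<close>.
\<close>

definition preA :: "(3, 'p::prime_card mod_ring) E0" where
  "preA = mk 0 (cone_mon (CARD('p) - 1) (- 1) 1) 0 0 0 0 0 0"

definition preE :: "(3, 'p::prime_card mod_ring) E0" where
  "preE = mk 0 (cone_mon CARD('p) (- 1) (- 1)) (cone_mon CARD('p) 0 1) 0 0 0 0 0"

definition correction :: "nat \<Rightarrow> (3, 'p::prime_card mod_ring) E0 \<Rightarrow> (3, 'p mod_ring) E0" where
  "correction s f = (SOME g. hodge s g \<and> one_form g \<and> dd (f - emb kap * g) = 0)"

primrec rep :: "gen \<Rightarrow> (3, 'p::prime_card mod_ring) E0" where
  "rep GU = vol"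
| "rep GK = emb kap"
| "rep GA0 = preA - emb kap * correction (CARD('p) - 3) preA"
| "rep GA1 = mk 0 (cone_mon (CARD('p) - 1) (int CARD('p) - 1) 1) 0 0 0 0 0 0"
| "rep GA2 = mk 0 0 0 (cone_mon (CARD('p) - 1) (1 - int CARD('p)) 1) 0 0 0 0"
| "rep GB0 = mk 0 0 0 0 (cone_mon (CARD('p) - 1) (- 1) (- 1)) 0 (cone_mon (CARD('p) - 1) 1 1) 0"
| "rep GB1 = mk 0 0 0 0 (cone_mon (CARD('p) - 1) (int CARD('p) - 1) 1) 0 0 0"
| "rep GB2 = mk 0 0 0 0 0 0 (cone_mon (CARD('p) - 1) (1 - int CARD('p)) 1) 0"
| "rep GC = mk 0 0 0 0 0 0 0 (cone_mon (CARD('p) - 1) 0 1)"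
| "rep GD0 = mk (cone_mon CARD('p) 0 1) 0 0 0 0 0 0 0"
| "rep GD1 = mk (cone_mon CARD('p) (int CARD('p)) 1) 0 0 0 0 0 0 0"
| "rep GD2 = mk (cone_mon CARD('p) (- int CARD('p)) 1) 0 0 0 0 0 0 0"
| "rep GE0 = mk 0 (cone_mon CARD('p) (- 1) 1) 0 (cone_mon CARD('p) 1 1) 0 0 0 0"
| "rep GE1 = preE - emb kap * correction (CARD('p) - 2) preE"
| "rep GE2 = mk 0 (cone_mon CARD('p) (int CARD('p) - 1) (- 1)) (cone_mon CARD('p) (int CARD('p)) 1) 0 0 0 0 0"
| "rep GE3 = mk 0 0 (cone_mon CARD('p) (- int CARD('p)) 1) (cone_mon CARD('p) (1 - int CARD('p)) 1) 0 0 0 0"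
| "rep GF = mk 0 0 0 0 (cone_mon CARD('p) (- 1) (- 1)) 0 (cone_mon CARD('p) 1 1) 0"

lemma cst_cone_mon: "cst t * cone_mon s w r = cone_mon s w (t * r)"
  by (simp add: cone_mon_def cst_mon mult.left_commute)

context
  assumes odd_p: "odd CARD('p::prime_card)"
begin

text \<open>
  In this form the powers of the monomials involved, as well as their exponents modulo \<open>p\<close>, are
  accessible to simplification.
\<close>

lemma p_decomp: obtains q where "CARD('p) = Suc (Suc (Suc q))" "(of_nat q :: 'p mod_ring) = - 3" "even q"
proof -
  obtain q where q: "CARD('p) = 3 + q"
    using p_ge_3[OF odd_p] le_Suc_ex by blast
  have "(of_nat (3 + q) :: 'p mod_ring) = 0"
    unfolding q[symmetric] by (simp add: of_nat_mod_ring_eq_0[OF odd_p])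
  then have "(of_nat q :: 'p mod_ring) = - 3" by (simp add: add_eq_0_iff2 add.commute)
  moreover have "even q" using odd_p unfolding q by simp
  ultimately show ?thesis using that[of q] q by simp
qed

lemma dd_pre:
  "dd (preA :: (3, 'p mod_ring) E0) = emb kap * mk 0 0 0 0 0 (mon 0 (CARD('p) - 3) 0 2) 0 0"
  "dd (preE :: (3, 'p mod_ring) E0) = emb kap * mk 0 0 0 0 0 (mon 0 (CARD('p) - 2) 0 (- 1)) 0 0"
proof -
  obtain q where q: "CARD('p) = Suc (Suc (Suc q))" "(of_nat q :: 'p mod_ring) = - 3" by (rule p_decomp)
  have c: "cone_mon s (- 1) r = mon 0 (s - 1) 1 (- r)" for s and r :: "'p mod_ring"
    using cone_mon_neg[of s 1 r] by simp
  have c0: "cone_mon s 0 r = mon 0 s 0 r" for s and r :: "'p mod_ring"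
    by (simp add: cone_mon_def)
  show "dd (preA :: (3, 'p mod_ring) E0) = emb kap * mk 0 0 0 0 0 (mon 0 (CARD('p) - 3) 0 2) 0 0"
    by (rule ext3_eqI) (simp_all add: preA_def q c coef_dd coef_emb_mult op_mon numeral_mon
      kap_def distrib_right mult.assoc var_mon flip: single_uminus single_diff single_add)
  show "dd (preE :: (3, 'p mod_ring) E0) = emb kap * mk 0 0 0 0 0 (mon 0 (CARD('p) - 2) 0 (- 1)) 0 0"
    by (rule ext3_eqI) (simp_all add: preE_def q c c0 coef_dd coef_emb_mult op_mon numeral_mon
      kap_def distrib_right mult.assoc var_mon flip: single_uminus single_diff single_add)
qed

lemma correction:
  "hodge (CARD('p) - 3) (correction (CARD('p) - 3) preA :: (3, 'p mod_ring) E0)"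
  "one_form (correction (CARD('p) - 3) preA :: (3, 'p mod_ring) E0)"
  "dd (preA - emb kap * correction (CARD('p) - 3) preA :: (3, 'p mod_ring) E0) = 0"
  "hodge (CARD('p) - 2) (correction (CARD('p) - 2) preE :: (3, 'p mod_ring) E0)"
  "one_form (correction (CARD('p) - 2) preE :: (3, 'p mod_ring) E0)"
  "dd (preE - emb kap * correction (CARD('p) - 2) preE :: (3, 'p mod_ring) E0) = 0"
proof -
  have p: "Suc (CARD('p) - 3) < CARD('p)" "Suc (CARD('p) - 2) < CARD('p)"
    using p_ge_3[OF odd_p] by auto
  have h: "hodge (CARD('p) - 3) (mk 0 0 0 0 0 (mon 0 (CARD('p) - 3) 0 2) 0 0 :: (3, 'p mod_ring) E0)"
    "hodge (CARD('p) - 2) (mk 0 0 0 0 0 (mon 0 (CARD('p) - 2) 0 (- 1)) 0 0 :: (3, 'p mod_ring) E0)"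
    by (auto intro!: hodgeI homog_mon)
  have "\<exists>g. hodge (CARD('p) - 3) g \<and> one_form g \<and> dd (preA - emb kap * g :: (3, 'p mod_ring) E0) = 0"
    using lift_cocycle_hodge[OF odd_p p(1) dd_pre(1) h(1)] by blast
  from someI_ex[OF this]
  show "hodge (CARD('p) - 3) (correction (CARD('p) - 3) preA :: (3, 'p mod_ring) E0)"
    "one_form (correction (CARD('p) - 3) preA :: (3, 'p mod_ring) E0)"
    "dd (preA - emb kap * correction (CARD('p) - 3) preA :: (3, 'p mod_ring) E0) = 0"
    unfolding correction_def by blast+
  have "\<exists>g. hodge (CARD('p) - 2) g \<and> one_form g \<and> dd (preE - emb kap * g :: (3, 'p mod_ring) E0) = 0"
    using lift_cocycle_hodge[OF odd_p p(2) dd_pre(2) h(2)] by blast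
  from someI_ex[OF this]
  show "hodge (CARD('p) - 2) (correction (CARD('p) - 2) preE :: (3, 'p mod_ring) E0)"
    "one_form (correction (CARD('p) - 2) preE :: (3, 'p mod_ring) E0)"
    "dd (preE - emb kap * correction (CARD('p) - 2) preE :: (3, 'p mod_ring) E0) = 0"
    unfolding correction_def by blast+
qed

lemma dd_vol: "dd vol = 0"
  by (rule ext3_eqI) (simp_all add: coef_dd coef_vol set_three_eq_iff)

lemma dd_emb_kap1: "dd (emb kap) = 0"
  by (rule ext3_eqI) (simp_all add: coef_dd coef_emb)

lemma dd_rep: "dd (rep g :: (3, 'p mod_ring) E0) = 0"
proof -
  obtain q where q: "CARD('p) = Suc (Suc (Suc q))" "(of_nat q :: 'p mod_ring) = - 3" by (rule p_decomp)
  have c: "cone_mon s (- 1) r = mon 0 (s - 1) 1 (- r)" for s and r :: "'p mod_ring"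
    using cone_mon_neg[of s 1 r] by simp
  have c1: "cone_mon s 1 r = mon 1 (s - 1) 0 r" "cone_mon s 0 r = mon 0 s 0 r"
    "cone_mon s (int n) r = mon n (s - n) 0 r" for s n and r :: "'p mod_ring"
    by (simp_all add: cone_mon_def)
  have i: "int CARD('p) - 1 = int (Suc (Suc q))" "1 - int CARD('p) = - int (Suc (Suc q))" by (simp_all add: q)
  show ?thesis
  proof (cases g)
    case GA0 then show ?thesis using correction by simp
  next
    case GE1 then show ?thesis using correction by simp
  next
    case GU then show ?thesis by (simp add: dd_vol)
  next
    case GK then show ?thesis by (simp add: dd_emb_kap1)
  qed (simp only: rep.simps i; rule ext3_eqI;
     (simp add: q c c1 cone_mon_neg coef_dd op_mon numeral_mon op_uminus del: of_nat_Suc)?;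
     (simp add: q single_uminus op_mon algebra_simps flip: single_add)?)+
qed

end

section \<open>Hodge degrees \<open>p - 1\<close> and \<open>p\<close>\<close>

definition gens_pred_p :: "gen set" where "gens_pred_p = {GA0, GA1, GA2, GB0, GB1, GB2, GC}"
definition gens_p :: "gen set" where "gens_p = {GD0, GD1, GD2, GE0, GE1, GE2, GE3, GF}"

context
  assumes odd_p: "odd CARD('p::prime_card)"
begin

lemma of_nat_p: "(of_nat CARD('p) :: 'p mod_ring) = 0"
  by simp

lemma dvd_near:
  assumes "int CARD('p) dvd w" "\<bar>w\<bar> < 2 * int CARD('p)"
  shows "w = 0 \<or> w = int CARD('p) \<or> w = - int CARD('p)"
proof -
  obtain k where k: "w = int CARD('p) * k" using assms(1) by (elim dvdE)
  have "int CARD('p) * \<bar>k\<bar> < int CARD('p) * 2" using assms(2) by (simp add: k abs_mult)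
  then have "\<bar>k\<bar> < 2" by (simp add: mult_less_cancel_left)
  then have "k = 0 \<or> k = 1 \<or> k = - 1" by linarith
  then show ?thesis by (auto simp: k)
qed

text \<open>
  Here \<open>s = p - 1\<close>, so that \<open>s + 1\<close> vanishes modulo \<open>p\<close>. Besides the weight 0, the weights \<open>2 p\<close> and \<open>- 2 p\<close>
  occur, at the highest and lowest vectors of the 1-forms and 2-forms. After subtraction of a coboundary
  the restriction to the cone is a combination of those of the new generators and of one more
  cocycle on the cone, \<open>N\<close>, which has to be excluded.
\<close>

lemma cocycle_degree_pred_p:
  fixes z :: "(3, 'p mod_ring) E0"
  assumes z: "hodge (CARD('p) - 1) z" "dd z = 0"
  shows "\<exists>r r1 r2 g. z = (\<Sum>i\<in>gens_pred_p. ext_const (r i) * rep i) +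
    emb (kpow (CARD('p) - 1)) * (ext_const r1 + ext_const r2 * vol) + dd g"
proof -
  define s where "s = CARD('p) - 1"
  have s: "CARD('p) = Suc s" "s \<ge> 2" using p_ge_3[OF odd_p] by (auto simp: s_def)
  have ss: "(of_nat s :: 'p mod_ring) = - 1"
    using of_nat_p unfolding s by (simp add: add_eq_0_iff add.commute)
  note z = z[folded s_def]
  obtain g1 where g1: "hodge s g1" "\<And>w. of_int (2 * w) \<noteq> (0 :: 'p mod_ring) \<Longrightarrow> vanishes s (z - dd g1) w"
    using weight_reduction[OF z] by metis
  define z1 where "z1 = z - dd g1"
  have z1: "hodge s z1" "dd z1 = 0"
    unfolding z1_def using z g1 by (simp_all add: hodge_diff hodge_dd d0_diff dd_dd)
  \<comment> \<open>removes what is exact on the cone in weight 0\<close>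
  define g2 where "g2 = mk (cone_mon s 0 (symb s 1 (coef z1 {2}))) 0 (cone_mon s 0 (symb s 0 (coef z1 {0, 2}))) 0 0 0 0 0"
  have g2: "hodge s g2"
    by (intro hodgeI) (simp_all add: g2_def homog_cone_mon)
  define f where "f = z1 - dd g2"
  have f: "hodge s f" "dd f = 0"
    unfolding f_def using z1 g2 by (simp_all add: hodge_diff hodge_dd d0_diff dd_dd)
  have fz: "z = f + dd (g1 + g2)" by (simp add: f_def z1_def d0_add)
  have f1: "vanishes s f w" if "\<not> int CARD('p) dvd w" for w
  proof -
    have "w \<noteq> 0" using that by auto
    then have "vanishes s g2 w" by (simp add: vanishes_def g2_def symb_cone_mon)
    moreover have "vanishes s z1 w" using g1(2)[OF of_int_2_neq_0[OF odd_p that]] by (simp add: z1_def)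
    ultimately show ?thesis unfolding f_def by (intro vanishes_diff vanishes_dd)
  qed
  have f0: "symb s 0 (coef f {}) = 0" "symb s 0 (coef f {1}) = 0" "symb s 1 (coef f {2}) = 0" "symb s 0 (coef f {0, 2}) = 0"
  proof -
    show "symb s 0 (coef f {}) = 0" "symb s 0 (coef f {1}) = 0"
      using cocycle_symb(1,3)[OF f(2), of s 0] by (simp_all add: ss)
    have G: "symb s 0 (coef g2 {}) = symb s 1 (coef z1 {2})" "symb s 0 (coef g2 {1}) = symb s 0 (coef z1 {0, 2})"
       "symb s (- 1) (coef g2 {0}) = 0" "symb s 1 (coef g2 {2}) = 0"
      by (simp_all add: g2_def symb_cone_mon)
    show "symb s 1 (coef f {2}) = 0" "symb s 0 (coef f {0, 2}) = 0"
      using symb_dd(4,6)[of s 0 g2] by (simp_all add: f_def symb_diff G ss)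
  qed
  define r where "r = (\<lambda>i. if i = GA0 then symb s (- 1) (coef f {0}) else if i = GA1 then symb s (int s) (coef f {0})
    else if i = GA2 then symb s (- int s) (coef f {2}) else if i = GB0 then symb s 1 (coef f {1, 2})
    else if i = GB1 then symb s (int s) (coef f {0, 1}) else if i = GB2 then symb s (- int s) (coef f {1, 2})
    else symb s 0 (coef f {0, 1, 2}))"
  define e where "e = symb s (- 1) (coef f {0, 1}) + r GB0"
  define M where "M = mk 0 (cone_mon s (- 1) (r GA0) + cone_mon s (int s) (r GA1)) 0 (cone_mon s (- int s) (r GA2))
    (cone_mon s (- 1) (e - r GB0) + cone_mon s (int s) (r GB1)) 0
    (cone_mon s 1 (r GB0) + cone_mon s (- int s) (r GB2)) (cone_mon s 0 (r GC))"
  \<comment> \<open>a cocycle on the cone that does not lift\<close>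
  define N where "N = (mk 0 0 0 0 (cone_mon s (- 1) 1) 0 0 0 :: (3, 'p mod_ring) E0)"
  have "vanishes s (f - M) w" for w
  proof -
    consider "\<not> int CARD('p) dvd w" | "w = 0" | "w = int CARD('p)" | "w = - int CARD('p)" | "\<bar>w\<bar> \<ge> 2 * int CARD('p)"
      using dvd_near[of w] by linarith
    then show ?thesis
    proof cases
      case 1
      then have "w \<noteq> 0" "w \<noteq> int CARD('p)" "w \<noteq> - int CARD('p)" by auto
      then have "vanishes s M w"
        using s by (auto simp: vanishes_def M_def symb_add symb_cone_mon)
      then show ?thesis using f1[OF 1] by (intro vanishes_diff)
    next
      case 2
      then show ?thesis using f0 s
        by (simp add: vanishes_def symb_diff M_def symb_add symb_cone_mon) (simp add: r_def e_def)
    next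
      case 3
      then show ?thesis using s
        by (simp add: vanishes_def symb_diff M_def symb_add symb_cone_mon symb_out) (simp add: r_def)
    next
      case 4
      then show ?thesis using s
        by (simp add: vanishes_def symb_diff M_def symb_add symb_cone_mon symb_out) (simp add: r_def)
    next
      case 5
      then show ?thesis using s by (intro vanishes_out) linarith
    qed
  qed
  moreover have "hodge s M"
    using s by (intro hodgeI) (auto simp: M_def homog_cone_mon intro!: homog_add)
  then have "hodge s (f - M)" using f by (simp add: hodge_diff)
  ultimately obtain y where y: "f - M = emb kap * y" "y = 0 \<or> (\<exists>t. s = Suc (Suc t) \<and> hodge t y)"
    using vanishes_imp_kap by blast
  obtain t where t: "s = Suc (Suc t)" using s(2) by (metis add_2_eq_Suc le_Suc_ex)
  have "hodge t y" using y(2) t by auto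
  define y' where "y' = y + ext_const (r GA0) * correction (CARD('p) - 3) preA"
  have y': "hodge t y'"
    unfolding y'_def using \<open>hodge t y\<close> correction(1)[OF odd_p] s t by (intro hodge_add hodge_const_mult) simp_all
  have sP: "int CARD('p) - 1 = int s" "1 - int CARD('p) = - int s" "CARD('p) - 1 = s" "CARD('p) - Suc 0 = s" using s by simp_all
  have sum: "(\<Sum>i\<in>gens_pred_p. ext_const (r i) * rep i) = M - ext_const e * N - emb kap * (ext_const (r GA0) * correction (CARD('p) - 3) preA)"
  proof -
    define c where "c = (correction (CARD('p) - 3) preA :: (3, 'p mod_ring) E0)"
    have S: "(\<Sum>i\<in>gens_pred_p. F i) = F GA0 + F GA1 + F GA2 + F GB0 + F GB1 + F GB2 + F GC" for F :: "gen \<Rightarrow> (3, 'p mod_ring) E0"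
      by (simp add: gens_pred_p_def add_ac)
    have cs: "cone_mon s w (t - t') = cone_mon s w t - cone_mon s w t'" for w and t t' :: "'p mod_ring"
      using cone_mon_add[of s w "t - t'" t'] by simp
    have cu: "cone_mon s w (- t) = - cone_mon s w t" for w and t :: "'p mod_ring"
      using cs[of w 0 t] by simp
    show ?thesis
      unfolding S rep.simps c_def[symmetric] unfolding preA_def sP M_def N_def
      by (rule ext3_eqI) (simp_all add: coef_const_mult3 coef_emb_mult right_diff_distrib mult_ac
        cst_cone_mon cs cu)
  qed
  have fy: "f = (\<Sum>i\<in>gens_pred_p. ext_const (r i) * rep i) + ext_const e * N + emb kap * y'"
    unfolding sum y'_def using y(1) by (simp add: distrib_left algebra_simps)
  \<comment> \<open>the obstruction to lifting \<open>N\<close>, a class detected by \<open>vb_power_not_exact\<close>\<close>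
  have N: "dd N = emb kap * mk 0 0 0 0 0 0 0 (cst (- 2) * vb ^ t)"
  proof -
    have c: "cone_mon s (- 1) 1 = mon 0 (Suc t) 1 (- 1 :: 'p mod_ring)"
      using cone_mon_neg[of s 1 1] t by simp
    have "(of_nat (Suc (Suc t)) :: 'p mod_ring) = - 1" using ss t by simp
    then have tt: "(of_nat t :: 'p mod_ring) = - 3" by (simp add: algebra_simps eq_neg_iff_add_eq_0)
    show ?thesis
      by (rule ext3_eqI) (simp_all add: N_def c coef_dd coef_emb_mult op_mon numeral_mon var_power cst_mon tt
        kap_def distrib_right mult.assoc var_mon flip: single_uminus single_diff single_add)
  qed
  have "dd ((\<Sum>i\<in>gens_pred_p. ext_const (r i) * rep i)) = 0"
    by (simp add: d0_sum d0_const_mult dd_rep[OF odd_p])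
  then have "ext_const e * dd N + emb kap * dd y' = 0"
    using f(2) unfolding fy by (simp add: d0_add d0_const_mult dd_emb_kap)
  then have "emb kap * (dd y' + ext_const e * mk 0 0 0 0 0 0 0 (cst (- 2) * vb ^ t)) = emb kap * 0"
    unfolding N by (simp add: distrib_left mult.assoc[symmetric] emb_commute[of kap "ext_const e"] add.commute)
  then have dy: "dd y' + ext_const e * mk 0 0 0 0 0 0 0 (cst (- 2) * vb ^ t) = 0"
    by (simp only: emb_kap_cancel)
  have "coef (dd y') {0, 1, 2} = cst (2 * e) * vb ^ t"
    using arg_cong[OF dy, of "\<lambda>f. coef f {0, 1, 2}"]
    by (simp add: coef_const_mult3 cst_ring add_eq_0_iff2 mult_ac)
  moreover have "even t" using odd_p s t by simp
  ultimately have "2 * e = 0"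
    using vb_power_not_exact[OF odd_p, of "t div 2" y' "2 * e"] s t by simp
  \<comment> \<open>hence \<open>N\<close> does not occur, and \<open>y'\<close> is a cocycle of Hodge degree \<open>p - 3\<close>\<close>
  then have e0: "e = 0" using two_neq_0[OF odd_p] by simp
  then have "dd y' = 0" using dy by (simp add: ext_const_0)
  then obtain r1 r2 g3 where "y' = emb (kpow t) * (ext_const r1 + ext_const r2 * vol) + dd g3"
    using cocycle_low_degree[OF odd_p _ y'] s t by auto
  then have "emb kap * y' = emb (kpow s) * (ext_const r1 + ext_const r2 * vol) + dd (emb kap * g3)"
    unfolding t kap_kpow[symmetric] emb_ring dd_emb_kap by (simp add: distrib_left mult.assoc)
  then have "z = (\<Sum>i\<in>gens_pred_p. ext_const (r i) * rep i) + emb (kpow s) * (ext_const r1 + ext_const r2 * vol) +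
    dd (emb kap * g3 + g1 + g2)"
    unfolding fz fy by (simp add: e0 ext_const_0 d0_add add_ac)
  then show ?thesis unfolding sP by blast
qed

text \<open>
  Here \<open>s\<close> itself vanishes modulo \<open>p\<close>, and all cocycles on the cone lift. Nothing comes from lower
  Hodge degrees, since \<open>p - 2\<close> is odd and \<open>kap\<close> has degree 2.
\<close>

lemma cocycle_degree_p:
  fixes z :: "(3, 'p mod_ring) E0"
  assumes z: "hodge CARD('p) z" "dd z = 0"
  shows "\<exists>r g. z = (\<Sum>i\<in>gens_p. ext_const (r i) * rep i) + dd g"
proof -
  define s where "s = CARD('p)"
  have s: "CARD('p) = s" "s \<ge> 3" using p_ge_3[OF odd_p] by (auto simp: s_def)
  have ss: "(of_nat s :: 'p mod_ring) = 0"
    using of_nat_p unfolding s .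
  note z = z[folded s_def]
  obtain g1 where g1: "hodge s g1" "\<And>w. of_int (2 * w) \<noteq> (0 :: 'p mod_ring) \<Longrightarrow> vanishes s (z - dd g1) w"
    using weight_reduction[OF z] by metis
  define z1 where "z1 = z - dd g1"
  have z1: "hodge s z1" "dd z1 = 0"
    unfolding z1_def using z g1 by (simp_all add: hodge_diff hodge_dd d0_diff dd_dd)
  let ?q = "\<lambda>w. symb s w (coef z1 {0, 2})" and ?t = "\<lambda>w. symb s w (coef z1 {0, 1, 2})"
  \<comment> \<open>removes the coefficients of \<open>x\<^sub>0 x\<^sub>2\<close> and \<open>x\<^sub>0 x\<^sub>1 x\<^sub>2\<close> on the cone\<close>
  define g2 where "g2 = mk 0 0 (cone_mon s 0 (?q 0) + cone_mon s (int s) (?q (int s)) + cone_mon s (- int s) (?q (- int s))) 0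
    (cone_mon s (- 1) (- ?t 0) + cone_mon s (int s - 1) (- ?t (int s))) 0
    (cone_mon s (1 - int s) (- ?t (- int s))) 0"
  have g2: "hodge s g2"
    using s by (intro hodgeI) (auto simp: g2_def intro!: homog_add homog_cone_mon)
  define f where "f = z1 - dd g2"
  have f: "hodge s f" "dd f = 0"
    unfolding f_def using z1 g2 by (simp_all add: hodge_diff hodge_dd d0_diff dd_dd)
  have fz: "z = f + dd (g1 + g2)" by (simp add: f_def z1_def d0_add)
  have f1: "vanishes s f w" if "\<not> int CARD('p) dvd w" for w
  proof -
    have "w \<noteq> 0" "w \<noteq> int s" "w \<noteq> - int s" using that s by auto
    then have "vanishes s g2 w" using s by (auto simp: vanishes_def g2_def symb_add symb_cone_mon)
    moreover have "vanishes s z1 w" using g1(2)[OF of_int_2_neq_0[OF odd_p that]] by (simp add: z1_def)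
    ultimately show ?thesis unfolding f_def by (intro vanishes_diff vanishes_dd)
  qed
  note out = symb_out[of s]
  have f0: "symb s 0 (coef f {0, 2}) = 0" "symb s 0 (coef f {0, 1, 2}) = 0"
    "symb s (int s) (coef f {0, 2}) = 0" "symb s (int s) (coef f {0, 1, 2}) = 0"
    "symb s (- int s) (coef f {0, 2}) = 0" "symb s (- int s) (coef f {0, 1, 2}) = 0"
    using s symb_dd(6,8)[of s 0 g2] symb_dd(6,8)[of s "int s" g2] symb_dd(6,8)[of s "- int s" g2]
    by (simp_all add: f_def symb_diff ss out)
      (simp_all add: g2_def symb_add symb_cone_mon)
  have c0: "symb s (- 1) (coef f {0}) = symb s 1 (coef f {2}) - symb s 0 (coef f {1})"
    "symb s (- 1) (coef f {0, 1}) = - symb s 1 (coef f {1, 2})"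
    using cocycle_symb(4,6)[OF f(2), of s 0]
    by (simp_all add: ss algebra_simps eq_neg_iff_add_eq_0)
  have cs: "symb s (int s - 1) (coef f {0}) = - symb s (int s) (coef f {1})"
    "symb s (int s - 1) (coef f {0, 1}) = 0"
    "symb s (1 - int s) (coef f {2}) = symb s (- int s) (coef f {1})"
    "symb s (1 - int s) (coef f {1, 2}) = 0"
    using cocycle_symb(4,6)[OF f(2), of s "int s"] cocycle_symb(4,6)[OF f(2), of s "- int s"]
    by (simp_all add: ss out eq_neg_iff_add_eq_0)
  define r where "r = (\<lambda>i. if i = GD0 then symb s 0 (coef f {}) else if i = GD1 then symb s (int s) (coef f {})
    else if i = GD2 then symb s (- int s) (coef f {}) else if i = GE0 then symb s 1 (coef f {2})
    else if i = GE1 then symb s 0 (coef f {1}) else if i = GE2 then symb s (int s) (coef f {1})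
    else if i = GE3 then symb s (- int s) (coef f {1})
    else symb s 1 (coef f {1, 2}))"
  define M where "M = mk (cone_mon s 0 (r GD0) + cone_mon s (int s) (r GD1) + cone_mon s (- int s) (r GD2))
    (cone_mon s (- 1) (r GE0 - r GE1) + cone_mon s (int s - 1) (- r GE2))
    (cone_mon s 0 (r GE1) + cone_mon s (int s) (r GE2) + cone_mon s (- int s) (r GE3))
    (cone_mon s 1 (r GE0) + cone_mon s (1 - int s) (r GE3))
    (cone_mon s (- 1) (- r GF)) 0 (cone_mon s 1 (r GF)) 0"
  have "vanishes s (f - M) w" for w
  proof -
    consider "\<not> int CARD('p) dvd w" | "w = 0" | "w = int s" | "w = - int s" | "\<bar>w\<bar> \<ge> 2 * int s"
      using dvd_near[of w] s by linarith
    then show ?thesis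
    proof cases
      case 1
      then have "w \<noteq> 0" "w \<noteq> int s" "w \<noteq> - int s" using s by auto
      then have "vanishes s M w"
        using s by (auto simp: vanishes_def M_def symb_add symb_cone_mon)
      then show ?thesis using f1[OF 1] by (intro vanishes_diff)
    next
      case 2
      then show ?thesis using f0 s c0
        by (simp add: vanishes_def symb_diff M_def symb_add symb_cone_mon) (simp add: r_def)
    next
      case 3
      then show ?thesis using s f0 cs
        by (simp add: vanishes_def symb_diff M_def symb_add symb_cone_mon symb_out) (simp add: r_def)
    next
      case 4
      then show ?thesis using s f0 cs
        by (simp add: vanishes_def symb_diff M_def symb_add symb_cone_mon symb_out) (simp add: r_def)
    next
      case 5
      then show ?thesis using s by (intro vanishes_out) linarith
    qed
  qed
  moreover have "hodge s M"
    using s by (intro hodgeI) (auto simp: M_def homog_cone_mon intro!: homog_add)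
  then have "hodge s (f - M)" using f by (simp add: hodge_diff)
  ultimately obtain y where y: "f - M = emb kap * y" "y = 0 \<or> (\<exists>t. s = Suc (Suc t) \<and> hodge t y)"
    using vanishes_imp_kap by blast
  obtain t where t: "s = Suc (Suc t)" using s(2) by (intro that[of "s - 2"]) arith
  have "hodge t y" using y(2) t by auto
  define y' where "y' = y + ext_const (r GE1) * correction (CARD('p) - 2) preE"
  have y': "hodge t y'"
    unfolding y'_def using \<open>hodge t y\<close> correction(4)[OF odd_p] s t by (intro hodge_add hodge_const_mult) simp_all
  have sum: "(\<Sum>i\<in>gens_p. ext_const (r i) * rep i) = M - emb kap * (ext_const (r GE1) * correction (CARD('p) - 2) preE)"
  proof -
    define c where "c = (correction (CARD('p) - 2) preE :: (3, 'p mod_ring) E0)"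
    have S: "(\<Sum>i\<in>gens_p. F i) = F GD0 + F GD1 + F GD2 + F GE0 + F GE1 + F GE2 + F GE3 + F GF" for F :: "gen \<Rightarrow> (3, 'p mod_ring) E0"
      by (simp add: gens_p_def add_ac)
    have cs: "cone_mon s w (t - t') = cone_mon s w t - cone_mon s w t'" for w and t t' :: "'p mod_ring"
      using cone_mon_add[of s w "t - t'" t'] by simp
    have cu: "cone_mon s w (- t) = - cone_mon s w t" for w and t :: "'p mod_ring"
      using cs[of w 0 t] by simp
    show ?thesis
      unfolding S rep.simps c_def[symmetric] unfolding preE_def s(1) M_def
      by (rule ext3_eqI) (simp_all add: coef_const_mult3 coef_emb_mult right_diff_distrib mult_ac
        cst_cone_mon cs cu)
  qed
  have fy: "f = (\<Sum>i\<in>gens_p. ext_const (r i) * rep i) + emb kap * y'"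
    unfolding sum y'_def using y(1) by (simp add: distrib_left algebra_simps)
  have "dd ((\<Sum>i\<in>gens_p. ext_const (r i) * rep i)) = 0"
    by (simp add: d0_sum d0_const_mult dd_rep[OF odd_p])
  then have "emb kap * dd y' = emb kap * 0"
    using f(2) unfolding fy by (simp add: d0_add dd_emb_kap)
  then have "dd y' = 0" by (simp only: emb_kap_cancel)
  then obtain r1 r2 g3 where "y' = emb (kpow t) * (ext_const r1 + ext_const r2 * vol) + dd g3"
    using cocycle_low_degree[OF odd_p _ y'] s t by auto
  moreover have "odd t" using odd_p s t by simp
  ultimately have "y' = dd g3" by (simp add: kpow_odd emb_ring)
  then have "z = (\<Sum>i\<in>gens_p. ext_const (r i) * rep i) + dd (emb kap * g3 + g1 + g2)"
    unfolding fz fy by (simp add: dd_emb_kap d0_add add_ac)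
  then show ?thesis by blast
qed

end

section \<open>Indecomposables\<close>

lemma symb_hcomp: "symb s w (hcomp s q) = symb s w q"
  by (induction q rule: pol3_induct) (auto simp: hcomp_mon symb_mon hcomp_add symb_add)

lemma symb_homog_neq: "homog t q \<Longrightarrow> s \<noteq> t \<Longrightarrow> symb s w q = 0"
  using symb_hcomp[of s w q] by (simp add: hcomp_homog)

lemma lookup_hcomp: "Poly_Mapping.lookup (hcomp (x + y + z) q) (expo x y z) = Poly_Mapping.lookup q (expo x y z)"
  by (simp add: hcomp.rep_eq)

lemma hcomp_mult_high:
  fixes q r :: "'k::comm_ring_1 pol3"
  assumes "\<And>s. s < n \<Longrightarrow> hcomp s q = 0" "\<And>s. s < m \<Longrightarrow> hcomp s r = 0" "u < n + m"
  shows "hcomp u (q * r) = 0"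
proof -
  obtain N1 N2 where "\<And>k. k \<ge> N1 \<Longrightarrow> q = (\<Sum>s<k. hcomp s q)" "\<And>k. k \<ge> N2 \<Longrightarrow> r = (\<Sum>s<k. hcomp s r)"
    using hcomp_sum_ex[of q] hcomp_sum_ex[of r] by blast
  then have "q * r = (\<Sum>s<N1. hcomp s q) * (\<Sum>s<N2. hcomp s r)" by (metis order_refl)
  then have "q * r = (\<Sum>s<N1. \<Sum>t<N2. hcomp s q * hcomp t r)"
    by (simp add: sum_product)
  moreover have hs: "hcomp u (sum g A) = (\<Sum>i\<in>A. hcomp u (g i))" for g :: "nat \<Rightarrow> 'k pol3" and A
    by (induction A rule: infinite_finite_induct) (simp_all add: hcomp_add)
  moreover have "hcomp u (hcomp s q * hcomp t r) = 0" for s t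
  proof (cases "s < n \<or> t < m")
    case True
    then show ?thesis using assms by auto
  next
    case False
    then have "s + t \<noteq> u" using assms(3) by auto
    then show ?thesis using hcomp_homog[OF homog_mult[OF homog_hcomp homog_hcomp], of u s q t r] by simp
  qed
  ultimately show ?thesis by simp
qed

lemma lookup_mult_0: "Poly_Mapping.lookup (q * r) 0 = Poly_Mapping.lookup q 0 * Poly_Mapping.lookup (r :: 'k::comm_ring_1 pol3) 0"
proof (induction q rule: pol3_induct)
  case (mon x y z a)
  show ?case
  proof (induction r rule: pol3_induct)
    case (mon x' y' z' b)
    have e: "0 = expo 0 0 0" by (simp add: expo_0)
    show ?case unfolding e by (auto simp: mon_mult lookup_single when_def)
  qed (simp add: distrib_left lookup_add)
qed (simp add: distrib_right lookup_add)

lemma lookup_kap_mult: "Poly_Mapping.lookup (kap * q) (expo 0 2 0) = Poly_Mapping.lookup (q :: 'k::comm_ring_1 pol3) 0"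
proof (induction q rule: pol3_induct)
  case (mon x y z r)
  have e: "0 = expo 0 0 0" by (simp add: expo_0)
  show ?case unfolding e
    by (simp add: kap_def distrib_right mult.assoc var_mon lookup_add lookup_single when_def)
qed (simp add: distrib_left lookup_add)

text \<open>
  The augmentation of cocycles, with respect to which \<open>phi\<close> will be a derivation.
\<close>

definition eps :: "(3, 'k::comm_ring_1) E0 \<Rightarrow> 'k" where
  "eps z = Poly_Mapping.lookup (coef z {}) 0"

lemma eps_mult: "eps (z * w) = eps z * eps w"
  by (simp add: eps_def coef_mult3 lookup_mult_0)

lemma eps_add: "eps (z + w) = eps z + eps w"
  by (simp add: eps_def lookup_add)

lemma eps_const: "eps (ext_const r) = r"
  by (simp add: eps_def cst_def expo_0)

lemma eps_dd: "eps (dd f) = 0"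
  by (simp add: eps_def coef_dd)

lemma eps_vol: "eps vol = 0"
  by (simp add: eps_def coef_vol)

lemma eps_emb_kap: "eps (emb kap * y) = 0"
proof -
  have "Poly_Mapping.lookup kap 0 = (0 :: 'a)"
  proof -
    have e: "0 = expo 0 0 0" by (simp add: expo_0)
    show ?thesis unfolding e by (simp add: kap_def va_def vb_def vc_def mon_mult lookup_add lookup_single when_def)
  qed
  then show ?thesis by (simp add: eps_def coef_emb_mult lookup_mult_0)
qed

lemma coef_parity3:
  "coef (ext_parity f) {} = coef f {}" "coef (ext_parity f) {i} = - coef f {i}"
  "coef (ext_parity f) {0, 1::3} = coef f {0, 1}" "coef (ext_parity f) {0, 2::3} = coef f {0, 2}"
  "coef (ext_parity f) {1, 2::3} = coef f {1, 2}" "coef (ext_parity f) {0, 1, 2::3} = - coef f {0, 1, 2}"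
  by (simp_all add: ext_parity.rep_eq)

lemma dd_parity: "dd (ext_parity f) = - ext_parity (dd f)"
  by (rule ext3_eqI) (simp_all add: coef_dd coef_parity3 op_uminus algebra_simps)

lemma mult_exact: "dd w = 0 \<Longrightarrow> dd f * w = dd (f * w)"
  by (simp add: d0_mult)

lemma exact_mult:
  assumes "dd w = 0" shows "w * dd f = dd (ext_parity w * f)"
proof -
  have "ext_parity (0 :: (3, 'a) E0) = 0"
    by (rule ext_poly_eqI) (simp add: ext_parity.rep_eq)
  then show ?thesis using assms by (simp add: d0_mult dd_parity)
qed

text \<open>
  The coefficients of the generators. They are components of the restriction to the cone, except for
  \<open>GK\<close>, as \<open>kap\<close> is 0 there. In the cases \<open>GA0\<close> and \<open>GB0\<close> a single component would not vanish on
  coboundaries.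
\<close>

primrec phi :: "gen \<Rightarrow> (3, 'p::prime_card mod_ring) E0 \<Rightarrow> 'p mod_ring" where
  "phi GU z = symb 0 0 (coef z {0, 1, 2})"
| "phi GK z = Poly_Mapping.lookup (coef z {}) (expo 0 2 0)"
| "phi GA0 z = symb (CARD('p) - 1) (- 1) (coef z {0}) - symb (CARD('p) - 1) 1 (coef z {2})"
| "phi GA1 z = symb (CARD('p) - 1) (int CARD('p) - 1) (coef z {0})"
| "phi GA2 z = symb (CARD('p) - 1) (1 - int CARD('p)) (coef z {2})"
| "phi GB0 z = symb (CARD('p) - 1) 1 (coef z {1, 2}) + symb (CARD('p) - 1) 0 (coef z {0, 2})"
| "phi GB1 z = symb (CARD('p) - 1) (int CARD('p) - 1) (coef z {0, 1})"
| "phi GB2 z = symb (CARD('p) - 1) (1 - int CARD('p)) (coef z {1, 2})"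
| "phi GC z = symb (CARD('p) - 1) 0 (coef z {0, 1, 2})"
| "phi GD0 z = symb CARD('p) 0 (coef z {})"
| "phi GD1 z = symb CARD('p) (int CARD('p)) (coef z {})"
| "phi GD2 z = symb CARD('p) (- int CARD('p)) (coef z {})"
| "phi GE0 z = symb CARD('p) 1 (coef z {2})"
| "phi GE1 z = symb CARD('p) 0 (coef z {1})"
| "phi GE2 z = symb CARD('p) (int CARD('p)) (coef z {1})"
| "phi GE3 z = symb CARD('p) (- int CARD('p)) (coef z {1})"
| "phi GF z = symb CARD('p) 1 (coef z {1, 2})"

lemma phi_add: "phi g (z + w) = phi g z + phi g w"
  by (cases g) (simp_all add: symb_add lookup_add)

lemma phi_const_mult: "phi g (ext_const r * z) = r * phi g z"
proof -
  have "Poly_Mapping.lookup (cst r * q) m = r * Poly_Mapping.lookup q m" for q and m :: "3 \<Rightarrow>\<^sub>0 nat"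
    by (simp add: cst_def expo_0 lookup_single_mult)
  then show ?thesis
    by (cases g) (simp_all add: coef_const_mult3 symb_cst right_diff_distrib distrib_left)
qed

definition high_hodge :: "(3, 'p::prime_card mod_ring) E0 \<Rightarrow> bool" where
  "high_hodge h \<longleftrightarrow> (\<forall>s<CARD('p) - 1. \<forall>S. hcomp s (coef h S) = 0)"

context
  assumes odd_p: "odd CARD('p::prime_card)"
begin

lemma phi_dd: "phi g (dd f :: (3, 'p mod_ring) E0) = 0"
proof -
  obtain q where q: "CARD('p) = Suc (Suc (Suc q))" "(of_nat q :: 'p mod_ring) = - 3"
    using p_decomp[OF odd_p] by metis
  have P: "(of_nat CARD('p) :: 'p mod_ring) = 0" by simp
  define s where "s = CARD('p) - 1"
  have s: "CARD('p) - 1 = s" "CARD('p) - Suc 0 = s" "int CARD('p) = int s + 1" "(of_nat s :: 'p mod_ring) = - 1"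
    using q by (simp_all add: s_def)
  show ?thesis
  proof (cases g)
    case GU
    then show ?thesis by (simp add: symb_dd symb_out)
  next
    case GA0
    then show ?thesis using symb_dd(2,4)[of s 0 f] by (simp add: s)
  next
    case GA1
    then show ?thesis using symb_dd(2)[of s "int s + 1" f] by (simp add: s symb_out)
  next
    case GA2
    then show ?thesis using symb_dd(4)[of s "- int s - 1" f] by (simp add: s symb_out)
  next
    case GB0
    then show ?thesis using symb_dd(6,7)[of s 0 f] by (simp add: s)
  next
    case GB1
    then show ?thesis using symb_dd(5)[of s "int s + 1" f] by (simp add: s symb_out)
  next
    case GB2
    then show ?thesis using symb_dd(7)[of s "- int s - 1" f] by (simp add: s symb_out)
  next
    case GC
    then show ?thesis using symb_dd(8)[of s 0 f] by (simp add: s)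
  next
    case GE0
    then show ?thesis using symb_dd(4)[of "CARD('p)" 0 f] by simp
  next
    case GF
    then show ?thesis using symb_dd(7)[of "CARD('p)" 0 f] by simp
  qed (simp_all add: coef_dd symb_op)
qed

lemma phi_kap: "phi g (emb kap * f :: (3, 'p mod_ring) E0) = (if g = GK then eps f else 0)"
  by (cases g) (simp_all add: coef_emb_mult symb_kap lookup_kap_mult eps_def)

text \<open>
  The corrections of the two lifted generators are invisible to the functionals by \<open>phi_kap\<close>.
\<close>

lemma phi_rep: "phi g (rep h :: (3, 'p mod_ring) E0) = (if g = h then 1 else 0)"
proof -
  define s where "s = CARD('p) - 1"
  have s: "CARD('p) - 1 = s" "CARD('p) - Suc 0 = s" "CARD('p) = Suc s" "s \<ge> 2"
    using p_ge_3[OF odd_p] by (simp_all add: s_def)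
  have ne: "symb t w (cone_mon u w' r) = 0" if "t \<noteq> u" "\<bar>w'\<bar> \<le> int u" for t u w w' and r :: "'p mod_ring"
    using that by (intro symb_homog_neq[OF homog_cone_mon]) auto
  have l: "Poly_Mapping.lookup (cone_mon u w' r) (expo 0 2 0) = 0" if "2 < u" "\<bar>w'\<bar> \<le> int u" for u w' and r :: "'p mod_ring"
    using homog_cone_mon[OF that(2), of r] that(1) by (auto simp: homog_def)
  have v: "symb u w (1 :: 'p mod_ring pol3) = (if u = 0 \<and> w = 0 then 1 else 0)" for u w
    using symb_mon[of u w 0 0 0 "1 :: 'p mod_ring"] by (simp add: expo_0)
  have k: "symb u w (kap :: 'p mod_ring pol3) = 0" for u w
    using symb_kap[of u w 1] by simp
  have k2: "Poly_Mapping.lookup (kap :: 'p mod_ring pol3) (expo 0 2 0) = 1"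
    using lookup_kap_mult[of "1 :: 'p mod_ring pol3"] by simp
  show ?thesis
  proof (cases h)
    case GA0
    have "eps (correction (CARD('p) - 3) preA :: (3, 'p mod_ring) E0) = 0"
      using correction(2)[OF odd_p] by (simp add: eps_def one_form_def)
    then have "phi g (rep h :: (3, 'p mod_ring) E0) = phi g (preA :: (3, 'p mod_ring) E0)"
      using phi_add[of g "rep GA0" "emb kap * correction (CARD('p) - 3) preA :: (3, 'p mod_ring) E0"]
      by (simp add: GA0 phi_kap)
    then show ?thesis using s unfolding GA0
      by (cases g) (simp_all add: preA_def symb_cone_mon ne)
  next
    case GE1
    have "eps (correction (CARD('p) - 2) preE :: (3, 'p mod_ring) E0) = 0"
      using correction(5)[OF odd_p] by (simp add: eps_def one_form_def)
    then have "phi g (rep h :: (3, 'p mod_ring) E0) = phi g (preE :: (3, 'p mod_ring) E0)"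
      using phi_add[of g "rep GE1" "emb kap * correction (CARD('p) - 2) preE :: (3, 'p mod_ring) E0"]
      by (simp add: GE1 phi_kap)
    then show ?thesis using s unfolding GE1
      by (cases g) (simp_all add: preE_def symb_cone_mon ne)
  next
    case GU
    then show ?thesis using s by (cases g) (simp_all add: coef_vol v set_three_eq_iff)
  next
    case GK
    then show ?thesis using s by (cases g) (simp_all add: coef_emb k k2)
  qed (cases g; use s in \<open>simp add: symb_cone_mon ne l\<close>)+
qed

lemma phi_const: "phi g (ext_const r :: (3, 'p mod_ring) E0) = 0"
proof -
  have "symb s w (cst r) = 0" if "s \<noteq> 0" for s w and r :: "'p mod_ring"
    using that by (intro symb_homog_neq[of 0]) simp_all
  moreover have "Poly_Mapping.lookup (cst r) (expo 0 2 0) = 0"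
    by (simp add: cst_def lookup_single when_def)
  ultimately show ?thesis using p_ge_3[OF odd_p] by (cases g) simp_all
qed

text \<open>
  Below Hodge degree \<open>p - 1\<close> a cocycle is known up to coboundaries; there it is split into its part of
  Hodge degree 0 and a multiple of \<open>kap\<close>.
\<close>

lemma cocycle_decomposition:
  fixes z :: "(3, 'p mod_ring) E0"
  assumes "dd z = 0"
  obtains r a y h f where "z = ext_const r + ext_const a * vol + emb kap * y + h + dd f"
    "dd y = 0" "dd h = 0" "high_hodge h"
proof -
  have A: "\<exists>r a y f. (\<Sum>s<n. hpart s z) = ext_const r + ext_const a * vol + emb kap * y + dd f \<and> dd y = 0"
    if "n < CARD('p)" for n
    using that
  proof (induction n)
    case 0
    show ?case by (intro exI[of _ 0]) (simp add: ext_const_0 d0_0)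
  next
    case (Suc n)
    then obtain r a y f where IH: "(\<Sum>s<n. hpart s z) = ext_const r + ext_const a * vol + emb kap * y + dd f" "dd y = 0"
      by auto
    have "dd (hpart n z) = 0"
      using assms by (simp add: dd_hpart) (simp add: hpart_def ext_poly_eq_iff ExtPoly_inverse)
    then obtain r1 r2 g where low: "hpart n z = emb (kpow n) * (ext_const r1 + ext_const r2 * vol) + dd g"
      using cocycle_low_degree[OF odd_p _ hodge_hpart] Suc.prems by blast
    show ?case
    proof (cases "n = 0")
      case True
      have "(\<Sum>s<Suc n. hpart s z) = ext_const (r + r1) + ext_const (a + r2) * vol + emb kap * y + dd (f + g)"
        using IH low by (simp add: True d0_add emb_ring distrib_right flip: emb_ring(6)) (simp add: cst_ring emb_ring algebra_simps)
      then show ?thesis using IH(2) by blast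
    next
      case False
      obtain y' where y': "emb (kpow n) = emb kap * (emb y' :: (3, 'p mod_ring) E0)" "opE y' = 0" "opF y' = 0" "opH y' = 0"
      proof (cases "even n")
        case True
        then obtain t where "n = Suc (Suc t)" using False by (metis One_nat_def even_Suc not0_implies_Suc odd_one)
        moreover have "opE (kpow t :: 'p mod_ring pol3) = 0" "opF (kpow t :: 'p mod_ring pol3) = 0" "opH (kpow t :: 'p mod_ring pol3) = 0"
          by (simp_all add: kpow_def op_power)
        ultimately show ?thesis using that[of "kpow t"] by (simp add: emb_ring flip: kap_kpow)
      next
        case False
        then show ?thesis using that[of 0] by (simp add: kpow_odd emb_ring)
      qed
      have "dd (emb y' * (ext_const r1 + ext_const r2 * vol)) = 0"
        by (rule ext3_eqI) (simp_all add: coef_dd coef_emb_mult coef_const_mult3 coef_vol op_mult y' set_three_eq_iff)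
      moreover have "(\<Sum>s<Suc n. hpart s z) = ext_const r + ext_const a * vol +
        emb kap * (y + emb y' * (ext_const r1 + ext_const r2 * vol)) + dd (f + g)"
        using IH low by (simp add: y' d0_add distrib_left mult.assoc)
      ultimately show ?thesis using IH(2) by (metis (no_types, lifting) add_0 d0_add)
    qed
  qed
  define n where "n = CARD('p) - 1"
  define h where "h = z - (\<Sum>s<n. hpart s z)"
  have "n < CARD('p)" using p_ge_3[OF odd_p] by (simp add: n_def)
  from A[OF this] obtain r a y f where
    y: "(\<Sum>s<n. hpart s z) = ext_const r + ext_const a * vol + emb kap * y + dd f" "dd y = 0" by blast
  have "hcomp s (coef h S) = 0" if "s < n" for s S
  proof -
    have hs: "hcomp s (sum g A) = (\<Sum>i\<in>A. hcomp s (g i))" for g :: "nat \<Rightarrow> 'p mod_ring pol3" and A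
      by (induction A rule: infinite_finite_induct) (simp_all add: hcomp_add)
    have "hcomp s (hcomp t q) = (if s = t then hcomp t q else 0)" for t and q :: "'p mod_ring pol3"
      using hcomp_homog[OF homog_hcomp[of t q], of s] by auto
    then show ?thesis using that
      by (simp add: h_def coef_sum coef_hpart hcomp_diff hs)
  qed
  then have "high_hodge h" by (simp add: high_hodge_def n_def)
  moreover have "dd h = 0"
  proof -
    have "hpart s 0 = (0 :: (3, 'p mod_ring) E0)" for s
      by (rule ext_poly_eqI) (simp add: coef_hpart)
    then show ?thesis using assms by (simp add: h_def d0_diff d0_sum dd_hpart)
  qed
  moreover have "z = ext_const r + ext_const a * vol + emb kap * y + h + dd f"
    using y(1) by (simp add: h_def algebra_simps)
  ultimately show ?thesis using that y(2) by blast
qed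

lemma high_symb: "high_hodge (h :: (3, 'p mod_ring) E0) \<Longrightarrow> s < CARD('p) - 1 \<Longrightarrow> symb s w (coef h S) = 0"
  using symb_hcomp[of s w "coef h S"] by (simp add: high_hodge_def)

lemma eps_high: "high_hodge (h :: (3, 'p mod_ring) E0) \<Longrightarrow> eps h = 0"
  using lookup_hcomp[of 0 0 0 "coef h {}"] p_ge_3[OF odd_p] by (simp add: high_hodge_def eps_def expo_0)

text \<open>
  The product has Hodge degree at least \<open>2 p - 2\<close>, and \<open>phi\<close> sees degrees up to \<open>p\<close>.
\<close>

lemma phi_high_mult:
  fixes h k :: "(3, 'p mod_ring) E0"
  assumes "high_hodge h" "high_hodge k"
  shows "phi g (h * k) = 0"
proof -
  have c: "hcomp u (coef h S * coef k T) = 0" if "u \<le> CARD('p)" for u S T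
    by (rule hcomp_mult_high[of "CARD('p) - 1" _ "CARD('p) - 1"])
      (use assms that p_ge_3[OF odd_p] in \<open>auto simp: high_hodge_def\<close>)
  have "hcomp u (coef (h * k) S) = 0" if "u \<le> CARD('p)" for u S
    by (rule subsets_three[of S]) (simp_all add: coef_mult3 hcomp_add hcomp_diff c that)
  moreover have "2 \<le> CARD('p)" using p_ge_3[OF odd_p] by simp
  ultimately have s: "symb u w (coef (h * k) S) = 0" "Poly_Mapping.lookup (coef (h * k) S) (expo 0 2 0) = 0"
    if "u \<le> CARD('p)" for u w S
    using that symb_hcomp[of u w "coef (h * k) S"] lookup_hcomp[of 0 2 0 "coef (h * k) S"] by simp_all
  note s2 = s(2)[of 0, OF le0]
  show ?thesis by (cases g) (simp_all add: s s2)
qed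

text \<open>
  The product is the part of exterior degree 0 of \<open>h\<close> times the volume form, of which \<open>phi\<close> could see the component
  in Hodge degree \<open>p - 1\<close> and weight 0. It is 0 for a cocycle because \<open>p - 1\<close> is invertible.
\<close>

lemma phi_vol_mult:
  fixes h :: "(3, 'p mod_ring) E0"
  assumes "high_hodge h" "dd h = 0"
  shows "phi g (vol * h) = 0" "phi g (h * vol) = 0"
proof -
  have "(of_nat (CARD('p) - 1) :: 'p mod_ring) \<noteq> 0"
    using p_ge_3[OF odd_p] by (intro of_nat_small_neq_0[OF odd_p]) auto
  then have c: "symb (CARD('p) - 1) 0 (coef h {}) = 0"
    using cocycle_symb(1)[OF assms(2), of "CARD('p) - 1" 0] by simp
  have u: "symb 0 0 (coef h {}) = 0" using high_symb[OF assms(1), of 0] p_ge_3[OF odd_p] by simp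
  have "coef (vol * h) S = (if S = {0, 1, 2} then coef h {} else 0)" for S
    by (rule subsets_three[of S]; hypsubst; simp add: coef_mult3 coef_vol set_three_eq_iff)
  then show "phi g (vol * h) = 0" using c u by (cases g) (simp_all add: set_three_eq_iff)
  have "coef (h * vol) S = (if S = {0, 1, 2} then coef h {} else 0)" for S
    by (rule subsets_three[of S]; hypsubst; simp add: coef_mult3 coef_vol set_three_eq_iff)
  then show "phi g (h * vol) = 0" using c u by (cases g) (simp_all add: set_three_eq_iff)
qed

text \<open>
  Every product of the terms in \<open>cocycle_decomposition\<close> is exact, \<open>kap\<close> times something of
  augmentation 0, or covered by the two preceding lemmas.
\<close>

lemma phi_mult_aug:
  fixes z w :: "(3, 'p mod_ring) E0"
  assumes z: "dd z = 0" "eps z = 0" and w: "dd w = 0" "eps w = 0"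
  shows "phi g (z * w) = 0"
proof -
  obtain r a y h f where zd: "z = ext_const r + ext_const a * vol + emb kap * y + h + dd f"
    "dd y = 0" "dd h = 0" "high_hodge h" using cocycle_decomposition[OF z(1)] by blast
  obtain r' a' y' h' f' where wd: "w = ext_const r' + ext_const a' * vol + emb kap * y' + h' + dd f'"
    "dd y' = 0" "dd h' = 0" "high_hodge h'" using cocycle_decomposition[OF w(1)] by blast
  have vol: "eps (ext_const t * vol) = (0 :: 'p mod_ring)" for t by (simp add: eps_mult eps_vol)
  have r: "r = 0" "r' = 0"
    using z(2) w(2) unfolding zd(1) wd(1)
    by (simp_all add: eps_add eps_const eps_emb_kap eps_dd vol eps_high[OF zd(4)] eps_high[OF wd(4)])
  define q where "q = ext_const a * vol + h"
  define q' where "q' = ext_const a' * vol + h'"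
  have q: "dd q = 0" by (simp add: q_def d0_add d0_const_mult dd_vol[OF odd_p] zd)
  have eq: "eps q = 0" by (simp add: q_def eps_add vol eps_high[OF zd(4)])
  have z': "z = q + emb kap * y + dd f" by (simp add: zd(1) r ext_const_0 q_def add_ac)
  have w': "w = q' + emb kap * y' + dd f'" by (simp add: wd(1) r ext_const_0 q'_def add_ac)
  have "z * w = q * q' + emb kap * (q * y') + q * dd f' + emb kap * (y * w) + dd (f * w)"
    unfolding mult_exact[OF w(1), symmetric]
    by (subst z', subst w') (simp add: distrib_left distrib_right mult.assoc[symmetric] emb_commute[of kap q] w' add_ac)
  then have "phi g (z * w) = phi g (q * q')"
    by (simp add: phi_add phi_kap phi_dd exact_mult[OF q] eps_mult eq w(2))
  also have "q * q' = ext_const (a * a') * (vol * vol) + ext_const a * (vol * h') + ext_const a' * (h * vol) + h * h'"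
    by (rule ext3_eqI) (simp_all add: q_def q'_def coef_mult3 coef_const_mult3 coef_vol set_three_eq_iff algebra_simps cst_ring)
  also have "phi g \<dots> = 0"
  proof -
    have "vol * vol = (0 :: (3, 'p mod_ring) E0)"
      by (rule ext3_eqI) (simp_all add: coef_mult3 coef_vol set_three_eq_iff)
    then show ?thesis
      using phi_const_mult[of g 0 0]
      by (simp add: phi_add phi_const_mult phi_vol_mult[OF wd(4,3)] phi_vol_mult[OF zd(4,3)] phi_high_mult[OF zd(4) wd(4)])
  qed
  finally show ?thesis .
qed

lemma phi_mult:
  fixes z w :: "(3, 'p mod_ring) E0"
  assumes z: "dd z = 0" and w: "dd w = 0"
  shows "phi g (z * w) = eps z * phi g w + eps w * phi g z"
proof -
  define z' where "z' = z + ext_const (- eps z)"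
  define w' where "w' = w + ext_const (- eps w)"
  have e: "ext_const (- t) = - (ext_const t :: (3, 'p mod_ring) E0)" for t
    by (simp add: cst_ring flip: emb_ring(6) emb_ring(5))
  have "phi g (z' * w') = 0"
    by (rule phi_mult_aug) (simp_all add: z'_def w'_def d0_add d0_const z w eps_add eps_const)
  moreover have "z * w = z' * w' + ext_const (eps z) * w' + ext_const (eps w) * z' + ext_const (eps z * eps w)"
  proof -
    have "ext_const (eps z * eps w) = (ext_const (eps z) * ext_const (eps w) :: (3, 'p mod_ring) E0)"
      by (simp add: cst_ring emb_ring flip: emb_ring(6))
    then show ?thesis
      by (simp add: z'_def w'_def e algebra_simps ext_const_commute[of "eps w" z]
          ext_const_commute[of "eps w" "ext_const (eps z)"])
  qed
  moreover have "phi g z' = phi g z" "phi g w' = phi g w"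
    by (simp_all add: z'_def w'_def phi_add phi_const)
  ultimately show ?thesis by (simp add: phi_add phi_const_mult phi_const)
qed

end

section \<open>The ring \<open>E1\<close>\<close>

abbreviation cls :: "(3, 'k::comm_ring_1) E0 \<Rightarrow> (3, 'k) E0 set" where "cls \<equiv> E1_class sl2c"
abbreviation HR :: "(3, 'k::comm_ring_1) E0 set ring" where "HR \<equiv> E1 sl2c"

lemma E1_class_alt: "E1_class c z = (\<lambda>d. d + z) ` range (d0 c)"
  by (auto simp: E1_class_def a_r_coset_def' cocycle_ring_def)

lemma E1_one: "\<one>\<^bsub>E1 c\<^esub> = E1_class c 1"
  by (simp add: E1_def FactRing_def E1_class_def cocycle_ring_def)

lemma E1_carrier: "carrier (E1 c) = E1_class c ` {z. d0 c z = 0}"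
  by (auto simp: E1_def FactRing_def A_RCOSETS_def' E1_class_def cocycle_ring_def)

lemma cocycle_mult: "dd z = 0 \<Longrightarrow> dd w = 0 \<Longrightarrow> dd (z * w) = 0"
  by (simp add: d0_mult)

lemma dd_1: "dd 1 = 0"
  using d0_const[of sl2c 1] by (simp add: cst_ring emb_ring flip: emb_ring(6))

lemma ring_cocycle_ring: "ring (cocycle_ring (sl2c :: 3 \<Rightarrow> 3 \<Rightarrow> 3 \<Rightarrow> 'k::comm_ring_1))"
proof (rule ringI)
  show "abelian_group (cocycle_ring (sl2c :: 3 \<Rightarrow> 3 \<Rightarrow> 3 \<Rightarrow> 'k))"
  proof (rule abelian_groupI)
    fix x :: "(3, 'k) E0" assume "x \<in> carrier (cocycle_ring sl2c)"
    then show "\<exists>y\<in>carrier (cocycle_ring sl2c). y \<oplus>\<^bsub>cocycle_ring sl2c\<^esub> x = \<zero>\<^bsub>cocycle_ring sl2c\<^esub>"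
      by (intro bexI[of _ "- x"]) (simp_all add: cocycle_ring_def d0_uminus)
  qed (auto simp: cocycle_ring_def d0_add d0_0 add_ac)
  show "Group.monoid (cocycle_ring (sl2c :: 3 \<Rightarrow> 3 \<Rightarrow> 3 \<Rightarrow> 'k))"
    by (rule monoidI) (auto simp: cocycle_ring_def cocycle_mult dd_1 mult.assoc)
qed (auto simp: cocycle_ring_def distrib_left distrib_right)

lemma ideal_coboundaries: "ideal (range dd) (cocycle_ring (sl2c :: 3 \<Rightarrow> 3 \<Rightarrow> 3 \<Rightarrow> 'k::comm_ring_1))"
proof (rule idealI[OF ring_cocycle_ring])
  show "subgroup (range dd) (add_monoid (cocycle_ring (sl2c :: 3 \<Rightarrow> 3 \<Rightarrow> 3 \<Rightarrow> 'k)))"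
  proof
    show "range dd \<subseteq> carrier (add_monoid (cocycle_ring (sl2c :: 3 \<Rightarrow> 3 \<Rightarrow> 3 \<Rightarrow> 'k)))"
      by (auto simp: cocycle_ring_def dd_dd)
    fix x y :: "(3, 'k) E0" assume "x \<in> range dd" "y \<in> range dd"
    then show "x \<otimes>\<^bsub>add_monoid (cocycle_ring sl2c)\<^esub> y \<in> range dd"
      by (auto simp: cocycle_ring_def simp flip: d0_add)
  next
    show "\<one>\<^bsub>add_monoid (cocycle_ring (sl2c :: 3 \<Rightarrow> 3 \<Rightarrow> 3 \<Rightarrow> 'k))\<^esub> \<in> range dd"
      using d0_0[of sl2c] by (auto simp: cocycle_ring_def image_iff)
  next
    fix x :: "(3, 'k) E0" assume "x \<in> range dd"
    then obtain f where f: "x = dd f" by blast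
    interpret ring "cocycle_ring (sl2c :: 3 \<Rightarrow> 3 \<Rightarrow> 3 \<Rightarrow> 'k)" by (rule ring_cocycle_ring)
    have "\<ominus>\<^bsub>cocycle_ring sl2c\<^esub> x = dd (- f)"
      by (rule minus_equality) (auto simp: cocycle_ring_def f d0_uminus dd_dd d0_0)
    then show "inv\<^bsub>add_monoid (cocycle_ring sl2c)\<^esub> x \<in> range dd"
      by (simp add: a_inv_def)
  qed
  fix a x :: "(3, 'k) E0"
  assume a: "a \<in> range dd" and "x \<in> carrier (cocycle_ring sl2c)"
  then have x: "dd x = 0" by (simp add: cocycle_ring_def)
  from a obtain f where f: "a = dd f" by blast
  show "x \<otimes>\<^bsub>cocycle_ring sl2c\<^esub> a \<in> range dd"
    using exact_mult[OF x, of f] by (simp add: cocycle_ring_def f)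
  show "a \<otimes>\<^bsub>cocycle_ring sl2c\<^esub> x \<in> range dd"
    using mult_exact[OF x, of f] by (simp add: cocycle_ring_def f)
qed

lemma cls_eq_iff: "cls z = cls w \<longleftrightarrow> z - w \<in> range dd"
proof
  assume "cls z = cls w"
  moreover have "z \<in> cls z" unfolding E1_class_alt by (intro image_eqI[of _ _ 0]) (auto simp: image_iff intro!: exI[of _ 0] simp: d0_0)
  ultimately obtain d where "z = d + w" "d \<in> range dd" unfolding E1_class_alt by blast
  then show "z - w \<in> range dd" by simp
next
  have sub: "cls z \<subseteq> cls w" if zw: "z - w \<in> range dd" for z w :: "(3, 'a) E0"
  proof
    fix x assume "x \<in> cls z"
    then obtain f g where "x = dd f + z" "z - w = dd g" using zw unfolding E1_class_alt by blast
    then have "x = dd (f + g) + w" by (simp add: d0_add algebra_simps)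
    then show "x \<in> cls w" unfolding E1_class_alt by blast
  qed
  assume zw: "z - w \<in> range dd"
  then obtain g where "z - w = dd g" by blast
  then have "w - z = dd (- g)" by (simp add: d0_uminus flip: minus_diff_eq[of z w])
  then have "w - z \<in> range dd" by blast
  then show "cls z = cls w" using sub zw by blast
qed

lemma cls_exact: "cls (z + dd g) = cls z"
  unfolding cls_eq_iff by simp

lemma HR_add: "dd z = 0 \<Longrightarrow> dd w = 0 \<Longrightarrow> cls z \<oplus>\<^bsub>HR\<^esub> cls w = cls (z + w)"
proof -
  interpret ideal "range dd" "cocycle_ring sl2c" by (rule ideal_coboundaries)
  assume "dd z = 0" "dd w = 0"
  then show ?thesis
    using a_rcos_sum[of z w] by (simp add: E1_def FactRing_def E1_class_def cocycle_ring_def)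
qed

lemma HR_mult: "dd z = 0 \<Longrightarrow> dd w = 0 \<Longrightarrow> cls z \<otimes>\<^bsub>HR\<^esub> cls w = cls (z * w)"
proof -
  interpret ideal "range dd" "cocycle_ring sl2c" by (rule ideal_coboundaries)
  assume "dd z = 0" "dd w = 0"
  then show ?thesis
    using rcoset_mult_add[of z w] by (simp add: E1_def FactRing_def E1_class_def cocycle_ring_def)
qed

lemma HR_zero: "\<zero>\<^bsub>HR\<^esub> = cls 0"
  by (simp add: E1_def FactRing_def E1_class_alt)

lemma ring_HR: "ring HR"
  unfolding E1_def by (rule ideal.quotient_is_ring[OF ideal_coboundaries])

lemma HR_minus: "dd z = 0 \<Longrightarrow> \<ominus>\<^bsub>HR\<^esub> cls z = cls (- z)"
proof -
  interpret ring HR by (rule ring_HR)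
  assume z: "dd z = 0"
  show ?thesis
    by (rule minus_equality) (use z in \<open>simp_all add: HR_add E1_carrier HR_zero d0_uminus\<close>)
qed

text \<open>Elements of the ring generated by a set of classes lift to any set of cocycles closed under the operations.\<close>

lemma generate_ring_lift:
  assumes x: "x \<in> generate_ring HR H"
    and incl: "\<And>h. h \<in> H \<Longrightarrow> \<exists>z. dd z = 0 \<and> P z \<and> h = cls z"
    and one: "P 1" and minus: "\<And>z. dd z = 0 \<Longrightarrow> P z \<Longrightarrow> P (- z)"
    and add: "\<And>z w. dd z = 0 \<Longrightarrow> dd w = 0 \<Longrightarrow> P z \<Longrightarrow> P w \<Longrightarrow> P (z + w)"
    and mult: "\<And>z w. dd z = 0 \<Longrightarrow> dd w = 0 \<Longrightarrow> P z \<Longrightarrow> P w \<Longrightarrow> P (z * w)"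
  obtains z where "dd z = 0" "P z" "x = cls z"
proof -
  have "\<exists>z. dd z = 0 \<and> P z \<and> x = cls z"
    using x
  proof (induction rule: generate_ring.induct)
    case one
    then show ?case using \<open>P 1\<close> dd_1 E1_one by blast
  next
    case (incl h)
    then show ?case by (rule assms(2))
  next
    case (a_inv h)
    then obtain z where z: "dd z = 0" "P z" "h = cls z" by blast
    then show ?case using minus HR_minus by (intro exI[of _ "- z"]) (simp add: d0_uminus)
  next
    case (eng_add h1 h2)
    then obtain z w where z: "dd z = 0" "P z" "h1 = cls z" and w: "dd w = 0" "P w" "h2 = cls w" by blast
    then show ?case by (intro exI[of _ "z + w"]) (simp add: d0_add add HR_add)
  next
    case (eng_mult h1 h2)
    then obtain z w where z: "dd z = 0" "P z" "h1 = cls z" and w: "dd w = 0" "P w" "h2 = cls w" by blast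
    then show ?case by (intro exI[of _ "z * w"]) (simp add: cocycle_mult mult HR_mult)
  qed
  then show ?thesis using that by blast
qed

lemma E0_comp_iff: "z \<in> E0_comp s t \<longleftrightarrow> hodge s z \<and> (\<forall>S. card S \<noteq> t \<longrightarrow> coef z S = 0)"
proof -
  have s: "(\<Sum>j\<in>UNIV. Poly_Mapping.lookup m j) = Poly_Mapping.lookup m 0 + Poly_Mapping.lookup m 1 + Poly_Mapping.lookup m 2"
    for m :: "3 \<Rightarrow>\<^sub>0 nat" unfolding UNIV_three by (simp add: add_ac)
  have z: "q = 0 \<longleftrightarrow> (\<forall>m. Poly_Mapping.lookup q m = 0)" for q :: "'a pol3"
    by (metis lookup_zero poly_mapping_eqI)
  show ?thesis unfolding bicomp_def hodge_def homog_def s z mem_Collect_eq mult_1 by blast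
qed

lemma E1_compI: "dd z = 0 \<Longrightarrow> z \<in> E0_comp s t \<Longrightarrow> cls z \<in> E1_comp sl2c s t"
  by (auto simp: E1_comp_def)

lemma UNIV_gen: "UNIV = {GU, GK, GA0, GA1, GA2, GB0, GB1, GB2, GC, GD0, GD1, GD2, GE0, GE1, GE2, GE3, GF}"
  (is "_ = ?A")
proof (rule UNIV_eq_I)
  fix g show "g \<in> ?A" by (cases g) simp_all
qed

instance gen :: finite
  by standard (simp add: UNIV_gen)

lemma CARD_gen: "CARD(gen) = 17"
  by (simp only: UNIV_gen) simp

context
  assumes odd_p: "odd CARD('p::prime_card)"
begin

lemma generated_const: "cls (ext_const r) \<in> E1_alg_gen sl2c S"
  unfolding E1_alg_gen_def by (rule generate_ring.incl) simp

lemma generates_standard: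
  "generates_through (sl2c :: 3 \<Rightarrow> 3 \<Rightarrow> 3 \<Rightarrow> 'p mod_ring) CARD('p) (range (\<lambda>g. cls (rep g)))"
proof -
  define G where "G = E1_alg_gen sl2c (range (\<lambda>g. cls (rep g :: (3, 'p mod_ring) E0)))"
  define good where "good z \<longleftrightarrow> dd z = 0 \<and> cls z \<in> G" for z
  have const: "good (ext_const r)" for r
    by (simp add: good_def G_def generated_const d0_const)
  have rep: "good (rep g)" for g
    by (auto simp: good_def G_def E1_alg_gen_def dd_rep[OF odd_p] intro!: generate_ring.incl)
  have add: "good (z + w)" if "good z" "good w" for z w
    using that generate_ring.eng_add[of "cls z" HR _ "cls w"]
    by (auto simp: good_def G_def E1_alg_gen_def HR_add d0_add)
  have mult: "good (z * w)" if "good z" "good w" for z w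
    using that generate_ring.eng_mult[of "cls z" HR _ "cls w"]
    by (auto simp: good_def G_def E1_alg_gen_def HR_mult cocycle_mult)
  have exact: "good (z + dd g)" if "good z" for z g
    using that by (simp add: good_def d0_add dd_dd cls_exact)
  have zero: "good 0" using const[of 0] by (simp add: ext_const_0)
  have sum: "good (\<Sum>i\<in>A. ext_const (r i) * rep i)" for A and r :: "gen \<Rightarrow> 'p mod_ring"
    by (induction A rule: infinite_finite_induct) (auto intro: zero add mult const rep)
  have kpow: "good (emb (kpow s))" for s
  proof (cases "even s")
    case True
    have "good (emb (kap ^ n))" for n
    proof (induction n)
      case 0
      show ?case using const[of 1] by (simp add: emb_ring cst_ring flip: emb_ring(6))
    next
      case (Suc n)
      then show ?case using mult[OF rep[of GK]] by (simp add: emb_ring)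
    qed
    then show ?thesis using True by (simp add: kpow_def)
  qed (simp add: kpow_odd emb_ring zero)
  have main: "good (emb (kpow s) * (ext_const r1 + ext_const r2 * vol))" for s r1 r2
    using mult[OF kpow[of s] add[OF const[of r1] mult[OF const[of r2] rep[of GU]]]] by simp
  have "good z" if z: "hodge s z" "dd z = 0" and s: "s \<le> CARD('p)" for s z
  proof -
    consider "Suc s < CARD('p)" | "s = CARD('p) - 1" | "s = CARD('p)" using s by linarith
    then show ?thesis
    proof cases
      case 1
      from cocycle_low_degree[OF odd_p this z] obtain r1 r2 g where
        "z = emb (kpow s) * (ext_const r1 + ext_const r2 * vol) + dd g" by blast
      then show ?thesis using exact[OF main] by simp
    next
      case 2
      from cocycle_degree_pred_p[OF odd_p z[unfolded 2]] obtain r r1 r2 g where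
        "z = (\<Sum>i\<in>gens_pred_p. ext_const (r i) * rep i) +
          emb (kpow (CARD('p) - 1)) * (ext_const r1 + ext_const r2 * vol) + dd g" by blast
      then show ?thesis using exact[OF add[OF sum main]] by simp
    next
      case 3
      from cocycle_degree_p[OF odd_p z[unfolded 3]] obtain r g where
        "z = (\<Sum>i\<in>gens_p. ext_const (r i) * rep i) + dd g" by blast
      then show ?thesis using exact[OF sum] by simp
    qed
  qed
  then have "cls z \<in> G" if "s \<le> CARD('p)" "z \<in> E0_comp s t" "dd z = 0" for s t z
    using that unfolding E0_comp_iff good_def by blast
  then have "E1_comp sl2c s t \<subseteq> G" if "s \<le> CARD('p)" for s t
    using that by (auto simp only: E1_comp_def)
  moreover have "range (\<lambda>g. cls (rep g :: (3, 'p mod_ring) E0)) \<subseteq> carrier HR"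
    by (auto simp: E1_carrier dd_rep[OF odd_p])
  ultimately show ?thesis unfolding generates_through_def G_def by blast
qed

definition phis :: "(3, 'p mod_ring) E0 \<Rightarrow> 'p mod_ring ^ gen" where
  "phis z = (\<chi> g. phi g z)"

lemma phis_cong: "cls z = cls w \<Longrightarrow> phis z = phis w"
proof -
  assume "cls z = cls w"
  then obtain f where "z - w = dd f" unfolding cls_eq_iff by blast
  then have "z = w + dd f" by (simp add: algebra_simps)
  then show ?thesis by (simp add: phis_def phi_add phi_dd[OF odd_p])
qed

text \<open>
  Generation through Hodge degree \<open>p\<close> is a condition on bihomogeneous classes; by this lemma it applies to
  the generators.
\<close>

lemma rep_comp:
  obtains s t where "s \<le> CARD('p)" "(rep g :: (3, 'p mod_ring) E0) \<in> E0_comp s t"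
proof -
  have p: "CARD('p) \<ge> 3" by (rule p_ge_3[OF odd_p])
  have one: "(rep g :: (3, 'p mod_ring) E0) \<in> E0_comp s 1"
    if "(rep g :: (3, 'p mod_ring) E0) = f - emb kap * correction t f" "hodge t (correction t f)" "one_form (correction t f)" "s = Suc (Suc t)"
      "one_form f" "hodge s f" for f s t
  proof -
    have "hodge s (emb kap * correction t f)" using hodge_emb_mult[OF homog_basic(6) that(2)] that(4) by simp
    then have "hodge s (rep g :: (3, 'p mod_ring) E0)" unfolding that(1) using that(6) by (intro hodge_diff)
    moreover have "coef (rep g :: (3, 'p mod_ring) E0) S = 0" if "card S \<noteq> 1" for S
      unfolding \<open>rep g = _\<close>
      using \<open>one_form (correction t f)\<close> \<open>one_form f\<close> that by (simp add: one_form_def coef_emb_mult)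
    ultimately show ?thesis unfolding E0_comp_iff by blast
  qed
  have mk1: "mk n a b c ab ac bc t \<in> E0_comp s u"
    if "homog s n" "homog s a" "homog s b" "homog s c" "homog s ab" "homog s ac" "homog s bc" "homog s t"
     "u \<noteq> 0 \<longrightarrow> n = 0" "u \<noteq> 1 \<longrightarrow> a = 0 \<and> b = 0 \<and> c = 0" "u \<noteq> 2 \<longrightarrow> ab = 0 \<and> ac = 0 \<and> bc = 0" "u \<noteq> 3 \<longrightarrow> t = 0"
    for n a b c ab ac bc t :: "'p mod_ring pol3" and s u
    unfolding E0_comp_iff
  proof (intro conjI allI impI)
    show "hodge s (mk n a b c ab ac bc t)" using that by (intro hodgeI) simp_all
    fix S :: "3 set" assume "card S \<noteq> u"
    then show "coef (mk n a b c ab ac bc t) S = 0"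
      using that(9-12) by (rule_tac subsets_three[of S]; hypsubst; simp)
  qed
  have mkE: "\<exists>s t. s \<le> CARD('p) \<and> mk n a b c ab ac bc v \<in> E0_comp s t"
    if "s \<le> CARD('p)"
      "homog s n" "homog s a" "homog s b" "homog s c" "homog s ab" "homog s ac" "homog s bc" "homog s v"
     "u \<noteq> 0 \<longrightarrow> n = 0" "u \<noteq> 1 \<longrightarrow> a = 0 \<and> b = 0 \<and> c = 0" "u \<noteq> 2 \<longrightarrow> ab = 0 \<and> ac = 0 \<and> bc = 0" "u \<noteq> 3 \<longrightarrow> v = 0"
    for n a b c ab ac bc v :: "'p mod_ring pol3" and s u :: nat
    using mk1[OF that(2-13)] that(1) by blast
  have "\<exists>s t. s \<le> CARD('p) \<and> (rep g :: (3, 'p mod_ring) E0) \<in> E0_comp s t"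
  proof (cases g)
    case GU
    have "vol = (mk 0 0 0 0 0 0 0 1 :: (3, 'p mod_ring) E0)"
      by (rule ext3_eqI) (simp_all add: coef_vol set_three_eq_iff)
    then show ?thesis using mk1[of 0 0 0 0 0 0 0 0 1 3] by (auto simp: GU)
  next
    case GK
    have "emb kap = (mk kap 0 0 0 0 0 0 0 :: (3, 'p mod_ring) E0)"
      by (rule ext3_eqI) (simp_all add: coef_emb)
    then show ?thesis using mk1[of 2 kap 0 0 0 0 0 0 0 0] p
      by (intro exI[of _ 2] exI[of _ 0]) (simp add: GK)
  next
    case GA0
    have "CARD('p) - 1 = Suc (Suc (CARD('p) - 3))" using p by simp
    moreover have "hodge (CARD('p) - 1) (preA :: (3, 'p mod_ring) E0)"
      using p by (intro hodgeI) (simp_all add: preA_def homog_cone_mon)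
    ultimately have "(rep g :: (3, 'p mod_ring) E0) \<in> E0_comp (CARD('p) - 1) 1"
      by (intro one[OF _ correction(1,2)[OF odd_p]]) (simp_all add: GA0 preA_def one_form_mk)
    then show ?thesis by (intro exI[of _ "CARD('p) - 1"] exI[of _ 1]) simp
  next
    case GE1
    have "CARD('p) = Suc (Suc (CARD('p) - 2))" using p by simp
    moreover have "hodge CARD('p) (preE :: (3, 'p mod_ring) E0)"
      using p by (intro hodgeI) (simp_all add: preE_def homog_cone_mon)
    ultimately have "(rep g :: (3, 'p mod_ring) E0) \<in> E0_comp CARD('p) 1"
      by (intro one[OF _ correction(4,5)[OF odd_p]]) (simp_all add: GE1 preE_def one_form_mk)
    then show ?thesis by (intro exI[of _ "CARD('p)"] exI[of _ 1]) simp
  qed (insert p, ((simp only: rep.simps, rule mkE[where s = "CARD('p) - 1" and u = 1]; simp add: homog_cone_mon; fail)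
      | (simp only: rep.simps, rule mkE[where s = "CARD('p) - 1" and u = 2]; simp add: homog_cone_mon; fail)
      | (simp only: rep.simps, rule mkE[where s = "CARD('p) - 1" and u = 3]; simp add: homog_cone_mon; fail)
      | (simp only: rep.simps, rule mkE[where s = "CARD('p)" and u = 0]; simp add: homog_cone_mon; fail)
      | (simp only: rep.simps, rule mkE[where s = "CARD('p)" and u = 1]; simp add: homog_cone_mon; fail)
      | (simp only: rep.simps, rule mkE[where s = "CARD('p)" and u = 2]; simp add: homog_cone_mon; fail)))+
  then show ?thesis using that by blast
qed

text \<open>
  Since \<open>phi\<close> is a derivation, its values on the subalgebra generated by \<open>S\<close> are linear combinations of
  its values on \<open>S\<close>. They contain the unit vectors, the values at the 17 generators.
\<close>

lemma generators_lower_bound: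
  assumes S: "finite S" "generates_through (sl2c :: 3 \<Rightarrow> 3 \<Rightarrow> 3 \<Rightarrow> 'p mod_ring) CARD('p) S"
  shows "17 \<le> card S"
proof -
  have "\<forall>x\<in>S. \<exists>z. dd z = 0 \<and> x = cls z"
    using S(2) by (auto simp: generates_through_def E1_carrier)
  then obtain l where l: "\<And>x. x \<in> S \<Longrightarrow> dd (l x) = 0 \<and> x = cls (l x)" by metis
  define V where "V = (\<lambda>x. phis (l x)) ` S"
  have smult: "phis (ext_const r * z) = r *s phis z" for r z
    by (simp add: phis_def phi_const_mult vec_eq_iff)
  have "axis g 1 \<in> vec.span V" for g
  proof -
    obtain s t where "s \<le> CARD('p)" "(rep g :: (3, 'p mod_ring) E0) \<in> E0_comp s t" by (rule rep_comp)
    then have "cls (rep g) \<in> generate_ring HR (S \<union> range (\<lambda>a. cls (ext_const a)))"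
      using S(2) E1_compI[OF dd_rep[OF odd_p]] unfolding generates_through_def E1_alg_gen_def by blast
    then obtain z where z: "dd z = 0" "phis z \<in> vec.span V" "cls (rep g) = cls z"
    proof (rule generate_ring_lift[where P = "\<lambda>z. phis z \<in> vec.span V"])
      fix h assume "h \<in> S \<union> range (\<lambda>a. cls (ext_const a :: (3, 'p mod_ring) E0))"
      then show "\<exists>z. dd z = 0 \<and> phis z \<in> vec.span V \<and> h = cls z"
      proof
        assume "h \<in> S"
        then have "phis (l h) \<in> V" by (simp add: V_def)
        then have "phis (l h) \<in> vec.span V" by (rule vec.span_base)
        then show ?thesis using l[OF \<open>h \<in> S\<close>] by blast
      next
        assume "h \<in> range (\<lambda>a. cls (ext_const a :: (3, 'p mod_ring) E0))"
        then obtain a where "h = cls (ext_const a)" by blast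
        moreover have "phis (ext_const a) = 0" by (simp add: phis_def phi_const[OF odd_p] vec_eq_iff)
        ultimately show ?thesis by (metis d0_const vec.span_zero)
      qed
    next
      have "phis 1 = 0" using phi_const[OF odd_p, of _ 1]
        by (simp add: phis_def vec_eq_iff cst_ring emb_ring flip: emb_ring(6))
      then show "phis 1 \<in> vec.span V" by (simp add: vec.span_zero)
    next
      fix z :: "(3, 'p mod_ring) E0" assume "phis z \<in> vec.span V"
      moreover have "phis (- z) = (- 1) *s phis z"
        using smult[of "- 1" z] by (simp add: cst_ring emb_ring flip: emb_ring(6))
      ultimately show "phis (- z) \<in> vec.span V" by (metis vec.span_scale)
    next
      fix z w :: "(3, 'p mod_ring) E0" assume "phis z \<in> vec.span V" "phis w \<in> vec.span V"
      moreover have "phis (z + w) = phis z + phis w" by (simp add: phis_def phi_add vec_eq_iff)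
      ultimately show "phis (z + w) \<in> vec.span V" by (metis vec.span_add)
    next
      fix z w :: "(3, 'p mod_ring) E0"
      assume "dd z = 0" "dd w = 0" "phis z \<in> vec.span V" "phis w \<in> vec.span V"
      moreover from this have "phis (z * w) = eps z *s phis w + eps w *s phis z"
        by (simp add: phis_def phi_mult[OF odd_p] vec_eq_iff)
      ultimately show "phis (z * w) \<in> vec.span V" by (metis vec.span_add vec.span_scale)
    qed
    have "phis (rep g) = axis g 1"
      by (simp add: phis_def phi_rep[OF odd_p] axis_def vec_eq_iff)
    then show ?thesis using z(2) phis_cong[OF z(3)] by simp
  qed
  then have "cart_basis \<subseteq> vec.span V" by (auto simp: cart_basis_def)
  then have "vec.span V = UNIV"
    by (metis span_cart_basis top.extremum_uniqueI vec.span_mono vec.span_span)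
  then have "CARD(gen) = vec.dim V"
    by (metis vec.dim_span vec_dim_card)
  also have "\<dots> \<le> card V" using S by (intro vec.dim_le_card') (simp add: V_def)
  also have "\<dots> \<le> card S" unfolding V_def using S(1) by (rule card_image_le)
  finally show ?thesis by (simp add: CARD_gen)
qed

text \<open>
  The lower bound also shows that the classes of the generators are distinct.
\<close>

lemma card_standard: "card (range (\<lambda>g. cls (rep g :: (3, 'p mod_ring) E0))) = 17"
proof -
  have "card (range (\<lambda>g. cls (rep g :: (3, 'p mod_ring) E0))) \<le> 17"
    using card_image_le[of UNIV "\<lambda>g. cls (rep g :: (3, 'p mod_ring) E0)"] by (simp add: CARD_gen)
  moreover have "17 \<le> card (range (\<lambda>g. cls (rep g :: (3, 'p mod_ring) E0)))"
    by (rule generators_lower_bound[OF _ generates_standard]) simp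
  ultimately show ?thesis by simp
qed

end

section \<open>The truncated isomorphism\<close>

definition kap_subst :: "((unit \<Rightarrow>\<^sub>0 nat) \<Rightarrow>\<^sub>0 'k) \<Rightarrow> 'k::comm_ring_1 pol3" where
  "kap_subst q = (\<Sum>m\<in>Poly_Mapping.keys q. cst (Poly_Mapping.lookup q m) * kap ^ Poly_Mapping.lookup m ())"

lemma kap_subst_single: "kap_subst (Poly_Mapping.single m r) = cst r * kap ^ Poly_Mapping.lookup m ()"
  by (simp add: kap_subst_def cst_ring)

lemma kap_subst_add: "kap_subst (q + r) = kap_subst q + kap_subst r"
proof -
  let ?A = "Poly_Mapping.keys q \<union> Poly_Mapping.keys r"
  have sup: "kap_subst f = (\<Sum>m\<in>?A. cst (Poly_Mapping.lookup f m) * kap ^ Poly_Mapping.lookup m ())"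
    if "Poly_Mapping.keys f \<subseteq> ?A" for f
    unfolding kap_subst_def using that by (intro sum.mono_neutral_left) (auto simp: in_keys_iff cst_ring)
  have "Poly_Mapping.keys (q + r) \<subseteq> ?A" by (auto simp: in_keys_iff lookup_add)
  then show ?thesis
    using sup[of q] sup[of r] sup[of "q + r"]
    by (simp add: lookup_add cst_ring distrib_right sum.distrib)
qed

lemma kap_subst_0 [simp]: "kap_subst 0 = 0"
  by (simp add: kap_subst_def)

lemma kap_subst_1 [simp]: "kap_subst 1 = 1"
  using kap_subst_single[of 0 1] by (simp add: cst_ring)

lemma kap_subst_mult: "kap_subst (q * r) = kap_subst q * kap_subst r"
proof (induction q rule: pm_induct)
  case (single m a)
  show ?case
  proof (induction r rule: pm_induct)
    case (single n b)
    show ?case by (simp add: mult_single kap_subst_single lookup_add power_add cst_ring mult_ac)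
  qed (simp add: distrib_left kap_subst_add)
qed (simp add: distrib_right kap_subst_add)

definition Luk_map :: "(unit, unit, 'k) ext_poly \<Rightarrow> (3, 'k::comm_ring_1) E0" where
  "Luk_map a = emb (kap_subst (coef a {})) + emb (kap_subst (coef a {()})) * vol"

lemma coef_Luk_map: "coef (Luk_map a) S = (if S = {} then kap_subst (coef a {}) else 0) +
    (if S = {0, 1, 2} then kap_subst (coef a {()}) else 0)"
  by (simp add: Luk_map_def coef_emb coef_emb_mult coef_vol)

lemma coef_mult_unit:
  fixes a b :: "(unit, unit, 'k::comm_ring_1) ext_poly"
  shows "coef (a * b) {} = coef a {} * coef b {}"
    "coef (a * b) {()} = coef a {} * coef b {()} + coef a {()} * coef b {}"
  by (simp_all add: times_ext_poly.rep_eq sum_Pow_insert)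

lemma subsets_unit: obtains "S = ({} :: unit set)" | "S = {()}"
  by (metis (full_types) UNIV_unit subset_UNIV subset_singletonD)

lemma Luk_map_add: "Luk_map (a + b) = Luk_map a + Luk_map b"
  by (rule ext_poly_eqI) (simp add: coef_Luk_map kap_subst_add)

lemma Luk_map_mult: "Luk_map (a * b) = Luk_map a * Luk_map b"
  by (rule ext3_eqI) (simp_all add: coef_Luk_map coef_mult_unit coef_mult3 kap_subst_mult kap_subst_add set_three_eq_iff mult_ac)

lemma Luk_map_const: "Luk_map (ext_const r) = ext_const r"
proof -
  have "coef (ext_const r :: (unit, unit, 'a) ext_poly) {} = Poly_Mapping.single 0 r"
    "coef (ext_const r :: (unit, unit, 'a) ext_poly) {()} = 0"
    by (simp_all add: ext_const.rep_eq)
  then show ?thesis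
    by (intro ext3_eqI) (simp_all add: coef_Luk_map kap_subst_single set_three_eq_iff)
qed

lemma Luk_map_one: "Luk_map 1 = 1"
  by (rule ext3_eqI) (simp_all add: coef_Luk_map set_three_eq_iff)

lemma kap_subst_op [simp]: "opE (kap_subst q) = 0" "opF (kap_subst q) = 0" "opH (kap_subst q) = 0"
proof -
  have "opE (kap_subst q) = 0 \<and> opF (kap_subst q) = 0 \<and> opH (kap_subst q) = 0"
    by (induction q rule: pm_induct) (simp_all add: kap_subst_single kap_subst_add op_add op_mult op_power)
  then show "opE (kap_subst q) = 0" "opF (kap_subst q) = 0" "opH (kap_subst q) = 0" by blast+
qed

lemma dd_Luk_map: "dd (Luk_map a) = 0"
  by (rule ext3_eqI) (simp_all add: coef_dd coef_Luk_map set_three_eq_iff)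

text \<open>
  In a fixed bidegree there is at most one monomial.
\<close>

lemma kap_subst_homog:
  fixes q :: "(unit \<Rightarrow>\<^sub>0 nat) \<Rightarrow>\<^sub>0 'k::comm_ring_1"
  assumes "\<And>m. Poly_Mapping.lookup q m \<noteq> 0 \<Longrightarrow> 2 * Poly_Mapping.lookup m () = s"
  shows "q = Poly_Mapping.single (Poly_Mapping.single () (s div 2)) (Poly_Mapping.lookup q (Poly_Mapping.single () (s div 2)))"
    and "kap_subst q = cst (Poly_Mapping.lookup q (Poly_Mapping.single () (s div 2))) * kpow s"
proof -
  let ?n = "Poly_Mapping.single () (s div 2)"
  have m: "m = ?n" if "Poly_Mapping.lookup q m \<noteq> 0" for m
    using assms[OF that] by (intro poly_mapping_eqI) (auto simp: lookup_single)
  then show q: "q = Poly_Mapping.single ?n (Poly_Mapping.lookup q ?n)"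
    by (intro poly_mapping_eqI) (auto simp: lookup_single when_def)
  show "kap_subst q = cst (Poly_Mapping.lookup q ?n) * kpow s"
  proof (cases "even s")
    case True
    then show ?thesis
      using arg_cong[OF q, of kap_subst] unfolding kap_subst_single by (simp add: kpow_def)
  next
    case False
    then have "Poly_Mapping.lookup q m = 0" for m using assms[of m] by (metis dvd_triv_left)
    then have "q = 0" by (intro poly_mapping_eqI) simp
    then show ?thesis by (simp add: cst_ring)
  qed
qed

lemma Luk_comp_iff: "a \<in> Luk_comp s t \<longleftrightarrow>
  (\<forall>m. Poly_Mapping.lookup (coef a {}) m \<noteq> 0 \<longrightarrow> 2 * Poly_Mapping.lookup m () = s \<and> t = 0) \<and>
  (\<forall>m. Poly_Mapping.lookup (coef a {()}) m \<noteq> 0 \<longrightarrow> 2 * Poly_Mapping.lookup m () = s \<and> t = 3)"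
proof -
  have all: "(\<forall>S. P S) \<longleftrightarrow> P {} \<and> P {()}" for P :: "unit set \<Rightarrow> bool"
  proof
    assume P: "P {} \<and> P {()}"
    show "\<forall>S. P S"
    proof
      fix S show "P S" using P by (rule_tac subsets_unit[of S]) simp_all
    qed
  qed simp
  have sum: "(\<Sum>j\<in>UNIV. Poly_Mapping.lookup m j) = Poly_Mapping.lookup m ()" for m :: "unit \<Rightarrow>\<^sub>0 nat"
    unfolding UNIV_unit by simp
  have t: "3 * card ({} :: unit set) = t \<longleftrightarrow> t = 0" "3 * card {()} = t \<longleftrightarrow> t = 3" by auto
  show ?thesis unfolding bicomp_def mem_Collect_eq sum all t ..
qed

lemma homog_kpow: "homog s (kpow s)"
proof (cases "even s")
  case True
  have "homog (2 * n) (kap ^ n)" for n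
    by (induction n) (use homog_mult[OF homog_basic(6)] in \<open>auto simp del: homog_basic(6)\<close>)
  then show ?thesis using True by (auto simp: kpow_def elim!: evenE)
qed (simp add: kpow_odd)

lemma Luk_map_comp: "a \<in> Luk_comp s t \<Longrightarrow> Luk_map a \<in> E0_comp s t"
proof -
  assume a: "a \<in> Luk_comp s t"
  note b = a[unfolded Luk_comp_iff]
  have z: "q = 0" if "\<And>m. Poly_Mapping.lookup q m \<noteq> 0 \<Longrightarrow> False" for q :: "(unit \<Rightarrow>\<^sub>0 nat) \<Rightarrow>\<^sub>0 'a"
    using that by (intro poly_mapping_eqI) auto
  have "coef a {} = 0" if "t \<noteq> 0" using b that by (intro z) blast
  moreover have "coef a {()} = 0" if "t \<noteq> 3" using b that by (intro z) blast
  moreover have "homog s (kap_subst (coef a {}))" "homog s (kap_subst (coef a {()}))"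
    using b by (subst kap_subst_homog(2)[of _ s]; auto intro!: homog_cst_mult homog_kpow)+
  ultimately show ?thesis
    unfolding E0_comp_iff hodge_def by (auto simp: coef_Luk_map intro!: homog_add)
qed

lemma cst_eq_0: "cst r = 0 \<longleftrightarrow> r = 0"
  by (metis cst_def cst_ring(1) lookup_single_eq lookup_zero)

lemma kpow_neq_0: "even s \<Longrightarrow> kpow s \<noteq> (0 :: 'k::idom pol3)"
  by (simp add: kpow_def kap_neq_0)

context
  assumes odd_p: "odd CARD('p::prime_card)"
begin

text \<open>
  By \<open>cocycle_low_degree\<close> the cocycle \<open>vb\<^sup>s\<close> times the volume form is a multiple of \<open>kpow s\<close> times
  the volume form up to a coboundary. If the latter were exact, so would be the former, in
  contradiction to \<open>vb_power_not_exact\<close>.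
\<close>

lemma vol_not_exact:
  assumes "Suc s < CARD('p)" "even s" "coef (dd g) {0, 1, 2} = cst r * kpow s"
  shows "r = (0 :: 'p mod_ring)"
proof (rule ccontr)
  assume r: "r \<noteq> 0"
  have h: "homog (n * 1) (vb ^ n :: 'p mod_ring pol3)" for n
    by (induction n) (use homog_mult[OF homog_basic(4)] in auto)
  then have "hodge s (mk 0 0 0 0 0 0 0 (vb ^ s) :: (3, 'p mod_ring) E0)"
    using h[of s] by (intro hodgeI) simp_all
  moreover have "dd (mk 0 0 0 0 0 0 0 (vb ^ s) :: (3, 'p mod_ring) E0) = 0"
    by (rule ext3_eqI) (simp_all add: coef_dd)
  ultimately obtain r1 r2 g' where
    "mk 0 0 0 0 0 0 0 (vb ^ s) = emb (kpow s) * (ext_const r1 + ext_const r2 * vol) + dd (g' :: (3, 'p mod_ring) E0)"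
    using cocycle_low_degree[OF odd_p assms(1)] by blast
  from arg_cong[OF this, of "\<lambda>z. coef z {0, 1, 2}"]
  have v: "vb ^ s = kpow s * cst r2 + coef (dd g') {0, 1, 2}"
    by (simp add: coef_emb_mult coef_const_mult3 coef_vol)
  have "cst (r2 / r) * coef (dd g) {0, 1, 2} = kpow s * cst r2"
    unfolding assms(3) using r by (simp add: mult.assoc[symmetric] mult.commute[of "cst r2"] flip: cst_ring(4))
  then have "coef (dd (g' + ext_const (r2 / r) * g)) {0, 1, 2} = cst 1 * vb ^ (2 * (s div 2))"
    using v assms(2) by (simp add: d0_add d0_const_mult coef_const_mult3 cst_ring add.commute)
  then show False
    using vb_power_not_exact[OF odd_p, of "s div 2"] assms(1,2) by fastforce
qed

lemma Luk_iso_standard: "Luk_iso_below (CARD('p) - 1) (sl2c :: 3 \<Rightarrow> 3 \<Rightarrow> 3 \<Rightarrow> 'p mod_ring)"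
  unfolding Luk_iso_below_def
proof (intro exI[of _ "\<lambda>a. cls (Luk_map a)"] conjI allI impI ballI)
  fix s t assume s: "s < CARD('p) - 1"
  then have s': "Suc s < CARD('p)" by simp
  show "bij_betw (\<lambda>a. cls (Luk_map a)) (Luk_comp s t) (E1_comp (sl2c :: 3 \<Rightarrow> 3 \<Rightarrow> 3 \<Rightarrow> 'p mod_ring) s t)"
  proof (rule bij_betwI')
    fix a b :: "(unit, unit, 'p mod_ring) ext_poly"
    assume a: "a \<in> Luk_comp s t" and b: "b \<in> Luk_comp s t"
    note ab = a[unfolded Luk_comp_iff] b[unfolded Luk_comp_iff]
    let ?n = "Poly_Mapping.single () (s div 2)"
    show "cls (Luk_map a) = cls (Luk_map b) \<longleftrightarrow> a = b"
    proof
      assume "cls (Luk_map a) = cls (Luk_map b)"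
      then obtain g where g: "Luk_map a - Luk_map b = dd g" unfolding cls_eq_iff by blast
      have k: "kap_subst (coef a S) = cst (Poly_Mapping.lookup (coef a S) ?n) * kpow s"
        "kap_subst (coef b S) = cst (Poly_Mapping.lookup (coef b S) ?n) * kpow s" for S
        using ab by (rule_tac subsets_unit[of S]; hypsubst; rule_tac kap_subst_homog(2); blast)+
      have eq: "Poly_Mapping.lookup (coef a S) ?n = Poly_Mapping.lookup (coef b S) ?n" if ev: "even s" for S
      proof -
        have "cst (Poly_Mapping.lookup (coef a {}) ?n - Poly_Mapping.lookup (coef b {}) ?n) * kpow s = 0"
          using arg_cong[OF g, of "\<lambda>z. coef z {}"] by (simp add: coef_Luk_map coef_dd k cst_ring left_diff_distrib set_three_eq_iff)
        moreover have "coef (dd g) {0, 1, 2} = cst (Poly_Mapping.lookup (coef a {()}) ?n - Poly_Mapping.lookup (coef b {()}) ?n) * kpow s"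
          unfolding g[symmetric] by (simp add: coef_Luk_map k cst_ring left_diff_distrib set_three_eq_iff)
        then have "Poly_Mapping.lookup (coef a {()}) ?n - Poly_Mapping.lookup (coef b {()}) ?n = 0"
          by (rule vol_not_exact[OF s' ev])
        ultimately show ?thesis
          using ev by (rule_tac subsets_unit[of S]) (simp_all add: kpow_neq_0 cst_eq_0)
      qed
      have "coef a S = coef b S" for S
      proof (cases "even s")
        case True
        have "coef a S = Poly_Mapping.single ?n (Poly_Mapping.lookup (coef a S) ?n)"
          "coef b S = Poly_Mapping.single ?n (Poly_Mapping.lookup (coef b S) ?n)"
          using ab by (rule_tac subsets_unit[of S]; hypsubst; rule_tac kap_subst_homog(1); blast)+
        then show ?thesis using eq[OF True] by metis
      next
        case False
        then have "2 * n \<noteq> s" for n by auto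
        then have "Poly_Mapping.lookup (coef a S) m = 0" "Poly_Mapping.lookup (coef b S) m = 0" for m
          using ab by (rule_tac subsets_unit[of S]; hypsubst; blast)+
        then show ?thesis by (intro poly_mapping_eqI) simp
      qed
      then show "a = b" by (rule ext_poly_eqI)
    qed simp
  next
    fix a :: "(unit, unit, 'p mod_ring) ext_poly" assume "a \<in> Luk_comp s t"
    then show "cls (Luk_map a) \<in> E1_comp sl2c s t" by (intro E1_compI dd_Luk_map Luk_map_comp)
  next
    fix x assume "x \<in> E1_comp (sl2c :: 3 \<Rightarrow> 3 \<Rightarrow> 3 \<Rightarrow> 'p mod_ring) s t"
    then obtain z where x: "x = cls z" and z: "z \<in> E0_comp s t" "dd z = 0" unfolding E1_comp_def by blast
    from z(1) have zc: "coef z S = 0" if "card S \<noteq> t" for S using that unfolding E0_comp_iff by blast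
    obtain r1 r2 g where zd: "z = emb (kpow s) * (ext_const r1 + ext_const r2 * vol) + dd g"
      using cocycle_low_degree[OF odd_p s' _ z(2)] z(1) unfolding E0_comp_iff by blast
    show "\<exists>a\<in>Luk_comp s t. x = cls (Luk_map a)"
    proof (cases "even s")
      case False
      then have "x = cls (Luk_map 0)"
        using cls_exact[of 0 g] by (simp add: x zd kpow_odd emb_ring Luk_map_def)
      moreover have "0 \<in> Luk_comp s t" by (simp add: bicomp_def)
      ultimately show ?thesis by blast
    next
      case True
      have "cst r1 * kpow s = 0" if "t \<noteq> 0"
        using zc[of "{}"] that unfolding zd
        by (simp add: coef_emb_mult coef_const_mult3 coef_vol coef_dd mult.commute set_three_eq_iff)
      then have r1: "r1 = 0" if "t \<noteq> 0" using that True by (simp add: kpow_neq_0 cst_eq_0)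
      have "coef (dd g) {0, 1, 2} = cst (- r2) * kpow s" if "t \<noteq> 3"
        using zc[of "{0, 1, 2}"] that unfolding zd
        by (simp add: coef_emb_mult coef_const_mult3 coef_vol cst_ring mult.commute eq_neg_iff_add_eq_0 add.commute)
      then have r2: "r2 = 0" if "t \<noteq> 3" using vol_not_exact[OF s' True] that by fastforce
      let ?n = "Poly_Mapping.single () (s div 2)"
      define a :: "(unit, unit, 'p mod_ring) ext_poly" where
        "a = ext_term {} (Poly_Mapping.single ?n r1) + ext_term {()} (Poly_Mapping.single ?n r2)"
      have a: "coef a {} = Poly_Mapping.single ?n r1" "coef a {()} = Poly_Mapping.single ?n r2"
        by (simp_all add: a_def coef_ext_term)
      have "a \<in> Luk_comp s t"
        unfolding Luk_comp_iff a using True r1 r2 by (auto simp: lookup_single when_def split: if_splits)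
      moreover have "Luk_map a = emb (kpow s) * (ext_const r1 + ext_const r2 * vol)"
        using True by (intro ext_poly_eqI)
          (simp add: coef_Luk_map a kap_subst_single kpow_def coef_emb_mult coef_const_mult3 coef_vol ext_const.rep_eq cst_def expo_0 mult_ac)
      then have "x = cls (Luk_map a)" unfolding x zd by (simp add: cls_exact)
      ultimately show ?thesis by blast
    qed
  qed
next
  fix a b :: "(unit, unit, 'p mod_ring) ext_poly"
  show "cls (Luk_map (a + b)) = cls (Luk_map a) \<oplus>\<^bsub>HR\<^esub> cls (Luk_map b)"
    by (simp add: HR_add dd_Luk_map Luk_map_add)
  show "cls (Luk_map (a * b)) = cls (Luk_map a) \<otimes>\<^bsub>HR\<^esub> cls (Luk_map b)"
    by (simp add: HR_mult dd_Luk_map Luk_map_mult)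
next
  fix a :: "(unit, unit, 'p mod_ring) ext_poly" and r
  show "cls (Luk_map (ext_const r * a)) = cls (ext_const r) \<otimes>\<^bsub>HR\<^esub> cls (Luk_map a)"
    by (simp add: HR_mult dd_Luk_map Luk_map_mult Luk_map_const d0_const)
next
  show "cls (Luk_map 1) = \<one>\<^bsub>HR\<^esub>"
    by (simp add: E1_one Luk_map_one)
qed

end

text \<open>
  There are no elements of exterior degree 1 in \<open>\<Lambda>(u) \<otimes> k[\<kappa>]\<close>.
\<close>

lemma not_Luk_iso_below:
  fixes z :: "(3, 'k::comm_ring_1) E0"
  assumes "s < n" "z \<in> E0_comp s 1" "dd z = 0" "z \<notin> range dd"
  shows "\<not> Luk_iso_below n (sl2c :: 3 \<Rightarrow> 3 \<Rightarrow> 3 \<Rightarrow> 'k)"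
proof
  assume "Luk_iso_below n (sl2c :: 3 \<Rightarrow> 3 \<Rightarrow> 3 \<Rightarrow> 'k)"
  then obtain \<phi> :: "(unit, unit, 'k) ext_poly \<Rightarrow> (3, 'k) E0 set" where
    "\<forall>s<n. \<forall>t. bij_betw \<phi> (Luk_comp s t) (E1_comp (sl2c :: 3 \<Rightarrow> 3 \<Rightarrow> 3 \<Rightarrow> 'k) s t)"
    unfolding Luk_iso_below_def by (elim exE conjE) rule
  then have "bij_betw \<phi> (Luk_comp s 1) (E1_comp (sl2c :: 3 \<Rightarrow> 3 \<Rightarrow> 3 \<Rightarrow> 'k) s 1)"
    using assms(1) by blast
  moreover have "(Luk_comp s 1 :: (unit, unit, 'k) ext_poly set) \<subseteq> {0}"
  proof
    fix a :: "(unit, unit, 'k) ext_poly" assume "a \<in> Luk_comp s 1"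
    then have "Poly_Mapping.lookup (coef a {}) m = 0" "Poly_Mapping.lookup (coef a {()}) m = 0" for m
      unfolding Luk_comp_iff by auto
    then have "coef a S = 0" for S by (rule_tac subsets_unit[of S]) (auto intro!: poly_mapping_eqI)
    then show "a \<in> {0}" by (auto intro!: ext_poly_eqI)
  qed
  moreover have "cls z \<in> E1_comp sl2c s 1" "cls 0 \<in> E1_comp (sl2c :: 3 \<Rightarrow> 3 \<Rightarrow> 3 \<Rightarrow> 'k) s 1"
    using assms by (auto intro!: E1_compI simp: d0_0 bicomp_def)
  moreover have "cls z \<noteq> cls 0" using assms(4) by (simp add: cls_eq_iff)
  ultimately have "cls z \<in> \<phi> ` {0}" "cls 0 \<in> \<phi> ` {0}"
    unfolding bij_betw_def by (metis image_mono subsetD)+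
  then show False using \<open>cls z \<noteq> cls 0\<close> by simp
qed

lemma not_Luk_iso_odd:
  assumes odd_p: "odd CARD('p::prime_card)"
  shows "\<not> Luk_iso_below CARD('p) (sl2c :: 3 \<Rightarrow> 3 \<Rightarrow> 3 \<Rightarrow> 'p mod_ring)"
proof (rule not_Luk_iso_below[of "CARD('p) - 1" _ "rep GA1"])
  show "dd (rep GA1 :: (3, 'p mod_ring) E0) = 0" by (rule dd_rep[OF odd_p])
  show "(rep GA1 :: (3, 'p mod_ring) E0) \<notin> range dd"
    using phi_rep[OF odd_p, of GA1 GA1] phi_dd[OF odd_p, of GA1] by (metis rangeE zero_neq_one)
  have "hodge (CARD('p) - 1) (rep GA1 :: (3, 'p mod_ring) E0)"
    using p_ge_3[OF odd_p] by (intro hodgeI) (simp_all add: homog_cone_mon)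
  moreover have "one_form (rep GA1 :: (3, 'p mod_ring) E0)" by (simp add: one_form_mk)
  ultimately show "(rep GA1 :: (3, 'p mod_ring) E0) \<in> E0_comp (CARD('p) - 1) 1"
    unfolding E0_comp_iff one_form_def by blast
qed (use p_ge_3[OF odd_p] in simp)

lemma not_Luk_iso_two:
  assumes p: "CARD('p::prime_card) = 2"
  shows "\<not> Luk_iso_below 1 (sl2c :: 3 \<Rightarrow> 3 \<Rightarrow> 3 \<Rightarrow> 'p mod_ring)"
proof (rule not_Luk_iso_below[of 0 _ "mk 0 1 0 0 0 0 0 0"])
  have "(of_nat CARD('p) :: 'p mod_ring) = 0" by simp
  then have "(2 :: 'p mod_ring) = 0" unfolding p by simp
  then have "(2 :: 'p mod_ring pol3) = 0" by (metis cst_numeral cst_ring(1))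
  then show "dd (mk 0 1 0 0 0 0 0 0 :: (3, 'p mod_ring) E0) = 0"
    by (intro ext3_eqI) (simp_all add: coef_dd)
  have "hodge 0 (mk 0 1 0 0 0 0 0 0 :: (3, 'p mod_ring) E0)" by (intro hodgeI) simp_all
  then show "(mk 0 1 0 0 0 0 0 0 :: (3, 'p mod_ring) E0) \<in> E0_comp 0 1"
    using one_form_mk unfolding E0_comp_iff one_form_def by blast
  show "(mk 0 1 0 0 0 0 0 0 :: (3, 'p mod_ring) E0) \<notin> range dd"
  proof
    assume "(mk 0 1 0 0 0 0 0 0 :: (3, 'p mod_ring) E0) \<in> range dd"
    then obtain g where "mk 0 1 0 0 0 0 0 0 = dd (g :: (3, 'p mod_ring) E0)" by blast
    from arg_cong[OF this, of "\<lambda>z. symb 0 0 (coef z {0})"]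
    have "symb 0 0 (1 :: 'p mod_ring pol3) = 0" by (simp add: coef_dd symb_op symb_out)
    then show False using symb_mon[of 0 0 0 0 0 "1 :: 'p mod_ring"] by (simp add: expo_0)
  qed
qed simp

section \<open>Integer coefficients\<close>

text \<open>\<open>d (va\<^sup>q)\<close> is divisible by \<open>q\<close>, and the quotient is a torsion class.\<close>

definition torsion_cocycle :: "nat \<Rightarrow> (3, int) E0" where
  "torsion_cocycle q = mk 0 (- 2 * vb * va ^ (q - 1)) (2 * va ^ q) 0 0 0 0 0"

lemma torsion_cocycle:
  assumes "q > 0"
  shows "of_nat q * torsion_cocycle q = dd (emb (va ^ q))"
    and "dd (torsion_cocycle q) = 0"
proof -
  have v: "va * va ^ (q - 1) = (va ^ q :: int pol3)" using assms by (cases q) simp_all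
  have q: "of_nat q * z = emb (of_nat q) * z" for z :: "(3, int) E0"
  proof -
    have "(of_nat q :: (3, int) E0) = emb (of_nat q)"
      by (induction q) (simp_all add: emb_ring)
    then show ?thesis by simp
  qed
  have op: "opE (va ^ q :: int pol3) = 0" "opF (va ^ q :: int pol3) = of_nat q * (- 2 * vb * va ^ (q - 1))"
    "opH (va ^ q :: int pol3) = of_nat q * (2 * (va * va ^ (q - 1)))"
    unfolding op_power op_v by (simp_all add: mult_ac)
  show e: "of_nat q * torsion_cocycle q = dd (emb (va ^ q))"
    unfolding q
    by (rule ext3_eqI; simp only: coef_dd coef_emb coef_emb_mult torsion_cocycle_def coef_mk; simp add: op[unfolded v])
  have c: "emb (of_nat q) = (ext_const (of_nat q) :: (3, int) E0)"
    by (simp only: cst_of_nat[symmetric] emb_ring(6))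
  have "emb (of_nat q) * dd (torsion_cocycle q) = dd (of_nat q * torsion_cocycle q)"
    unfolding q c d0_const_mult ..
  also have "\<dots> = 0" unfolding e by (rule dd_dd)
  finally have *: "emb (of_nat q) * dd (torsion_cocycle q) = 0" .
  show "dd (torsion_cocycle q) = 0"
  proof (rule ext_poly_eqI)
    fix S
    have "of_nat q * coef (dd (torsion_cocycle q)) S = 0"
      using arg_cong[OF *, of "\<lambda>z. coef z S"] by (simp add: coef_emb_mult)
    then show "coef (dd (torsion_cocycle q)) S = coef 0 S" using assms by simp
  qed
qed

text \<open>
  The action of \<open>h\<close> multiplies the weight vector \<open>va\<^sup>q\<close> by \<open>2 q\<close>, while the cocycle has the coefficient
  \<open>2 va\<^sup>q\<close> there. The multiple \<open>n\<close> anticipates the proof that the ring is not finitely generated.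
\<close>

lemma torsion_cocycle_exact:
  assumes "of_nat n * coef (torsion_cocycle q) {1} = opH w" "q > 0"
  shows "q dvd n"
proof -
  have "symb q (int q) (of_nat n * (2 * va ^ q :: int pol3)) = symb q (int q) (opH w)"
    using assms(1) by (simp add: torsion_cocycle_def)
  moreover have "of_nat n * (2 * va ^ q) = cst (int n * 2) * (va ^ q :: int pol3)"
    by (simp add: cst_ring cst_numeral flip: cst_of_nat)
  ultimately have "int n * 2 * symb q (int q) (va ^ q :: int pol3) = 2 * int q * symb q (int q) w"
    by (simp only: symb_cst symb_op) simp
  moreover have "symb q (int q) (va ^ q :: int pol3) = 1"
    unfolding var_power symb_mon by simp
  ultimately have "int n * 2 = 2 * int q * symb q (int q) w" by simp
  then have "int n = int q * symb q (int q) w" by simp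
  then show ?thesis by (metis dvd_triv_left int_dvd_int_iff)
qed

lemma has_torsion_standard:
  assumes "prime q"
  shows "has_torsion (HR :: (3, int) E0 set ring) q"
proof -
  have q: "q > 0" "q \<noteq> 1" using assms prime_gt_0_nat by auto
  note tc = torsion_cocycle[OF q(1)]
  let ?x = "cls (torsion_cocycle q)"
  interpret ring HR by (rule ring_HR)
  have x: "?x \<in> carrier HR" using tc(2) by (auto simp: E1_carrier)
  have pow: "[n] \<cdot>\<^bsub>HR\<^esub> ?x = cls (of_nat n * torsion_cocycle q)" for n :: nat
  proof (induction n)
    case 0
    then show ?case by (simp add: HR_zero)
  next
    case (Suc n)
    have "dd (of_nat n * torsion_cocycle q) = 0"
    proof (induction n)
      case (Suc n)
      then show ?case by (simp add: distrib_right d0_add tc(2))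
    qed (simp add: d0_0)
    then show ?case using Suc by (simp add: HR_add tc(2) distrib_right add.commute)
  qed
  have "[q] \<cdot>\<^bsub>HR\<^esub> ?x = \<zero>\<^bsub>HR\<^esub>"
    unfolding pow HR_zero cls_eq_iff tc(1) by simp
  moreover have "?x \<noteq> \<zero>\<^bsub>HR\<^esub>"
  proof
    assume "?x = \<zero>\<^bsub>HR\<^esub>"
    then obtain g where "torsion_cocycle q = dd g" unfolding HR_zero cls_eq_iff by auto
    then have "of_nat 1 * coef (torsion_cocycle q) {1} = opH (coef g {})" by (simp add: coef_dd)
    from torsion_cocycle_exact[OF this q(1)] show False using q(2) by simp
  qed
  ultimately show ?thesis unfolding has_torsion_def using x by blast
qed

text \<open>
  \<open>n\<close> times the 1-form part of \<open>z\<close> is the coboundary of some \<open>w\<close>. A condition on all of \<open>z\<close> would be too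
  strong, as the class of 1 is not torsion.
\<close>

definition exact_one_part :: "nat \<Rightarrow> (3, int) E0 \<Rightarrow> bool" where
  "exact_one_part n z \<longleftrightarrow> (\<exists>w. of_nat n * coef z {0} = opF w \<and> of_nat n * coef z {1} = opH w \<and> of_nat n * coef z {2} = opE w)"

lemma op_of_nat [simp]: "opE (of_nat n) = 0" "opF (of_nat n) = 0" "opH (of_nat n) = 0"
  unfolding cst_of_nat[symmetric] by simp_all

lemma op_of_nat_mult:
  "opE (of_nat n * q) = of_nat n * opE (q :: 'k::comm_ring_1 pol3)"
  "opF (of_nat n * q) = of_nat n * opF q" "opH (of_nat n * q) = of_nat n * opH q"
  unfolding cst_of_nat[symmetric] by (simp_all add: op_mult)

lemma exact_one_part_mult: "exact_one_part n z \<Longrightarrow> exact_one_part (m * n) z"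
proof -
  assume "exact_one_part n z"
  then obtain w where w: "of_nat n * coef z {0} = opF w" "of_nat n * coef z {1} = opH w" "of_nat n * coef z {2} = opE w"
    unfolding exact_one_part_def by blast
  show ?thesis unfolding exact_one_part_def
    by (rule exI[of _ "of_nat m * w"]) (simp add: op_of_nat_mult w[symmetric] mult.assoc)
qed

lemma exact_one_part_add: "exact_one_part n z \<Longrightarrow> exact_one_part n z' \<Longrightarrow> exact_one_part n (z + z')"
  unfolding exact_one_part_def by (elim exE conjE, rule_tac x = "w + wa" in exI) (simp add: op_add distrib_left)

text \<open>
  The first cohomology vanishes over the rationals, hence it is torsion. The multiple \<open>2 s!\<close> clears
  the denominators \<open>2 w\<close>, \<open>\<bar>w\<bar> \<le> s\<close>, of Cartan's homotopy, and for \<open>w = 0\<close> the denominator \<open>s\<close>.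
\<close>

lemma exact_one_part_homog:
  assumes "hodge s z" "dd z = 0" "coef z {0, 1} = 0" "coef z {0, 2} = 0" "coef z {1, 2} = 0"
  shows "\<exists>n>0. exact_one_part n z"
  using assms
proof (induction s arbitrary: z rule: less_induct)
  case (less s)
  show ?case
  proof (cases "s = 0")
    case True
    then have "\<exists>r. coef z S = cst r" for S
      using less.prems homog_0_cst by (auto simp: hodge_def)
    then obtain r where r: "\<And>S. coef z S = cst (r S)" by metis
    have d: "coef (dd z) S = 0" for S using less.prems by simp
    have "cst (r {1}) = 0" using d[of "{0, 2}"] by (simp add: coef_dd r)
    moreover have "2 * cst (r {0}) = 0" using d[of "{0, 1}"] by (simp add: coef_dd r)
    moreover have "2 * cst (r {2}) = 0" using d[of "{1, 2}"] by (simp add: coef_dd r)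
    ultimately have "exact_one_part 1 z" unfolding exact_one_part_def by (intro exI[of _ 0]) (simp add: r)
    then show ?thesis by (intro exI[of _ 1]) simp
  next
    case False
    define N where "N = 2 * fact s * (1::nat)"
    have N: "N > 0" by (simp add: N_def)
    have dv: "2 * w dvd int N" if "w \<noteq> 0" "\<bar>w\<bar> \<le> int s" for w :: int
    proof -
      have "nat \<bar>w\<bar> dvd fact s" using that by (intro dvd_fact) auto
      then have "\<bar>w\<bar> dvd int (fact s)" by (metis abs_ge_zero int_dvd_int_iff nat_0_le)
      then show ?thesis by (simp add: N_def)
    qed
    obtain n where n: "homog s n" "\<And>w. symb s w n = (if \<bar>w\<bar> \<le> int s then
      if w = 0 then - (int N div (2 * int s)) * 2 * symb s (- 1) (coef z {0})
      else (int N div (2 * w)) * symb s w (coef z {1}) else 0)"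
      using ex_symb[of s "\<lambda>w. if w = 0 then - (int N div (2 * int s)) * 2 * symb s (- 1) (coef z {0})
        else (int N div (2 * w)) * symb s w (coef z {1})"] by blast
    define z' where "z' = ext_const (int N) * mk 0 (coef z {0}) (coef z {1}) (coef z {2}) 0 0 0 0 - dd (emb n)"
    have c: "coef (dd z) S = 0" for S using less.prems by simp
    have "dd (mk 0 (coef z {0}) (coef z {1}) (coef z {2}) 0 0 0 0) = 0"
      using c[of "{0, 1}"] c[of "{0, 2}"] c[of "{1, 2}"] by (intro ext3_eqI) (simp_all add: coef_dd)
    then have z': "dd z' = 0" by (simp add: z'_def d0_diff d0_const_mult dd_dd)
    have "hodge s (mk 0 (coef z {0}) (coef z {1}) (coef z {2}) 0 0 0 0)"
      using less.prems(1) by (intro hodgeI) (simp_all add: hodge_def)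
    moreover have "hodge s (emb n)" using n(1) by (simp add: hodge_def coef_emb)
    ultimately have h: "hodge s z'"
      unfolding z'_def by (intro hodge_diff hodge_const_mult hodge_dd)
    have zero: "coef z' {} = 0" "coef z' {0, 1} = 0" "coef z' {0, 2} = 0" "coef z' {1, 2} = 0" "coef z' {0, 1, 2} = 0"
      by (simp_all add: z'_def coef_const_mult3 coef_dd coef_emb)
    have "vanishes s z' w" for w
    proof -
      have 1: "symb s w (coef z' {1}) = int N * symb s w (coef z {1}) - 2 * w * symb s w n"
        by (simp add: z'_def coef_const_mult3 symb_diff symb_cst coef_dd symb_op coef_emb)
      have cy: "int s * symb s 0 (coef z {1}) = 0"
        using cocycle_symb(3)[OF less.prems(2), of s 0] by simp
      have "symb s w (coef z' {1}) = 0 \<and> symb s (w - 1) (coef z' {0}) = 0 \<and> symb s (w + 1) (coef z' {2}) = 0"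
      proof (cases "w = 0")
        case True
        have b: "symb s 0 (coef z {1}) = 0" using cy False by simp
        have "2 * int s dvd int N" using dv[of "int s"] False by simp
        then have "int N = 2 * int s * (int N div (2 * int s))" by simp
        then have "symb s (- 1) (coef z' {0}) = 0"
          using n(2)[of 0]
          by (simp add: z'_def coef_const_mult3 symb_diff symb_cst coef_dd symb_op coef_emb)
        then show ?thesis
          using True 1 b cocycle_symb(4)[OF z', of s 0] by simp
      next
        case w: False
        have b: "symb s w (coef z' {1}) = 0"
        proof (cases "\<bar>w\<bar> \<le> int s")
          case True
          then have "2 * w * (int N div (2 * w)) = int N" using dv[OF w] by simp
          then show ?thesis unfolding 1 n(2) using True w by (simp add: mult.assoc[symmetric])
        next
          case False
          then show ?thesis by (simp add: symb_out)
        qed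
        then show ?thesis using w cocycle_symb(3,5)[OF z', where s = s and w = w] by simp
      qed
      then show ?thesis unfolding vanishes_def zero by simp
    qed
    from vanishes_imp_kap[OF h this] obtain y where
      y: "z' = emb kap * y" "y = 0 \<or> (\<exists>t. s = Suc (Suc t) \<and> hodge t y)" by blast
    have yz: "coef y S = 0" if "coef z' S = 0" for S
      using that unfolding y(1) coef_emb_mult using kap_neq_0 by auto
    have "\<exists>m>0. exact_one_part m y"
      using y(2)
    proof
      assume "y = 0"
      then have "exact_one_part 1 y" unfolding exact_one_part_def by (intro exI[of _ 0]) simp
      then show ?thesis by (intro exI[of _ 1]) simp
    next
      assume "\<exists>t. s = Suc (Suc t) \<and> hodge t y"
      then obtain t where "s = Suc (Suc t)" "hodge t y" by blast
      then show ?thesis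
        using less.IH[of t y] kap_cocycle[of y] z' y(1) yz zero by simp
    qed
    then obtain m w where m: "m > 0" and w: "of_nat m * coef y {0} = opF w" "of_nat m * coef y {1} = opH w" "of_nat m * coef y {2} = opE w"
      unfolding exact_one_part_def by blast
    have zy: "cst (int N) * coef z {0} = opF n + kap * coef y {0}" "cst (int N) * coef z {1} = opH n + kap * coef y {1}"
      "cst (int N) * coef z {2} = opE n + kap * coef y {2}"
      using arg_cong[OF y(1), of "\<lambda>z. coef z {0}"] arg_cong[OF y(1), of "\<lambda>z. coef z {1}"] arg_cong[OF y(1), of "\<lambda>z. coef z {2}"]
      by (simp_all add: z'_def coef_const_mult3 coef_dd coef_emb coef_emb_mult algebra_simps)
    have "exact_one_part (m * N) z"
      unfolding exact_one_part_def
    proof (intro exI conjI)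
      have e: "of_nat (m * N) * q = of_nat m * (cst (int N) * q)" for q :: "int pol3"
        by (simp add: cst_of_nat mult.assoc)
      show "of_nat (m * N) * coef z {0} = opF (of_nat m * n + kap * w)"
        "of_nat (m * N) * coef z {1} = opH (of_nat m * n + kap * w)"
        "of_nat (m * N) * coef z {2} = opE (of_nat m * n + kap * w)"
        unfolding e zy by (simp_all add: op_add op_mult op_of_nat_mult w[symmetric] distrib_left mult_ac)
    qed
    then show ?thesis using m N by (intro exI[of _ "m * N"]) simp
  qed
qed

lemma exact_one_part_cocycle:
  assumes "dd z = 0"
  shows "\<exists>n>0. exact_one_part n z"
proof -
  have k: "\<exists>n>0. exact_one_part n (hpart s z)" for s
  proof -
    define y where "y = mk 0 (coef (hpart s z) {0}) (coef (hpart s z) {1}) (coef (hpart s z) {2}) 0 0 0 0"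
    have "hpart s (0 :: (3, int) E0) = 0" by (rule ext_poly_eqI) (simp add: coef_hpart)
    then have "dd (hpart s z) = 0" using assms by (simp add: dd_hpart)
    then have c: "coef (dd (hpart s z)) S = 0" for S by simp
    have "dd y = 0"
      using c[of "{0, 1}"] c[of "{0, 2}"] c[of "{1, 2}"] by (intro ext3_eqI) (simp_all add: y_def coef_dd)
    moreover have "hodge s y"
      using hodge_hpart[of s z] by (intro hodgeI) (simp_all add: y_def hodge_def)
    ultimately have "\<exists>n>0. exact_one_part n y" by (intro exact_one_part_homog[of s]) (simp_all add: y_def)
    then show ?thesis by (simp add: exact_one_part_def y_def)
  qed
  have "\<exists>n>0. exact_one_part n (\<Sum>s<m. hpart s z)" for m
  proof (induction m)
    case 0
    have "exact_one_part 1 0" unfolding exact_one_part_def by (intro exI[of _ 0]) simp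
    then show ?case by (intro exI[of _ 1]) simp
  next
    case (Suc m)
    then obtain n n' where "n > 0" "exact_one_part n (\<Sum>s<m. hpart s z)" "n' > 0" "exact_one_part n' (hpart m z)"
      using k[of m] by blast
    then have "exact_one_part (n * n') (\<Sum>s<Suc m. hpart s z)"
      using exact_one_part_mult[of n "\<Sum>s<m. hpart s z" n'] exact_one_part_mult[of n' "hpart m z" n]
      by (simp add: exact_one_part_add mult.commute)
    then show ?case using \<open>n > 0\<close> \<open>n' > 0\<close> by (intro exI[of _ "n * n'"]) simp
  qed
  moreover obtain N where "\<And>n. n \<ge> N \<Longrightarrow> z = (\<Sum>s<n. hpart s z)" using hpart_sum[of z] by blast
  ultimately show ?thesis by (metis order_refl)
qed

text \<open>
  The 1-form part of a product \<open>z * w\<close> is the sum of the 1-form parts of the factors, each multiplied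
  with the polynomial part of the other factor. These polynomials are invariants if \<open>z\<close> and \<open>w\<close> are cocycles, so
  multiplication with them preserves exactness.
\<close>

lemma not_fin_gen_standard: "\<not> fin_gen_ring (HR :: (3, int) E0 set ring)"
proof
  assume "fin_gen_ring (HR :: (3, int) E0 set ring)"
  then obtain S where S: "finite S" "S \<subseteq> carrier HR" "generate_ring HR S = carrier (HR :: (3, int) E0 set ring)"
    unfolding fin_gen_ring_def by blast
  have "\<forall>x\<in>S. \<exists>z n. dd z = 0 \<and> x = cls z \<and> n > 0 \<and> exact_one_part n z"
    using S(2) exact_one_part_cocycle unfolding E1_carrier by blast
  then obtain l n where l: "\<And>x. x \<in> S \<Longrightarrow> dd (l x) = 0 \<and> x = cls (l x) \<and> n x > 0 \<and> exact_one_part (n x) (l x)" by metis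
  define N where "N = (\<Prod>x\<in>S. n x)"
  have N: "N > 0" unfolding N_def using l by (intro prod_pos) blast
  obtain q where q: "prime q" "q > N" using bigger_prime by blast
  then have "q > 0" by simp
  note tc = torsion_cocycle[OF this]
  have "cls (torsion_cocycle q) \<in> generate_ring HR S"
    unfolding S(3) E1_carrier using tc(2) by blast
  then obtain z where z: "dd z = 0" "exact_one_part N z" "cls (torsion_cocycle q) = cls z"
  proof (rule generate_ring_lift[where P = "exact_one_part N"])
    fix h assume h: "h \<in> S"
    have "n h dvd N" unfolding N_def using S(1) h by (rule dvd_prodI)
    then have "exact_one_part N (l h)" using l[OF h] exact_one_part_mult[of "n h" "l h"] by (metis dvd_def mult.commute)
    then show "\<exists>z. dd z = 0 \<and> exact_one_part N z \<and> h = cls z" using l[OF h] by blast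
  next
    show "exact_one_part N 1" unfolding exact_one_part_def by (intro exI[of _ 0]) simp
  next
    fix z assume "exact_one_part N z"
    then obtain w where "of_nat N * coef z {0} = opF w" "of_nat N * coef z {1} = opH w" "of_nat N * coef z {2} = opE w"
      unfolding exact_one_part_def by blast
    then show "exact_one_part N (- z)" unfolding exact_one_part_def by (intro exI[of _ "- w"]) (simp add: op_uminus)
  next
    fix z w assume "exact_one_part N z" "exact_one_part N w"
    then show "exact_one_part N (z + w)" by (rule exact_one_part_add)
  next
    fix z w :: "(3, int) E0"
    assume z: "dd z = 0" "exact_one_part N z" and w: "dd w = 0" "exact_one_part N w"
    have inv: "opE (coef u {}) = 0" "opF (coef u {}) = 0" "opH (coef u {}) = 0" if "dd u = 0" for u :: "(3, int) E0"
      using arg_cong[OF that, of "\<lambda>u. coef u {0}"] arg_cong[OF that, of "\<lambda>u. coef u {1}"] arg_cong[OF that, of "\<lambda>u. coef u {2}"]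
      by (simp_all add: coef_dd)
    from z(2) obtain a where a: "of_nat N * coef z {0} = opF a" "of_nat N * coef z {1} = opH a" "of_nat N * coef z {2} = opE a"
      unfolding exact_one_part_def by blast
    from w(2) obtain b where b: "of_nat N * coef w {0} = opF b" "of_nat N * coef w {1} = opH b" "of_nat N * coef w {2} = opE b"
      unfolding exact_one_part_def by blast
    show "exact_one_part N (z * w)"
      unfolding exact_one_part_def
      by (rule exI[of _ "coef z {} * b + coef w {} * a"])
        (simp add: coef_mult3 op_add op_mult inv[OF z(1)] inv[OF w(1)] a[symmetric] b[symmetric] algebra_simps)
  qed
  from z(3) obtain g where g: "torsion_cocycle q - z = dd g" unfolding cls_eq_iff by blast
  then have t: "torsion_cocycle q = z + dd g" by (simp add: algebra_simps)
  from z(2) obtain w where "of_nat N * coef z {1} = opH w" unfolding exact_one_part_def by blast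
  then have "of_nat N * coef (torsion_cocycle q) {1} = opH (w + of_nat N * coef g {})"
    by (simp add: t distrib_left coef_dd op_add op_of_nat_mult)
  from torsion_cocycle_exact[OF this \<open>q > 0\<close>] show False
    using q(2) N by (auto dest: dvd_imp_le)
qed

section \<open>Change of basis\<close>

text \<open>
  Isomorphisms of the bigraded differential algebras. They act on \<open>E1\<close> by taking images of cosets,
  and this action is compatible with all operations.
\<close>

locale E0_iso =
  fixes c c' :: "3 \<Rightarrow> 3 \<Rightarrow> 3 \<Rightarrow> 'k::comm_ring_1"
    and \<Psi> \<Psi>' :: "(3, 'k) E0 \<Rightarrow> (3, 'k) E0"
  assumes inv1: "\<Psi>' (\<Psi> z) = z" and inv2: "\<Psi> (\<Psi>' z) = z"
    and add: "\<Psi> (z + w) = \<Psi> z + \<Psi> w"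
    and mult: "\<Psi> (z * w) = \<Psi> z * \<Psi> w"
    and const: "\<Psi> (ext_const r) = ext_const r"
    and d: "d0 c' (\<Psi> z) = \<Psi> (d0 c z)"
    and comp: "z \<in> E0_comp s t \<Longrightarrow> \<Psi> z \<in> E0_comp s t" "z \<in> E0_comp s t \<Longrightarrow> \<Psi>' z \<in> E0_comp s t"
begin

lemma sym: "E0_iso c' c \<Psi>' \<Psi>"
proof
  show "\<Psi>' (z + w) = \<Psi>' z + \<Psi>' w" for z w by (metis add inv1 inv2)
  show "\<Psi>' (z * w) = \<Psi>' z * \<Psi>' w" for z w by (metis mult inv1 inv2)
  show "\<Psi>' (ext_const r) = ext_const r" for r by (metis const inv1)
  show "d0 c (\<Psi>' z) = \<Psi>' (d0 c' z)" for z by (metis d inv1 inv2)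
qed (simp_all add: inv1 inv2 comp del: One_nat_def)

lemma zero: "\<Psi> 0 = 0"
  using add[of 0 0] by simp

lemma one: "\<Psi> 1 = 1"
  using const[of 1] by (simp add: cst_ring emb_ring flip: emb_ring(6))

lemma cocycle: "d0 c' (\<Psi> z) = 0 \<longleftrightarrow> d0 c z = 0"
  by (metis d inv1 zero)

lemma range: "\<Psi> ` range (d0 c) = range (d0 c')"
proof -
  have "d0 c' w \<in> \<Psi> ` range (d0 c)" for w
    using d[of "\<Psi>' w"] by (simp add: inv2)
  moreover have "\<Psi> (d0 c w) \<in> range (d0 c')" for w using d[of w] by (metis rangeI)
  ultimately show ?thesis by blast
qed

abbreviation T :: "(3, 'k) E0 set \<Rightarrow> (3, 'k) E0 set" where "T X \<equiv> \<Psi> ` X"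

lemma T_class: "T (E1_class c z) = E1_class c' (\<Psi> z)"
  unfolding E1_class_alt range[symmetric] by (auto simp: add image_iff)

lemma T_inv: "\<Psi>' ` T X = X"
  by (auto simp: inv1 image_iff)

lemma T_add: "T (X \<oplus>\<^bsub>E1 c\<^esub> Y) = T X \<oplus>\<^bsub>E1 c'\<^esub> T Y"
proof -
  have e: "X \<oplus>\<^bsub>E1 c\<^esub> Y = (\<Union>a\<in>X. \<Union>b\<in>Y. {a + b})" for c and X Y :: "(3, 'k) E0 set"
    by (simp add: E1_def FactRing_def set_add_def set_mult_def cocycle_ring_def)
  show ?thesis unfolding e by (simp add: image_UN add)
qed

lemma T_mult: "T (X \<otimes>\<^bsub>E1 c\<^esub> Y) = T X \<otimes>\<^bsub>E1 c'\<^esub> T Y"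
proof -
  have e: "X \<otimes>\<^bsub>E1 c\<^esub> Y = (\<Union>a\<in>X. \<Union>b\<in>Y. E1_class c (a * b))" for c and X Y :: "(3, 'k) E0 set"
    by (simp add: E1_def FactRing_def rcoset_mult_def E1_class_def cocycle_ring_def)
  show ?thesis unfolding e by (simp add: image_UN T_class mult)
qed

lemma T_one: "T \<one>\<^bsub>E1 c\<^esub> = \<one>\<^bsub>E1 c'\<^esub>"
  unfolding E1_one T_class one ..

lemma T_zero: "T \<zero>\<^bsub>E1 c\<^esub> = \<zero>\<^bsub>E1 c'\<^esub>"
  by (simp add: E1_def FactRing_def range)

lemma T_class_image:
  assumes "\<Psi> ` A = B"
  shows "T ` (E1_class c ` A) = E1_class c' ` B"
  unfolding assms[symmetric] image_image T_class ..

lemma T_carrier: "T ` carrier (E1 c) = carrier (E1 c')"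
  unfolding E1_carrier
proof (rule T_class_image, safe)
  fix z assume "d0 c' z = 0"
  then show "z \<in> \<Psi> ` {z. d0 c z = 0}" using cocycle[of "\<Psi>' z"] by (auto simp: inv2 intro!: image_eqI[of _ _ "\<Psi>' z"])
qed (simp add: cocycle)

lemma T_comp: "T ` E1_comp c s t = E1_comp c' s t"
  unfolding E1_comp_def
proof (rule T_class_image, safe)
  fix z assume "z \<in> E0_comp s t" "d0 c' z = 0"
  then show "z \<in> \<Psi> ` {z \<in> E0_comp s t. d0 c z = 0}"
    using cocycle[of "\<Psi>' z"] by (intro image_eqI[of _ _ "\<Psi>' z"]) (auto simp: inv2 intro: comp simp del: One_nat_def)
qed (simp_all add: cocycle comp del: One_nat_def)

lemma T_inj: "inj T"
  by (metis T_inv injI)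

lemma T_ring_iso: "T \<in> ring_iso (E1 c) (E1 c')"
proof (rule ring_iso_memI)
  show "bij_betw T (carrier (E1 c)) (carrier (E1 c'))"
    using T_inj T_carrier by (auto simp: bij_betw_def intro: inj_on_subset)
qed (use T_carrier in \<open>auto simp: T_mult T_add T_one\<close>)

lemma ring_transfer: "ring (E1 c) \<Longrightarrow> ring (E1 c')"
  using ring.ring_iso_imp_img_ring[OF _ T_ring_iso] by (simp add: T_zero)

lemma T_ring_hom_ring: "ring (E1 c) \<Longrightarrow> ring_hom_ring (E1 c) (E1 c') T"
  using ring_transfer T_ring_iso by (auto intro!: ring_hom_ringI2 simp: ring_iso_def)

lemma T_generate:
  assumes "ring (E1 c)" "H \<subseteq> carrier (E1 c)" "x \<in> generate_ring (E1 c) H"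
  shows "T x \<in> generate_ring (E1 c') (T ` H)"
proof -
  interpret ring_hom_ring "E1 c" "E1 c'" T by (rule T_ring_hom_ring[OF assms(1)])
  from assms(3) show ?thesis
  proof (induction rule: generate_ring.induct)
    case one
    then show ?case unfolding T_one by (rule generate_ring.one)
  next
    case (incl h)
    then show ?case by (intro generate_ring.incl imageI)
  next
    case (a_inv h)
    then have "h \<in> carrier (E1 c)" using ring.generate_ring_in_carrier[OF assms(1,2)] by blast
    then have "T (\<ominus>\<^bsub>E1 c\<^esub> h) = \<ominus>\<^bsub>E1 c'\<^esub> T h" by (rule hom_a_inv)
    then show ?case using a_inv by (simp add: generate_ring.a_inv)
  next
    case (eng_add h1 h2)
    then show ?case unfolding T_add by (intro generate_ring.eng_add)
  next
    case (eng_mult h1 h2)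
    then show ?case unfolding T_mult by (intro generate_ring.eng_mult)
  qed
qed

lemma Luk_iso_transfer:
  assumes "Luk_iso_below n c" shows "Luk_iso_below n c'"
proof -
  from assms obtain \<phi> :: "(unit, unit, 'k) ext_poly \<Rightarrow> (3, 'k) E0 set" where
    bij: "\<forall>s<n. \<forall>t. bij_betw \<phi> (Luk_comp s t) (E1_comp c s t)" and
    add: "\<forall>s<n. \<forall>t. \<forall>a\<in>Luk_comp s t. \<forall>b\<in>Luk_comp s t. \<phi> (a + b) = \<phi> a \<oplus>\<^bsub>E1 c\<^esub> \<phi> b" and
    scal: "\<forall>s<n. \<forall>t. \<forall>r. \<forall>a\<in>Luk_comp s t. \<phi> (ext_const r * a) = E1_class c (ext_const r) \<otimes>\<^bsub>E1 c\<^esub> \<phi> a" and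
    one: "0 < n \<longrightarrow> \<phi> 1 = \<one>\<^bsub>E1 c\<^esub>" and
    mult: "\<forall>s t s' t'. s + s' < n \<longrightarrow> (\<forall>a\<in>Luk_comp s t. \<forall>b\<in>Luk_comp s' t'. \<phi> (a * b) = \<phi> a \<otimes>\<^bsub>E1 c\<^esub> \<phi> b)"
    unfolding Luk_iso_below_def by (elim exE conjE) rule
  show ?thesis
    unfolding Luk_iso_below_def
  proof (intro exI[of _ "\<lambda>a. T (\<phi> a)"] conjI allI impI ballI)
    fix s t assume "s < n"
    then have "bij_betw \<phi> (Luk_comp s t) (E1_comp c s t)" using bij by blast
    moreover have "bij_betw T (E1_comp c s t) (E1_comp c' s t)"
      using T_inj T_comp by (auto simp: bij_betw_def intro: inj_on_subset)
    ultimately show "bij_betw (\<lambda>a. T (\<phi> a)) (Luk_comp s t) (E1_comp c' s t)"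
      using bij_betw_trans by (fastforce simp: comp_def)
  next
    fix s t and a b :: "(unit, unit, 'k) ext_poly" assume "s < n" "a \<in> Luk_comp s t" "b \<in> Luk_comp s t"
    then show "T (\<phi> (a + b)) = T (\<phi> a) \<oplus>\<^bsub>E1 c'\<^esub> T (\<phi> b)" using add by (metis T_add)
  next
    fix s t r and a :: "(unit, unit, 'k) ext_poly" assume "s < n" "a \<in> Luk_comp s t"
    then show "T (\<phi> (ext_const r * a)) = E1_class c' (ext_const r) \<otimes>\<^bsub>E1 c'\<^esub> T (\<phi> a)"
      using scal by (metis T_mult T_class const)
  next
    assume "0 < n"
    then show "T (\<phi> 1) = \<one>\<^bsub>E1 c'\<^esub>" using one by (metis T_one)
  next
    fix s t s' t' and a b :: "(unit, unit, 'k) ext_poly" assume "s + s' < n" "a \<in> Luk_comp s t" "b \<in> Luk_comp s' t'"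
    then show "T (\<phi> (a * b)) = T (\<phi> a) \<otimes>\<^bsub>E1 c'\<^esub> T (\<phi> b)" using mult by (metis T_mult)
  qed
qed

lemma generates_transfer:
  assumes "ring (E1 c)" "generates_through c n S"
  shows "generates_through c' n (T ` S)"
proof -
  let ?k = "\<lambda>c :: 3 \<Rightarrow> 3 \<Rightarrow> 3 \<Rightarrow> 'k. range (\<lambda>a. E1_class c (ext_const a))"
  have S: "S \<subseteq> carrier (E1 c)" "\<And>s t. s \<le> n \<Longrightarrow> E1_comp c s t \<subseteq> generate_ring (E1 c) (S \<union> ?k c)"
    using assms(2) unfolding generates_through_def E1_alg_gen_def by blast+
  have "?k c \<subseteq> carrier (E1 c)" unfolding E1_carrier by (auto simp: d0_const)
  then have sub: "S \<union> ?k c \<subseteq> carrier (E1 c)" using S by blast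
  have im: "T ` (S \<union> ?k c) = T ` S \<union> ?k c'"
    by (simp add: image_Un image_image T_class const)
  have "E1_comp c' s t \<subseteq> generate_ring (E1 c') (T ` S \<union> ?k c')" if "s \<le> n" for s t
    unfolding T_comp[symmetric] im[symmetric]
    using S(2)[OF that] T_generate[OF assms(1) sub] by blast
  moreover have "T ` S \<subseteq> carrier (E1 c')" using S(1) T_carrier by blast
  ultimately show ?thesis unfolding generates_through_def E1_alg_gen_def by blast
qed

lemma torsion_transfer:
  assumes "has_torsion (E1 c) q" shows "has_torsion (E1 c') q"
proof -
  obtain x where x: "x \<in> carrier (E1 c)" "x \<noteq> \<zero>\<^bsub>E1 c\<^esub>" "[q] \<cdot>\<^bsub>E1 c\<^esub> x = \<zero>\<^bsub>E1 c\<^esub>"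
    using assms unfolding has_torsion_def by blast
  have "T ([n] \<cdot>\<^bsub>E1 c\<^esub> x) = [n] \<cdot>\<^bsub>E1 c'\<^esub> T x" for n :: nat
    by (induction n) (simp_all add: add_pow_def nat_pow_def T_zero T_add)
  then have "[q] \<cdot>\<^bsub>E1 c'\<^esub> T x = \<zero>\<^bsub>E1 c'\<^esub>" using x(3) T_zero by metis
  moreover have "T x \<noteq> \<zero>\<^bsub>E1 c'\<^esub>" using x(2) T_zero T_inv by metis
  moreover have "T x \<in> carrier (E1 c')" using x(1) T_carrier by blast
  ultimately show ?thesis unfolding has_torsion_def by (intro bexI[of _ "T x"] conjI)
qed

lemma fin_gen_transfer:
  assumes "ring (E1 c)" "fin_gen_ring (E1 c)" shows "fin_gen_ring (E1 c')"
proof -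
  obtain S where S: "finite S" "S \<subseteq> carrier (E1 c)" "generate_ring (E1 c) S = carrier (E1 c)"
    using assms(2) unfolding fin_gen_ring_def by blast
  have sub: "T ` S \<subseteq> carrier (E1 c')" using S(2) T_carrier by blast
  have "carrier (E1 c') \<subseteq> generate_ring (E1 c') (T ` S)"
    unfolding T_carrier[symmetric] using T_generate[OF assms(1) S(2)] S(3) by blast
  moreover have "generate_ring (E1 c') (T ` S) \<subseteq> carrier (E1 c')"
    by (rule ring.generate_ring_incl[OF ring_transfer[OF assms(1)] sub])
  ultimately show ?thesis unfolding fin_gen_ring_def using S(1) sub by (intro exI[of _ "T ` S"]) auto
qed

end

text \<open>The endomorphism of \<open>E0\<close> induced by a linear substitution of the variables.\<close>

context
  fixes A :: "3 \<Rightarrow> 3 \<Rightarrow> 'k::comm_ring_1"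
begin

definition lin_y :: "3 \<Rightarrow> 'k pol3" where
  "lin_y l = cst (A l 0) * va + cst (A l 1) * vb + cst (A l 2) * vc"

definition lin_x :: "3 \<Rightarrow> (3, 'k) E0" where
  "lin_x l = ext_const (A l 0) * gen_x 0 + ext_const (A l 1) * gen_x 1 + ext_const (A l 2) * gen_x 2"

definition psubst :: "'k pol3 \<Rightarrow> 'k pol3" where
  "psubst q = (\<Sum>m\<in>Poly_Mapping.keys q. cst (Poly_Mapping.lookup q m) *
     (lin_y 0 ^ Poly_Mapping.lookup m 0 * lin_y 1 ^ Poly_Mapping.lookup m 1 * lin_y 2 ^ Poly_Mapping.lookup m 2))"

lemma psubst_mon: "psubst (mon x y z r) = cst r * (lin_y 0 ^ x * lin_y 1 ^ y * lin_y 2 ^ z)"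
  by (simp add: psubst_def cst_ring)

lemma psubst_add: "psubst (q + r) = psubst q + psubst r"
proof -
  let ?A = "Poly_Mapping.keys q \<union> Poly_Mapping.keys r"
  let ?m = "\<lambda>m. lin_y 0 ^ Poly_Mapping.lookup m 0 * lin_y 1 ^ Poly_Mapping.lookup m 1 * lin_y 2 ^ Poly_Mapping.lookup m 2"
  have sup: "psubst f = (\<Sum>m\<in>?A. cst (Poly_Mapping.lookup f m) * ?m m)"
    if "Poly_Mapping.keys f \<subseteq> ?A" for f
    unfolding psubst_def using that by (intro sum.mono_neutral_left) (auto simp: in_keys_iff cst_ring)
  have "Poly_Mapping.keys (q + r) \<subseteq> ?A" by (auto simp: in_keys_iff lookup_add)
  then show ?thesis
    using sup[of q] sup[of r] sup[of "q + r"]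
    by (simp add: lookup_add cst_ring distrib_right sum.distrib)
qed

lemma psubst_mult: "psubst (q * r) = psubst q * psubst r"
proof (induction q rule: pol3_induct)
  case (mon x y z a)
  show ?case
  proof (induction r rule: pol3_induct)
    case (mon x' y' z' b)
    show ?case by (simp add: mon_mult psubst_mon power_add cst_ring mult_ac)
  qed (simp add: distrib_left psubst_add)
qed (simp add: distrib_right psubst_add)

lemma psubst_0 [simp]: "psubst 0 = 0"
  by (simp add: psubst_def)

lemma psubst_basic: "psubst (cst r) = cst r" "psubst va = lin_y 0" "psubst vb = lin_y 1" "psubst vc = lin_y 2"
  unfolding cst_def va_def vb_def vc_def psubst_mon by (simp_all add: cst_def expo_0)

lemma psubst_const [simp]: "psubst 1 = 1" "psubst (numeral n) = numeral n"
  using psubst_basic(1)[of 1] psubst_basic(1)[of "numeral n"] by (simp_all add: cst_ring cst_numeral)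

lemma psubst_uminus: "psubst (- q) = - psubst q"
  using psubst_add[of q "- q"] by (simp add: minus_unique)

lemma homog_power: "homog 1 q \<Longrightarrow> homog n (q ^ n :: 'k pol3)"
  by (induction n) (use homog_mult[of 1 q] in auto)

lemma homog_lin_y: "homog 1 (lin_y l)"
  unfolding lin_y_def by (intro homog_add homog_cst_mult homog_basic)

lemma homog_psubst: "homog s q \<Longrightarrow> homog s (psubst q)"
proof (induction rule: homog_induct)
  case (mon x y z r)
  have "homog (x + y + z) (lin_y 0 ^ x * lin_y 1 ^ y * lin_y 2 ^ z)"
    by (intro homog_mult homog_power homog_lin_y)
  then show ?case using mon by (simp add: psubst_mon homog_cst_mult)
qed (auto simp: psubst_add intro: homog_add)

definition esubst :: "(3, 'k) E0 \<Rightarrow> (3, 'k) E0" where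
  "esubst f = emb (psubst (coef f {})) + lin_x 0 * emb (psubst (coef f {0})) + lin_x 1 * emb (psubst (coef f {1})) +
     lin_x 2 * emb (psubst (coef f {2})) + lin_x 0 * (lin_x 1 * emb (psubst (coef f {0, 1}))) +
     lin_x 0 * (lin_x 2 * emb (psubst (coef f {0, 2}))) + lin_x 1 * (lin_x 2 * emb (psubst (coef f {1, 2}))) +
     lin_x 0 * (lin_x 1 * (lin_x 2 * emb (psubst (coef f {0, 1, 2}))))"

lemma coef_lin_x [simp]: "coef (lin_x l) {} = 0" "coef (lin_x l) {0} = cst (A l 0)" "coef (lin_x l) {1} = cst (A l 1)"
   "coef (lin_x l) {2} = cst (A l 2)"
  "coef (lin_x l) {0, 1} = 0" "coef (lin_x l) {0, 2} = 0" "coef (lin_x l) {1, 2} = 0" "coef (lin_x l) {0, 1, 2} = 0"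
  by (simp_all add: lin_x_def coef_const_mult3)

lemma coef_emb3 [simp]: "coef (emb q) {} = q" "coef (emb q) (insert i S) = 0"
  by (simp_all add: coef_emb)

lemma coef_esubst:
  "coef (esubst f) {} = psubst (coef f {})"
  "coef (esubst f) {0} = cst (A 0 0) * psubst (coef f {0}) + cst (A 1 0) * psubst (coef f {1}) + cst (A 2 0) * psubst (coef f {2})"
  "coef (esubst f) {1} = cst (A 0 1) * psubst (coef f {0}) + cst (A 1 1) * psubst (coef f {1}) + cst (A 2 1) * psubst (coef f {2})"
  "coef (esubst f) {2} = cst (A 0 2) * psubst (coef f {0}) + cst (A 1 2) * psubst (coef f {1}) + cst (A 2 2) * psubst (coef f {2})"
  "coef (esubst f) {0, 1} = (cst (A 0 0) * cst (A 1 1) - cst (A 0 1) * cst (A 1 0)) * psubst (coef f {0, 1}) +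
     (cst (A 0 0) * cst (A 2 1) - cst (A 0 1) * cst (A 2 0)) * psubst (coef f {0, 2}) +
     (cst (A 1 0) * cst (A 2 1) - cst (A 1 1) * cst (A 2 0)) * psubst (coef f {1, 2})"
  "coef (esubst f) {0, 2} = (cst (A 0 0) * cst (A 1 2) - cst (A 0 2) * cst (A 1 0)) * psubst (coef f {0, 1}) +
     (cst (A 0 0) * cst (A 2 2) - cst (A 0 2) * cst (A 2 0)) * psubst (coef f {0, 2}) +
     (cst (A 1 0) * cst (A 2 2) - cst (A 1 2) * cst (A 2 0)) * psubst (coef f {1, 2})"
  "coef (esubst f) {1, 2} = (cst (A 0 1) * cst (A 1 2) - cst (A 0 2) * cst (A 1 1)) * psubst (coef f {0, 1}) +
     (cst (A 0 1) * cst (A 2 2) - cst (A 0 2) * cst (A 2 1)) * psubst (coef f {0, 2}) +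
     (cst (A 1 1) * cst (A 2 2) - cst (A 1 2) * cst (A 2 1)) * psubst (coef f {1, 2})"
  "\<exists>t. coef (esubst f) {0, 1, 2} = t * psubst (coef f {0, 1, 2}) \<and> homog 0 t"
proof -
  show "\<exists>t. coef (esubst f) {0, 1, 2} = t * psubst (coef f {0, 1, 2}) \<and> homog 0 t"
    by (rule exI[of _ "cst (A 0 0 * (A 1 1 * A 2 2 - A 1 2 * A 2 1) -
      A 0 1 * (A 1 0 * A 2 2 - A 1 2 * A 2 0) + A 0 2 * (A 1 0 * A 2 1 - A 1 1 * A 2 0))"], rule conjI[OF _ homog_basic(1)])
      (simp add: esubst_def coef_mult3 cst_ring algebra_simps)
qed (simp_all add: esubst_def coef_mult3 algebra_simps)

lemma lin_x_anti: "lin_x l * lin_x l = 0" "lin_x l * lin_x m = - (lin_x m * lin_x l)"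
  by (rule ext3_eqI; simp add: coef_mult3 mult_ac)+

lemma esubst_add: "esubst (f + g) = esubst f + esubst g"
  by (simp add: esubst_def psubst_add emb_ring distrib_left add_ac)

lemma esubst_const_mult: "esubst (ext_const r * f) = ext_const r * esubst f"
proof -
  have e: "lin_x l * (ext_const r * z) = ext_const r * (lin_x l * z)" for l z
    by (metis ext_const_commute mult.assoc)
  show ?thesis
    unfolding esubst_def coef_const_mult3 psubst_mult psubst_basic emb_ring e distrib_left ..
qed

lemma esubst_gen_y_mult: "esubst (gen_y j * f) = emb (lin_y j) * esubst f"
proof -
  have e: "lin_x l * (emb q * z) = emb q * (lin_x l * z)" for l q z
    by (metis emb_commute mult.assoc)
  have c: "psubst (coef (gen_y j * f) U) = lin_y j * psubst (coef f U)" for U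
    by (rule three_cases[of j]; hypsubst; simp only: coef_gen_y_mult var_eq_single psubst_mult psubst_basic)
  show ?thesis unfolding esubst_def c emb_ring e distrib_left ..
qed

lemma esubst_gen_x_mult: "esubst (gen_x j * f) = lin_x j * esubst f"
proof -
  have a1: "lin_x l * (lin_x l * z) = 0" for l z
    by (simp add: lin_x_anti(1) flip: mult.assoc)
  have a2: "lin_x 1 * (lin_x 0 * z) = - (lin_x 0 * (lin_x 1 * z))"
    "lin_x 2 * (lin_x 0 * z) = - (lin_x 0 * (lin_x 2 * z))"
    "lin_x 2 * (lin_x 1 * z) = - (lin_x 1 * (lin_x 2 * z))" for z
    by (simp_all add: lin_x_anti(2)[of 1 0] lin_x_anti(2)[of 2 0] lin_x_anti(2)[of 2 1] flip: mult.assoc)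
  show ?thesis
    by (rule three_cases[of j])
      (simp_all add: esubst_def coef_gen_x_mult inv_sign_insert2 inv_sign_single insert_Diff_if
        psubst_uminus emb_ring distrib_left a1 a2)
qed

lemma esubst_const: "esubst (ext_const r) = ext_const r"
  by (simp add: esubst_def psubst_basic emb_ring)

lemma esubst_mult: "esubst (f * g) = esubst f * esubst g"
proof (induction f rule: ext_poly_induct)
  case (const r)
  then show ?case by (simp add: esubst_const_mult esubst_const)
next
  case (add f f')
  then show ?case by (simp add: distrib_right esubst_add)
next
  case (gen_x i f)
  then show ?case by (simp add: mult.assoc esubst_gen_x_mult)
next
  case (gen_y i f)
  then show ?case by (simp add: mult.assoc esubst_gen_y_mult)
qed

lemma esubst_gen: "esubst (gen_x l) = lin_x l" "esubst (gen_y l) = emb (lin_y l)"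
proof -
  have "esubst 1 = 1" using esubst_const[of 1] by (simp add: cst_ring emb_ring flip: emb_ring(6))
  then show "esubst (gen_x l) = lin_x l" "esubst (gen_y l) = emb (lin_y l)"
    using esubst_gen_x_mult[of l 1] esubst_gen_y_mult[of l 1] by simp_all
qed

lemma esubst_comp:
  assumes z: "z \<in> E0_comp s t"
  shows "esubst z \<in> E0_comp s t"
proof -
  from z have h: "homog s (coef z S)" and c: "card S \<noteq> t \<Longrightarrow> coef z S = 0" for S
    unfolding E0_comp_iff hodge_def by blast+
  obtain k where k: "coef (esubst z) {0, 1, 2} = k * psubst (coef z {0, 1, 2})" "homog 0 k"
    using coef_esubst(8) by blast
  have m: "homog s (cst r * cst r' * q)" if "homog s q" for r r' q
    using that by (simp add: mult.assoc homog_cst_mult)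
  have "homog s (coef (esubst z) S) \<and> (card S \<noteq> t \<longrightarrow> coef (esubst z) S = 0)" for S
  proof (rule subsets_three[of S]; hypsubst)
    show "homog s (coef (esubst z) {0, 1, 2}) \<and> (card {0, 1, 2 :: 3} \<noteq> t \<longrightarrow> coef (esubst z) {0, 1, 2} = 0)"
      using homog_mult[OF k(2) homog_psubst[OF h[of "{0, 1, 2}"]]] c[of "{0, 1, 2}"] unfolding k(1) by simp
  qed (use c[of "{}"] c[of "{0}"] c[of "{1}"] c[of "{2}"] c[of "{0, 1}"] c[of "{0, 2}"] c[of "{1, 2}"] in
    \<open>auto simp: coef_esubst left_diff_distrib intro!: homog_add homog_diff homog_cst_mult homog_psubst m h\<close>)
  then show ?thesis unfolding E0_comp_iff hodge_def by blast
qed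

end

lemma sum_three: "(\<Sum>i\<in>UNIV. f i) = f 0 + f 1 + f (2::3)" for f :: "3 \<Rightarrow> 'a::comm_monoid_add"
  unfolding UNIV_three by (simp add: add_ac)

lemma lin_y_comp: "psubst B (lin_y A l) = lin_y (\<lambda>l i. \<Sum>m\<in>UNIV. A l m * B m i) l"
  by (simp add: lin_y_def[of A] psubst_add psubst_mult psubst_basic)
    (simp add: lin_y_def sum_three cst_ring algebra_simps)

lemma lin_x_comp: "esubst B (lin_x A l) = lin_x (\<lambda>l i. \<Sum>m\<in>UNIV. A l m * B m i) l"
proof -
  have "esubst B (lin_x A l) = ext_const (A l 0) * lin_x B 0 + ext_const (A l 1) * lin_x B 1 + ext_const (A l 2) * lin_x B 2"
    unfolding lin_x_def[of A] esubst_add esubst_const_mult esubst_gen ..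
  also have "\<dots> = lin_x (\<lambda>l i. \<Sum>m\<in>UNIV. A l m * B m i) l"
    by (rule ext3_eqI) (simp_all add: coef_const_mult3 sum_three cst_ring add_ac)
  finally show ?thesis .
qed

text \<open>
  Substitutions compose like matrices.
\<close>

lemma esubst_inverse:
  fixes A B :: "3 \<Rightarrow> 3 \<Rightarrow> 'k::comm_ring_1"
  assumes "\<And>l i. (\<Sum>m\<in>UNIV. A l m * B m i) = (if l = i then 1 else 0)"
  shows "esubst B (esubst A f) = f"
proof (induction f rule: ext_poly_induct)
  case (const r)
  then show ?case by (simp add: esubst_const)
next
  case (add f g)
  then show ?case by (simp add: esubst_add)
next
  case (gen_x i f)
  have "esubst B (lin_x A i) = gen_x i"
    unfolding lin_x_comp assms by (rule three_cases[of i]; hypsubst; intro ext3_eqI; simp add: cst_ring)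
  then show ?case unfolding esubst_gen_x_mult esubst_mult[of B] gen_x by simp
next
  case (gen_y j f)
  have "psubst B (lin_y A j) = coef (gen_y j :: (3, 'k) E0) {}"
    unfolding lin_y_comp assms by (rule three_cases[of j]; hypsubst; simp add: lin_y_def cst_ring)
  moreover have "emb (coef (gen_y j :: (3, 'k) E0) {}) = (gen_y j :: (3, 'k) E0)"
    by (intro ext3_eqI) simp_all
  moreover have "esubst B (emb q) = emb (psubst B q)" for q
    by (simp add: esubst_def emb_ring)
  ultimately show ?case unfolding esubst_gen_y_mult esubst_mult[of B] gen_y by simp
qed

lemma coef_dgen_x3:
  fixes c :: "3 \<Rightarrow> 3 \<Rightarrow> 3 \<Rightarrow> 'k::comm_ring_1"
  shows
  "coef (dgen_x c i) {} = 0" "coef (dgen_x c i) {j} = 0"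
  "coef (dgen_x c i) {0, 1} = - cst (c 0 1 i)" "coef (dgen_x c i) {0, 2} = - cst (c 0 2 i)"
  "coef (dgen_x c i) {1, 2} = - cst (c 1 2 i)" "coef (dgen_x c i) {0, 1, 2} = 0"
  unfolding dgen_x_def sum_three by (simp_all add: greaterThan_three coef_mult3)

lemma coef_dgen_y3:
  fixes c :: "3 \<Rightarrow> 3 \<Rightarrow> 3 \<Rightarrow> 'k::comm_ring_1"
  shows
  "coef (dgen_y c i) {} = 0"
  "coef (dgen_y c i) {k} = cst (c 0 k i) * va + cst (c 1 k i) * vb + cst (c 2 k i) * vc"
  "coef (dgen_y c i) {0, 1} = 0" "coef (dgen_y c i) {0, 2} = 0"
  "coef (dgen_y c i) {1, 2} = 0" "coef (dgen_y c i) {0, 1, 2} = 0"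
  unfolding dgen_y_def sum_three by (simp_all add: coef_mult3) (rule three_cases[of k]; simp)

text \<open>
  The rows \<open>M j\<close> are the coordinates of a basis of \<open>sl\<^sub>2\<close> with respect to \<open>f, h, e\<close>, and the right-hand
  side of \<open>key\<close> is the bracket in these coordinates: \<open>key\<close> says that \<open>c\<close> consists of the structure
  constants of this basis.
\<close>

lemma esubst_dgen_x:
  fixes M :: "3 \<Rightarrow> 3 \<Rightarrow> 'k::comm_ring_1"
  assumes key: "\<And>j k l. (\<Sum>i\<in>UNIV. c j k i * M i l) =
    (if l = 0 then 2 * (M j 0 * M k 1 - M j 1 * M k 0) else if l = 1 then M j 2 * M k 0 - M j 0 * M k 2
     else 2 * (M j 1 * M k 2 - M j 2 * M k 1))"
  defines "A \<equiv> \<lambda>l i. M i l"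
  shows "d0 c (lin_x A l) = esubst A (dgen_x sl2c l)"
proof -
  have k: "cst (A l 0) * cst (c j k 0) + cst (A l 1) * cst (c j k 1) + cst (A l 2) * cst (c j k 2) =
    cst (\<Sum>i\<in>UNIV. c j k i * M i l)" for j k
    unfolding sum_three A_def cst_ring by (simp add: mult_ac)
  let ?L = "ext_const (A l 0) * dgen_x c 0 + ext_const (A l 1) * dgen_x c 1 + ext_const (A l 2) * dgen_x c 2 :: (3, 'k) E0"
  have L: "coef ?L {} = 0" "coef ?L {0} = 0" "coef ?L {1} = 0" "coef ?L {2} = 0" "coef ?L {0, 1, 2} = 0"
    "coef ?L {0, 1} = - cst (\<Sum>i\<in>UNIV. c 0 1 i * M i l)"
    "coef ?L {0, 2} = - cst (\<Sum>i\<in>UNIV. c 0 2 i * M i l)"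
    "coef ?L {1, 2} = - cst (\<Sum>i\<in>UNIV. c 1 2 i * M i l)"
    unfolding k[symmetric] by (simp_all add: coef_const_mult3 coef_dgen_x3)
  let ?D = "dgen_x sl2c l :: (3, 'k) E0"
  have D: "coef ?D {} = 0" "coef ?D {0} = 0" "coef ?D {1} = 0" "coef ?D {2} = 0" "coef ?D {0, 1, 2} = 0"
    "coef ?D {0, 1} = - cst (sl2c 0 1 l)" "coef ?D {0, 2} = - cst (sl2c 0 2 l)"
    "coef ?D {1, 2} = - cst (sl2c 1 2 l)"
    by (simp_all add: coef_dgen_x3)
  have "d0 c (lin_x A l) = ?L"
    unfolding lin_x_def d0_add d0_const_mult d0_gen_x ..
  also have "\<dots> = esubst A ?D"
  proof (rule ext3_eqI)
    show "coef ?L {0, 1, 2} = coef (esubst A ?D) {0, 1, 2}"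
      using coef_esubst(8)[of A ?D] unfolding L D by auto
    show "coef ?L {0, 1} = coef (esubst A ?D) {0, 1}" "coef ?L {0, 2} = coef (esubst A ?D) {0, 2}"
      "coef ?L {1, 2} = coef (esubst A ?D) {1, 2}"
      unfolding L coef_esubst D key
      by (rule three_cases[of l]; hypsubst;
        simp add: A_def psubst_uminus psubst_basic cst_ring cst_numeral algebra_simps; fail)+
    show "coef ?L {} = coef (esubst A ?D) {}" "coef ?L {0} = coef (esubst A ?D) {0}"
      "coef ?L {1} = coef (esubst A ?D) {1}" "coef ?L {2} = coef (esubst A ?D) {2}"
      unfolding L coef_esubst D psubst_0 by simp_all
  qed
  finally show ?thesis .
qed

lemma esubst_dgen_y:
  fixes M :: "3 \<Rightarrow> 3 \<Rightarrow> 'k::comm_ring_1"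
  assumes key: "\<And>j k l. (\<Sum>i\<in>UNIV. c j k i * M i l) =
    (if l = 0 then 2 * (M j 0 * M k 1 - M j 1 * M k 0) else if l = 1 then M j 2 * M k 0 - M j 0 * M k 2
     else 2 * (M j 1 * M k 2 - M j 2 * M k 1))"
  defines "A \<equiv> \<lambda>l i. M i l"
  shows "d0 c (emb (lin_y A l)) = esubst A (dgen_y sl2c l)"
proof -
  let ?L = "ext_const (A l 0) * dgen_y c 0 + ext_const (A l 1) * dgen_y c 1 + ext_const (A l 2) * dgen_y c 2 :: (3, 'k) E0"
  have L: "coef ?L {} = 0" "coef ?L {0, 1} = 0" "coef ?L {0, 2} = 0" "coef ?L {1, 2} = 0" "coef ?L {0, 1, 2} = 0"
    by (simp_all add: coef_const_mult3 coef_dgen_y3)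
  have L1: "coef ?L {k} = cst (\<Sum>i\<in>UNIV. c 0 k i * M i l) * va + cst (\<Sum>i\<in>UNIV. c 1 k i * M i l) * vb +
      cst (\<Sum>i\<in>UNIV. c 2 k i * M i l) * vc" for k
    unfolding coef_const_mult3 coef_dgen_y3 plus_ext_poly.rep_eq sum_three cst_ring A_def by (simp only: algebra_simps)
  have v: "psubst A (cst r * va + cst r' * vb + cst r'' * vc) =
    cst r * lin_y A 0 + cst r' * lin_y A 1 + cst r'' * lin_y A 2" for r r' r''
    by (simp add: psubst_add psubst_mult psubst_basic)
  let ?D = "dgen_y sl2c l :: (3, 'k) E0"
  have D: "coef ?D {0, 1} = 0" "coef ?D {0, 2} = 0" "coef ?D {1, 2} = 0" "coef ?D {0, 1, 2} = 0" "coef ?D {} = 0"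
    by (simp_all add: coef_dgen_y3)
  have "emb (lin_y A l) = ext_const (A l 0) * gen_y 0 + ext_const (A l 1) * gen_y 1 + ext_const (A l 2) * gen_y 2"
    by (rule ext3_eqI) (simp_all add: lin_y_def coef_const_mult3)
  then have "d0 c (emb (lin_y A l)) = ?L"
    by (simp only: d0_add d0_const_mult d0_gen_y)
  also have "\<dots> = esubst A ?D"
  proof (rule ext3_eqI)
    show "coef ?L {0, 1, 2} = coef (esubst A ?D) {0, 1, 2}"
      using coef_esubst(8)[of A ?D] unfolding L D by auto
    show "coef ?L {0} = coef (esubst A ?D) {0}"
      unfolding L1 coef_esubst coef_dgen_y3 v key
      by (rule three_cases[of l]; hypsubst; simp add: lin_y_def A_def cst_ring cst_numeral algebra_simps)
    show "coef ?L {1} = coef (esubst A ?D) {1}"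
      unfolding L1 coef_esubst coef_dgen_y3 v key
      by (rule three_cases[of l]; hypsubst; simp add: lin_y_def A_def cst_ring cst_numeral algebra_simps)
    show "coef ?L {2} = coef (esubst A ?D) {2}"
      unfolding L1 coef_esubst coef_dgen_y3 v key
      by (rule three_cases[of l]; hypsubst; simp add: lin_y_def A_def cst_ring cst_numeral algebra_simps)
    show "coef ?L {} = coef (esubst A ?D) {}" "coef ?L {0, 1} = coef (esubst A ?D) {0, 1}"
      "coef ?L {0, 2} = coef (esubst A ?D) {0, 2}" "coef ?L {1, 2} = coef (esubst A ?D) {1, 2}"
      unfolding L coef_esubst D psubst_0 by simp_all
  qed
  finally show ?thesis .
qed

text \<open>
  Both sides are twisted derivations along the substitution, so it is enough to compare them on generators.
\<close>

lemma esubst_d0: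
  fixes M :: "3 \<Rightarrow> 3 \<Rightarrow> 'k::comm_ring_1"
  assumes key: "\<And>j k l. (\<Sum>i\<in>UNIV. c j k i * M i l) =
    (if l = 0 then 2 * (M j 0 * M k 1 - M j 1 * M k 0) else if l = 1 then M j 2 * M k 0 - M j 0 * M k 2
     else 2 * (M j 1 * M k 2 - M j 2 * M k 1))"
  defines "A \<equiv> \<lambda>l i. M i l"
  shows "d0 c (esubst A f) = esubst A (dd f)"
proof (induction f rule: ext_poly_induct)
  case (const r)
  then show ?case by (simp add: esubst_const d0_const) (simp add: esubst_def emb_ring)
next
  case (add f g)
  then show ?case by (simp add: esubst_add d0_add)
next
  case (gen_x l f)
  have "ext_parity (lin_x A l) = - lin_x A l"
    by (rule ext3_eqI) (simp_all add: coef_parity3)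
  moreover have "d0 c (lin_x A l) = esubst A (dgen_x sl2c l)"
    unfolding A_def by (rule esubst_dgen_x[OF key])
  moreover have "esubst A (- z) = - esubst A z" for z
    using esubst_add[of A z "- z"] esubst_add[of A 0 0] by (simp add: minus_unique)
  ultimately show ?case
    unfolding esubst_gen_x_mult d0_mult[of c] gen_x d0_gen_x_mult diff_conv_add_uminus esubst_add esubst_mult
    by (simp add: esubst_mult esubst_gen)
next
  case (gen_y l f)
  have "ext_parity (emb (lin_y A l)) = emb (lin_y A l)"
    by (rule ext3_eqI) (simp_all add: coef_parity3)
  moreover have "d0 c (emb (lin_y A l)) = esubst A (dgen_y sl2c l)"
    unfolding A_def by (rule esubst_dgen_y[OF key])
  ultimately show ?case
    unfolding esubst_gen_y_mult d0_mult[of c] gen_y d0_gen_y_mult esubst_add esubst_mult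
    by (simp add: esubst_gen)
qed

section \<open>Arbitrary bases\<close>

text \<open>
  The coordinates of a matrix in \<open>sl\<^sub>2\<close> with respect to \<open>f, h, e\<close>.
\<close>

definition entry :: "'k::comm_ring_1^2^2 \<Rightarrow> 3 \<Rightarrow> 'k" where
  "entry X l = (if l = 0 then X $ 2 $ 1 else if l = 1 then X $ 1 $ 1 else X $ 1 $ 2)"

lemma sl2_trace: "X \<in> sl2 \<longleftrightarrow> X $ 2 $ 2 = - (X $ 1 $ 1)"
  by (auto simp: sl2_def trace_def sum_2 add_eq_0_iff)

lemma sl2_eqI:
  assumes "X \<in> sl2" "Y \<in> sl2" "\<And>l. entry X l = entry Y l"
  shows "X = Y"
  using assms(1,2) assms(3)[of 0] assms(3)[of 1] assms(3)[of 2]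
  by (simp add: entry_def vec_eq_iff forall_2 sl2_trace)

lemma entry_lin_comb: "entry (lin_comb a e) l = (\<Sum>i\<in>UNIV. a i * entry (e i) l)"
  by (simp add: entry_def lin_comb_def)

lemma lin_comb_sl2:
  assumes "range e \<subseteq> sl2" shows "lin_comb a e \<in> sl2"
proof -
  have "e k $ 2 $ 2 = - (e k $ 1 $ 1)" for k using assms sl2_trace by blast
  then show ?thesis by (simp add: sl2_trace lin_comb_def sum_negf)
qed

lemma entry_lie_bracket:
  assumes "X \<in> sl2" "Y \<in> sl2"
  shows "entry (lie_bracket X Y) l =
    (if l = 0 then 2 * (entry X 0 * entry Y 1 - entry X 1 * entry Y 0)
     else if l = 1 then entry X 2 * entry Y 0 - entry X 0 * entry Y 2
     else 2 * (entry X 1 * entry Y 2 - entry X 2 * entry Y 1))"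
proof -
  have "X $ 2 $ 2 = - (X $ 1 $ 1)" "Y $ 2 $ 2 = - (Y $ 1 $ 1)" using assms by (simp_all add: sl2_trace)
  then show ?thesis
    by (simp add: entry_def lie_bracket_def matrix_matrix_mult_def sum_2 algebra_simps)
qed

lemma sum_mult_delta:
  fixes a :: "'n::finite \<Rightarrow> 'k::comm_ring_1"
  shows "(\<Sum>i\<in>UNIV. a i * (if i = l then 1 else 0)) = a l" "(\<Sum>i\<in>UNIV. (if l = i then 1 else 0) * a i) = a l"
proof -
  have "a i * (if i = l then 1 else 0) = (if i = l then a i else 0)"
    "(if l = i then 1 else 0) * a i = (if i = l then a i else 0)" for i by auto
  then show "(\<Sum>i\<in>UNIV. a i * (if i = l then 1 else 0)) = a l" "(\<Sum>i\<in>UNIV. (if l = i then 1 else 0) * a i) = a l"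
    by (simp_all only: sum.delta finite UNIV_I if_True)
qed

lemma dual_basis_exists:
  fixes e :: "3 \<Rightarrow> 'k::comm_ring_1^2^2"
  assumes "sl2_basis e"
  obtains N where "\<And>l k. (\<Sum>i\<in>UNIV. N l i * entry (e i) k) = (if l = k then 1 else 0)"
    "\<And>l k. (\<Sum>m\<in>UNIV. entry (e l) m * N m k) = (if l = k then 1 else 0)"
proof -
  have e: "range e \<subseteq> sl2" and ex1: "\<And>A. A \<in> sl2 \<Longrightarrow> \<exists>!a. A = lin_comb a e"
    using assms unfolding sl2_basis_def by blast+
  have "\<exists>a. \<forall>k. (\<Sum>i\<in>UNIV. a i * entry (e i) k) = (if l = k then 1 else 0)" for l
  proof -
    define s :: "'k^2^2" where "s = vector [vector [if l = 1 then 1 else 0, if l = 2 then 1 else 0],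
      vector [if l = 0 then 1 else 0, if l = 1 then - 1 else 0]]"
    have s: "entry s k = (if l = k then 1 else 0)" for k
      by (rule three_cases[of k]; hypsubst; simp add: s_def entry_def vector_2)
    have "s \<in> sl2" by (simp add: s_def sl2_trace vector_2)
    then obtain a where "s = lin_comb a e" using ex1 by blast
    then show ?thesis using s entry_lin_comb by metis
  qed
  then obtain N where N: "\<And>l k. (\<Sum>i\<in>UNIV. N l i * entry (e i) k) = (if l = k then 1 else 0)"
    by metis
  have "(\<Sum>m\<in>UNIV. entry (e l) m * N m k) = (if l = k then 1 else 0)" for l k
  proof -
    \<comment> \<open>Both sides are the coefficients of \<open>e l\<close> in the basis \<open>e\<close>.\<close>
    have "e l = lin_comb (\<lambda>k. \<Sum>m\<in>UNIV. entry (e l) m * N m k) e"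
    proof (rule sl2_eqI)
      fix j
      have "entry (lin_comb (\<lambda>k. \<Sum>m\<in>UNIV. entry (e l) m * N m k) e) j =
          (\<Sum>k\<in>UNIV. \<Sum>m\<in>UNIV. entry (e l) m * (N m k * entry (e k) j))"
        by (simp add: entry_lin_comb sum_distrib_right mult.assoc)
      also have "\<dots> = (\<Sum>m\<in>UNIV. entry (e l) m * (\<Sum>k\<in>UNIV. N m k * entry (e k) j))"
        by (subst sum.swap) (simp add: sum_distrib_left)
      also have "\<dots> = entry (e l) j"
        unfolding N by (rule sum_mult_delta)
      finally show "entry (e l) j = entry (lin_comb (\<lambda>k. \<Sum>m\<in>UNIV. entry (e l) m * N m k) e) j" ..
    qed (use e lin_comb_sl2 in blast)+
    moreover have "e l = lin_comb (\<lambda>k. if l = k then 1 else 0) e"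
      unfolding lin_comb_def vec_eq_iff by (simp add: sum_mult_delta(2)[of l "\<lambda>k. e k $ _ $ _"])
    moreover have "e l \<in> sl2" using e by blast
    ultimately have "(\<lambda>k. \<Sum>m\<in>UNIV. entry (e l) m * N m k) = (\<lambda>k. if l = k then 1 else 0)"
      using ex1 by blast
    then show ?thesis by meson
  qed
  with N that show thesis by blast
qed

text \<open>
  Dual bases transform by the matrix of coordinates, so the old dual basis is \<open>x\<^sub>l = \<Sum>\<^sub>i entry (e i) l x'\<^sub>i\<close>
  in terms of the new one \<open>x'\<^sub>i\<close>.
\<close>

lemma basis_change:
  fixes e :: "3 \<Rightarrow> 'k::comm_ring_1^2^2"
  assumes "sl2_basis e"
  obtains \<Psi> \<Psi>' where "E0_iso sl2c (structure_const e) \<Psi> \<Psi>'"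
proof -
  have e: "e i \<in> sl2" for i using assms unfolding sl2_basis_def by blast
  obtain N where N: "\<And>l k. (\<Sum>i\<in>UNIV. N l i * entry (e i) k) = (if l = k then 1 else 0)"
    "\<And>l k. (\<Sum>m\<in>UNIV. entry (e l) m * N m k) = (if l = k then 1 else 0)"
    by (rule dual_basis_exists[OF assms]) blast
  let ?A = "\<lambda>l i. entry (e i) l" and ?B = "\<lambda>l i. N i l"
  have key: "(\<Sum>i\<in>UNIV. structure_const e j k i * entry (e i) l) =
    (if l = 0 then 2 * (entry (e j) 0 * entry (e k) 1 - entry (e j) 1 * entry (e k) 0)
     else if l = 1 then entry (e j) 2 * entry (e k) 0 - entry (e j) 0 * entry (e k) 2
     else 2 * (entry (e j) 1 * entry (e k) 2 - entry (e j) 2 * entry (e k) 1))" for j k l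
    using entry_lie_bracket[OF e e, of j k l] unfolding structure_const[OF assms] entry_lin_comb .
  have AB: "(\<Sum>m\<in>UNIV. ?A l m * ?B m i) = (if l = i then 1 else 0)"
    "(\<Sum>m\<in>UNIV. ?B l m * ?A m i) = (if l = i then 1 else 0)" for l i
    using N(1)[of i l] N(2)[of i l] by (simp_all add: mult.commute eq_commute)
  have "E0_iso sl2c (structure_const e) (esubst ?A) (esubst ?B)"
    by unfold_locales
      (erule esubst_comp | simp add: esubst_inverse[of ?A ?B] esubst_inverse[of ?B ?A] AB esubst_add esubst_mult
        esubst_const esubst_d0[OF key])+
  then show thesis by (rule that)
qed

theorem theorem1p6:
  fixes e :: "3 \<Rightarrow> 'p::prime_card mod_ring^2^2" and f :: "3 \<Rightarrow> int^2^2"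
  assumes "sl2_basis e" and "sl2_basis f"
  shows
    "(odd CARD('p) \<longrightarrow>
        Luk_iso_below (CARD('p) - 1) (structure_const e) \<and>
        \<not> Luk_iso_below CARD('p) (structure_const e) \<and>
        (\<exists>S. finite S \<and> card S = 17 \<and> generates_through (structure_const e) CARD('p) S) \<and>
        (\<forall>S. finite S \<and> generates_through (structure_const e) CARD('p) S \<longrightarrow> 17 \<le> card S)) \<and>
     (CARD('p) = 2 \<longrightarrow> \<not> Luk_iso_below 1 (structure_const e)) \<and>
     (\<forall>q. prime q \<longrightarrow> has_torsion (E1 (structure_const f)) q) \<and>
     \<not> fin_gen_ring (E1 (structure_const f))"
proof -
  obtain \<Psi> \<Psi>' where "E0_iso sl2c (structure_const e) \<Psi> \<Psi>'" by (rule basis_change[OF assms(1)])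
  then interpret e: E0_iso sl2c "structure_const e" \<Psi> \<Psi>' .
  interpret e': E0_iso "structure_const e" sl2c \<Psi>' \<Psi> by (rule e.sym)
  obtain \<Theta> \<Theta>' where "E0_iso sl2c (structure_const f) \<Theta> \<Theta>'" by (rule basis_change[OF assms(2)])
  then interpret f: E0_iso sl2c "structure_const f" \<Theta> \<Theta>' .
  interpret f': E0_iso "structure_const f" sl2c \<Theta>' \<Theta> by (rule f.sym)
  let ?S = "range (\<lambda>g. cls (rep g :: (3, 'p mod_ring) E0))"
  have "\<exists>S. finite S \<and> card S = 17 \<and> generates_through (structure_const e) CARD('p) S" if "odd CARD('p)"
  proof (intro exI conjI)
    show "finite (e.T ` ?S)" by simp
    show "card (e.T ` ?S) = 17"
      using card_standard[OF that] card_image[OF inj_on_subset[OF e.T_inj subset_UNIV], of ?S] by simp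
    show "generates_through (structure_const e) CARD('p) (e.T ` ?S)"
      by (rule e.generates_transfer[OF ring_HR generates_standard[OF that]])
  qed
  moreover have "17 \<le> card S"
    if "odd CARD('p)" "finite S" "generates_through (structure_const e) CARD('p) S" for S
  proof -
    have "generates_through sl2c CARD('p) (e'.T ` S)"
      by (rule e'.generates_transfer[OF e.ring_transfer[OF ring_HR] that(3)])
    then have "17 \<le> card (e'.T ` S)"
      using generators_lower_bound[OF that(1)] that(2) by blast
    also have "\<dots> \<le> card S" by (rule card_image_le[OF that(2)])
    finally show ?thesis .
  qed
  moreover have "\<not> fin_gen_ring (E1 (structure_const f))"
    using f'.fin_gen_transfer[OF f.ring_transfer[OF ring_HR]] not_fin_gen_standard by blast
  ultimately show ?thesis
    using e.Luk_iso_transfer[OF Luk_iso_standard] e'.Luk_iso_transfer not_Luk_iso_odd not_Luk_iso_two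
      f.torsion_transfer[OF has_torsion_standard] by blast
qed

end
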